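(* Let $\mathbb{F}$ be a field and let $m$, $n$, $r\le\min\{m,n\}$ be positive integers. Let $\epsilon_1(s)\mid\dots\mid\epsilon_r(s)$ and $\psi_r(s)\mid\dots\mid\psi_1(s)$ be monic polynomials in $\mathbb{F}[s]$ such that $\frac{\epsilon_i(s)}{\psi_i(s)}$ are irreducible rational functions for $i=1,\dots,r$. Let $q_1\le\dots\le q_r$ be integers and let $(k_1,\dots,k_r)$, $(\ell_1,\dots,\ell_r)$ be partitions of non negative integers. Let $g_1\ge\dots\ge g_r$ be the decreasing reordering of $k_r+\ell_1,\,k_{r-1}+\ell_2,\dots,k_1+\ell_r$. Consider the conditions (a) $\ell_1=\dots=\ell_r=0$ if $r=n$; (b) $k_1=\dots=k_r=0$ if $r=m$; (c) $(-g_r,\dots,-g_1)\prec(\deg(\epsilon_r)-\deg(\psi_r)+q_r,\dots,\deg(\epsilon_1)-\deg(\psi_1)+q_1)$. (Necessity, arbitrary field.) If $R(s)\in\mathbb{F}(s)^{m\times n}$ is a rational matrix with $\operatorname{rank}(R(s))=r$, $\frac{\epsilon_1(s)}{\psi_1(s)},\dots,\frac{\epsilon_r(s)}{\psi_r(s)}$ as invariant rational functions, $q_1,\dots,q_r$ as invariant orders at $\infty$, $k_1,\dots,k_r$ as col-span minimal indices, and $\ell_1,\dots,\ell_r$ as row-span minimal indices, then (a), (b) and (c) hold. (Sufficiency.) Conversely, if $\mathbb{F}$ is algebraically closed, conditions (a), (b) and (c) are sufficient for the existence of a rational matrix $R(s)\in\mathbb{F}(s)^{m\times n}$ with $\operatorname{rank}(R(s))=r$,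 $\frac{\epsilon_1(s)}{\psi_1(s)},\dots,\frac{\epsilon_r(s)}{\psi_r(s)}$ as invariant rational functions, $q_1,\dots,q_r$ as invariant orders at $\infty$, $k_1,\dots,k_r$ as col-span minimal indices and $\ell_1,\dots,\ell_r$ as row-span minimal indices.
   Context: $\mathbb{F}[s]$ is the ring of polynomials and $\mathbb{F}(s)$ its field of fractions; a rational matrix is a matrix with entries in $\mathbb{F}(s)$, and its rank is its rank over $\mathbb{F}(s)$. Invariant rational functions: for $R(s)\in\mathbb{F}(s)^{m\times n}$ of rank $r$ there are unimodular matrices $U(s),V(s)$ (square polynomial matrices with polynomial inverse) such that $U(s)R(s)V(s)=\begin{bmatrix}\operatorname{diag}\left(\frac{\epsilon_1(s)}{\psi_1(s)},\dots,\frac{\epsilon_r(s)}{\psi_r(s)}\right)&0\\0&0\end{bmatrix}$ (Smith--McMillan form), with $\epsilon_1\mid\dots\mid\epsilon_r$ and $\psi_r\mid\dots\mid\psi_1$ monic polynomials and each $\epsilon_i/\psi_i$ irreducible (numerator and denominator coprime). These fractions are uniquely determined and are the (finite) invariant rational functions of $R(s)$. Invariant orders at infinity: a rational function is proper if the degree of its numerator is at most that of its denominator; a biproper matrix is an invertible square matrix of proper rational functions whose inverse also has proper entries. For $R(s)$ of rank $r$ there are biproper matrices $B_1(s),B_2(s)$ with $B_1(s)R(s)B_2(s)=\begin{bmatrix}\operatorname{diag}(s^{-q_1},\dots,s^{-q_r})&0\\0&0\end{bmatrix}$, where $q_1\le\dots\le q_r$ are uniquely determined integers, called the invariant orders at infinity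 of $R(s)$. For $P(s)\in\mathbb{F}(s)^{m\times n}$, $\mathcal{R}(P(s))\subseteq\mathbb{F}(s)^m$ is the $\mathbb{F}(s)$-subspace spanned by the columns of $P(s)$. A polynomial basis of a subspace $\mathcal{V}$ of $\mathbb{F}(s)^p$ is a basis consisting of polynomial vectors; its order is the sum of the degrees of its vectors (degree of a vector = maximum degree of its entries). A minimal basis of $\mathcal{V}$ is a polynomial basis of least order. The decreasingly ordered list of degrees of the vectors is the same for all minimal bases of $\mathcal{V}$; these degrees are the minimal indices of $\mathcal{V}$. The col-span (row-span) minimal indices of $P(s)$ are the minimal indices of $\mathcal{R}(P(s))$ ($\mathcal{R}(P(s)^T)$), ordered decreasingly. A partition is a non-increasing sequence of non negative integers. For sequences of integers $a_1\ge\dots\ge a_r$ and $b_1\ge\dots\ge b_r$, $(a_1,\dots,a_r)\prec(b_1,\dots,b_r)$ (majorization) means $\sum_{i=1}^k a_i\le\sum_{i=1}^k b_i$ for $1\le k\le r-1$ and $\sum_{i=1}^r a_i=\sum_{i=1}^r b_i$. *)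

theory Defs
  imports
    "Jordan_Normal_Form.DL_Rank"
    "HOL-Computational_Algebra.Polynomial_Factorial"
begin

text \<open>
  \<^typ>\<open>'a poly fract\<close> plays the role of $\mathbb{F}(s)$. Sequences $x_1,\dots,x_r$ are lists of
  length $r$, so $x_i$ is \<open>x ! (i - 1)\<close>.
\<close>

definition diagonal_form :: "nat \<Rightarrow> nat \<Rightarrow> 'b::zero list \<Rightarrow> 'b mat" where
  "diagonal_form m n ds = mat m n (\<lambda>(i, j). if i = j \<and> i < length ds then ds ! i else 0)"

text \<open>
  For a polynomial matrix, \<^const>\<open>invertible_mat\<close> asks for an inverse over the
  polynomial ring, i.e. for unimodularity. The pair \<open>eps\<close>, \<open>psi\<close> lists the reduced numerators
  and denominators of the invariant rational functions.
\<close>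

definition invariant_rational_functions ::
    "'a::field poly fract mat \<Rightarrow> 'a poly list \<Rightarrow> 'a poly list \<Rightarrow> bool" where
  "invariant_rational_functions R eps psi \<longleftrightarrow>
     length eps = length psi \<and> length eps \<le> min (dim_row R) (dim_col R) \<and>
     (\<forall>p \<in> set eps \<union> set psi. lead_coeff p = 1) \<and>
     sorted_wrt (dvd) eps \<and> sorted_wrt (\<lambda>p q. q dvd p) psi \<and>
     (\<forall>i < length eps. coprime (eps ! i) (psi ! i)) \<and>
     (\<exists>U \<in> carrier_mat (dim_row R) (dim_row R). \<exists>V \<in> carrier_mat (dim_col R) (dim_col R).
        invertible_mat U \<and> invertible_mat V \<and>
        map_mat to_fract U * R * map_mat to_fract V =
          diagonal_form (dim_row R) (dim_col R) (map2 Fract eps psi))"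

text \<open>Since \<open>degree 0 = 0\<close>, the zero function is proper, as it should be.\<close>

definition proper :: "'a::field poly fract \<Rightarrow> bool" where
  "proper f \<longleftrightarrow> (\<exists>a b. b \<noteq> 0 \<and> f = Fract a b \<and> degree a \<le> degree b)"

definition biproper :: "nat \<Rightarrow> 'a::field poly fract mat \<Rightarrow> bool" where
  "biproper n B \<longleftrightarrow>
     B \<in> carrier_mat n n \<and> elements_mat B \<subseteq> Collect proper \<and>
     (\<exists>C \<in> carrier_mat n n. elements_mat C \<subseteq> Collect proper \<and> B * C = 1\<^sub>m n \<and> C * B = 1\<^sub>m n)"

definition invariant_orders_at_infinity :: "'a::field poly fract mat \<Rightarrow> int list \<Rightarrow> bool" where
  "invariant_orders_at_infinity R q \<longleftrightarrow>
     length q \<le> min (dim_row R) (dim_col R) \<and> sorted q \<and>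
     (\<exists>B\<^sub>1 B\<^sub>2. biproper (dim_row R) B\<^sub>1 \<and> biproper (dim_col R) B\<^sub>2 \<and>
        B\<^sub>1 * R * B\<^sub>2 =
          diagonal_form (dim_row R) (dim_col R) (map (\<lambda>x. to_fract [:0, 1:] powi (- x)) q))"

text \<open>
  Basis vectors are nonzero, so the convention \<open>degree 0 = 0\<close> does not affect the maximum.
\<close>

definition vec_degree :: "'a::zero poly vec \<Rightarrow> nat" where
  "vec_degree v = Max {degree (v $ i) | i. i < dim_vec v}"

text \<open>
  \<open>B\<close> is a set of vectors over the polynomial ring whose (injective) image over the fraction
  field is a basis of the subspace \<open>W\<close> of the space of \<open>p\<close>-vectors.
\<close>

definition polynomial_basis ::
    "nat \<Rightarrow> 'a::field poly fract vec set \<Rightarrow> 'a poly vec set \<Rightarrow> bool" where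
  "polynomial_basis p W B \<longleftrightarrow>
     finite B \<and> B \<subseteq> carrier_vec p \<and>
     vectorspace.basis class_ring (module_vec TYPE('a poly fract) p\<lparr>carrier := W\<rparr>)
       (map_vec to_fract ` B)"

definition minimal_basis ::
    "nat \<Rightarrow> 'a::field poly fract vec set \<Rightarrow> 'a poly vec set \<Rightarrow> bool" where
  "minimal_basis p W B \<longleftrightarrow>
     polynomial_basis p W B \<and>
     (\<forall>B'. polynomial_basis p W B' \<longrightarrow> sum vec_degree B \<le> sum vec_degree B')"

definition minimal_indices :: "nat \<Rightarrow> 'a::field poly fract vec set \<Rightarrow> nat list \<Rightarrow> bool" where
  "minimal_indices p W ks \<longleftrightarrow>
     (\<exists>B. minimal_basis p W B \<and>
        ks = rev (sorted_list_of_multiset (image_mset vec_degree (mset_set B))))"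

definition col_span_minimal_indices :: "'a::field poly fract mat \<Rightarrow> nat list \<Rightarrow> bool" where
  "col_span_minimal_indices P ks \<longleftrightarrow>
     minimal_indices (dim_row P) (vec_space.col_space (dim_row P) P) ks"

definition row_span_minimal_indices :: "'a::field poly fract mat \<Rightarrow> nat list \<Rightarrow> bool" where
  "row_span_minimal_indices P ls \<longleftrightarrow> col_span_minimal_indices (transpose_mat P) ls"

definition has_invariants ::
    "'a::field poly fract mat \<Rightarrow> nat \<Rightarrow> 'a poly list \<Rightarrow> 'a poly list \<Rightarrow> int list \<Rightarrow>
     nat list \<Rightarrow> nat list \<Rightarrow> bool" where
  "has_invariants R r eps psi q k l \<longleftrightarrow>
     vec_space.rank (dim_row R) R = r \<and>
     invariant_rational_functions R eps psi \<and>
     invariant_orders_at_infinity R q \<and>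
     col_span_minimal_indices R k \<and>
     row_span_minimal_indices R l"

text \<open>Meant for nonincreasing lists only; no reordering is performed.\<close>

definition majorized :: "int list \<Rightarrow> int list \<Rightarrow> bool" (infix \<open>\<prec>\<^sub>m\<close> 50) where
  "a \<prec>\<^sub>m b \<longleftrightarrow>
     length a = length b \<and>
     (\<forall>k < length a. sum_list (take k a) \<le> sum_list (take k b)) \<and>
     sum_list a = sum_list b"

end

theory Submission
  imports Defs
begin

text \<open>
  Let \<open>K = F(s)\<close> and let \<open>S\<close> be one of two subrings of \<open>K\<close>: the polynomials or the proper rational
  functions. The Smith--McMillan form and the form at infinity are the same notion for these two
  choices of \<open>S\<close>: a diagonal form under multiplication by matrices invertible over \<open>S\<close>. This is
  why the lemmas on matrices are stated for a subring \<open>S\<close> of a field.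

  \<^bold>\<open>Reduction to square matrices.\<close> Let \<open>P\<close> and \<open>Q\<close> have as columns minimal bases of the column
  space of \<open>R\<close> and of its row space. Then \<open>R = P E Q\<^sup>T\<close> with a square nonsingular \<open>E\<close> of size \<open>r\<close>. A
  polynomial basis with column degrees \<open>k\<close> is minimal exactly if \<open>P\<close> has a polynomial left inverse
  and \<open>P s\<^sup>-\<^sup>k\<close> has a proper one, where \<open>s\<^sup>k\<close> stands for the diagonal matrix with entries
  \<open>s\<^sup>k\<^sup>i\<close> (\<open>minimal_basis_left_inverses\<close>, \<open>left_inverses_imp_minimal_basis\<close>). Hence \<open>R\<close> and \<open>E\<close> have the
  same finite invariants, and the invariant orders at infinity of \<open>R\<close> are those of
  \<open>F = s\<^sup>k E s\<^sup>l\<close>: everything is now a statement about \<open>E\<close>.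

  \<^bold>\<open>Necessity.\<close> Let \<open>a\<^sub>i = deg \<epsilon>\<^sub>i - deg \<psi>\<^sub>i + q\<^sub>i\<close>. A minor of \<open>E\<close> of size \<open>t\<close> is a polynomial multiple of the
  product of the first \<open>t\<close> invariant rational functions, and the corresponding minor of \<open>F\<close> is a proper
  multiple of \<open>s\<close> to the power \<open>-(q\<^sub>1 + \<dots> + q\<^sub>t)\<close> (\<open>determinantal_comparison\<close>). Comparing degrees, a nonzero
  minor with rows \<open>I\<close> and columns \<open>J\<close> forces the sum of \<open>k\<close> over \<open>I\<close> plus the sum of \<open>l\<close> over \<open>J\<close> to be
  at most \<open>-(a\<^sub>1 + \<dots> + a\<^sub>t)\<close>. A nonsingular matrix has a nonzero minor whose weight is at least the
  sum of any \<open>t\<close> of the numbers \<open>k\<^sub>i + l\<^sub>j\<close> with \<open>i + j = r + 1\<close> (\<open>exists_nonsingular_minor\<close>), because the pairing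
  of large with small is the least favourable one. This gives the inequalities; for \<open>t = r\<close> the
  two divisibilities can be reversed, which gives the equality. If \<open>P\<close> is square, its determinant and
  that of \<open>P s\<^sup>-\<^sup>k\<close> both have degree zero, so \<open>k\<close> vanishes.

  \<^bold>\<open>Sufficiency.\<close> A matrix \<open>E\<close> with prescribed invariants is built by induction on \<open>r\<close> as a bordered
  matrix with corner \<open>f\<close>, first column \<open>x\<close> and remaining block \<open>E'\<close> (\<open>exists_square_with_invariants\<close>). Choose \<open>j\<close>
  with \<open>a\<^sub>j \<le> -(k\<^sub>1 + l\<^sub>1) \<le> a\<^sub>j\<^sub>+\<^sub>1\<close>. Over an algebraically closed field the invariants with indices \<open>j\<close>
  and \<open>j + 1\<close> can be merged into one: there are a rational function \<open>f\<close> between the two invariant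
  rational functions with respect to divisibility and an integer \<open>p\<close> between the two orders such that
  \<open>deg f + p = -(k\<^sub>1 + l\<^sub>1)\<close>.
  The block \<open>E'\<close> takes the merged invariants, for which majorization persists. The column \<open>x\<close> only
  matters modulo the corner, at the finite places and, after scaling, at infinity; as \<open>k\<^sub>1\<close> is the
  largest of the \<open>k\<^sub>i\<close>, both congruences can be satisfied together
  (\<open>approximation_at_both_places\<close>). Finally \<open>P\<close> and \<open>Q\<close> are written down explicitly.

  Majorization enters in a form that involves no reordering: for every set of \<open>t\<close> indices the numbers
  \<open>-(k\<^sub>i + l\<^sub>r\<^sub>+\<^sub>1\<^sub>-\<^sub>i)\<close> add up to at least \<open>a\<^sub>1 + \<dots> + a\<^sub>t\<close>, with equality in total (\<open>majorized_iff_subset_sums\<close>).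
\<close>

section \<open>Degrees of rational functions\<close>

abbreviation s_var :: "'a::field poly fract" where
  "s_var \<equiv> to_fract [:0, 1:]"

text \<open>
  Degree of the numerator minus degree of the denominator, for any representation of a nonzero function; the
  value at zero is unspecified, so statements about sizes use \<open>deg_le\<close> below.
\<close>

definition rdeg :: "'a::field poly fract \<Rightarrow> int" where
  "rdeg f = (SOME d. \<exists>a b. a \<noteq> 0 \<and> b \<noteq> 0 \<and> f = Fract a b \<and> d = int (degree a) - int (degree b))"

lemma rdeg_Fract:
  assumes "a \<noteq> 0" "b \<noteq> 0"
  shows "rdeg (Fract a b) = int (degree a) - int (degree b)"
  unfolding rdeg_def
proof (rule some_equality)
  fix d
  assume "\<exists>a' b'. a' \<noteq> 0 \<and> b' \<noteq> 0 \<and> Fract a b = Fract a' b' \<and> d = int (degree a') - int (degree b')"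
  then obtain a' b' where *: "a' \<noteq> 0" "b' \<noteq> 0" "Fract a b = Fract a' b'"
    "d = int (degree a') - int (degree b')" by blast
  then have "a * b' = a' * b" using assms by (simp add: eq_fract)
  then have "degree (a * b') = degree (a' * b)" by simp
  then have "degree a + degree b' = degree a' + degree b"
    using * assms by (simp add: degree_mult_eq)
  then show "d = int (degree a) - int (degree b)" using * by linarith
qed (use assms in blast)

lemma fract_nonzero_cases:
  assumes "f \<noteq> 0"
  obtains a b where "a \<noteq> 0" "b \<noteq> 0" "f = Fract a b"
proof (cases f)
  case (Fract a b)
  then show thesis using assms that by (metis fract_collapse(1))
qed

lemma rdeg_to_fract: "p \<noteq> 0 \<Longrightarrow> rdeg (to_fract p) = int (degree p)"
  by (simp add: to_fract_def rdeg_Fract)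

lemma rdeg_mult: "f \<noteq> 0 \<Longrightarrow> g \<noteq> 0 \<Longrightarrow> rdeg (f * g) = rdeg f + rdeg g"
  by (elim fract_nonzero_cases) (simp add: rdeg_Fract degree_mult_eq)

lemma rdeg_inverse: "f \<noteq> 0 \<Longrightarrow> rdeg (inverse f) = - rdeg f"
  by (elim fract_nonzero_cases) (simp add: rdeg_Fract)

lemma rdeg_divide: "f \<noteq> 0 \<Longrightarrow> g \<noteq> 0 \<Longrightarrow> rdeg (f / g) = rdeg f - rdeg g"
  by (simp add: divide_inverse rdeg_mult rdeg_inverse)

lemma rdeg_uminus: "f \<noteq> 0 \<Longrightarrow> rdeg (- f) = rdeg f"
  by (elim fract_nonzero_cases) (simp add: rdeg_Fract)

lemma rdeg_1 [simp]: "rdeg 1 = 0"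
  using rdeg_to_fract[of 1] by simp

lemma rdeg_power: "f \<noteq> 0 \<Longrightarrow> rdeg (f ^ n) = int n * rdeg f"
  by (induction n) (auto simp: rdeg_mult algebra_simps)

lemma s_var_nonzero [simp]: "s_var \<noteq> (0 :: 'a::field poly fract)"
  by simp

lemma rdeg_s_powi [simp]: "rdeg (s_var powi d) = d"
  by (auto simp: power_int_def rdeg_power rdeg_inverse rdeg_to_fract)

lemma rdeg_prod: "(\<And>i. i \<in> A \<Longrightarrow> f i \<noteq> 0) \<Longrightarrow> rdeg (\<Prod>i\<in>A. f i) = (\<Sum>i\<in>A. rdeg (f i))"
  by (induction A rule: infinite_finite_induct) (auto simp: rdeg_mult)

text \<open>
  The zero function satisfies every bound, as if its degree were minus infinity; this makes the bounds stable
  under sums and products.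
\<close>

definition deg_le :: "'a::field poly fract \<Rightarrow> int \<Rightarrow> bool" where
  "deg_le f d \<longleftrightarrow> f = 0 \<or> rdeg f \<le> d"

lemma deg_le_0 [simp]: "deg_le 0 d"
  by (simp add: deg_le_def)

lemma deg_le_mono: "deg_le f d \<Longrightarrow> d \<le> e \<Longrightarrow> deg_le f e"
  by (auto simp: deg_le_def)

lemma deg_le_mult: "deg_le f d \<Longrightarrow> deg_le g e \<Longrightarrow> deg_le (f * g) (d + e)"
  by (cases "f = 0"; cases "g = 0") (auto simp: deg_le_def rdeg_mult)

lemma deg_le_uminus [simp]: "deg_le (- f) d = deg_le f d"
  by (cases "f = 0") (auto simp: deg_le_def rdeg_uminus)

lemma deg_le_s_powi [simp]: "deg_le (s_var powi d :: 'a::field poly fract) e \<longleftrightarrow> d \<le> e"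
  by (auto simp: deg_le_def)

lemma deg_le_to_fract: "p \<noteq> 0 \<Longrightarrow> deg_le (to_fract p) d \<longleftrightarrow> int (degree p) \<le> d"
  by (auto simp: deg_le_def rdeg_to_fract)

lemma deg_le_add:
  assumes "deg_le f d" "deg_le g d"
  shows "deg_le (f + g) d"
proof (cases "f = 0 \<or> g = 0 \<or> f + g = 0")
  case False
  then obtain a b a' b' where *: "a \<noteq> 0" "b \<noteq> 0" "f = Fract a b" "a' \<noteq> 0" "b' \<noteq> 0" "g = Fract a' b'"
    by (metis fract_nonzero_cases)
  have fg: "f + g = Fract (a * b' + a' * b) (b * b')" using * by simp
  then have nz: "a * b' + a' * b \<noteq> 0" using False by (auto simp: fract_collapse)
  have "degree (a * b' + a' * b) \<le> max (degree (a * b')) (degree (a' * b))"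
    by (rule degree_add_le_max)
  moreover have "degree (a * b') = degree a + degree b'" "degree (a' * b) = degree a' + degree b"
    using * by (simp_all add: degree_mult_eq)
  moreover have "int (degree a) - int (degree b) \<le> d" "int (degree a') - int (degree b') \<le> d"
    using assms False * by (auto simp: deg_le_def rdeg_Fract)
  moreover have "rdeg (f + g) = int (degree (a * b' + a' * b)) - (int (degree b) + int (degree b'))"
    unfolding fg using nz * by (simp add: rdeg_Fract degree_mult_eq)
  ultimately have "rdeg (f + g) \<le> d" by linarith
  then show ?thesis by (simp add: deg_le_def)
qed (use assms in \<open>auto simp: deg_le_def\<close>)

lemma deg_le_diff: "deg_le f d \<Longrightarrow> deg_le g d \<Longrightarrow> deg_le (f - g) d"
  using deg_le_add[of f d "- g"] by simp

lemma deg_le_sum: "(\<And>i. i \<in> A \<Longrightarrow> deg_le (f i) d) \<Longrightarrow> deg_le (\<Sum>i\<in>A. f i) d"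
  by (induction A rule: infinite_finite_induct) (auto simp: deg_le_add)

lemma proper_iff_deg_le: "proper f \<longleftrightarrow> deg_le f 0"
proof
  assume "proper f"
  then obtain a b where *: "b \<noteq> 0" "f = Fract a b" "degree a \<le> degree b"
    by (auto simp: proper_def)
  then show "deg_le f 0"
    by (cases "a = 0") (auto simp: deg_le_def rdeg_Fract fract_collapse)
next
  assume *: "deg_le f 0"
  show "proper f"
  proof (cases "f = 0")
    case True
    then show ?thesis unfolding proper_def
      by (intro exI[of _ 0] exI[of _ 1]) (simp add: fract_collapse)
  next
    case False
    then obtain a b where ab: "a \<noteq> 0" "b \<noteq> 0" "f = Fract a b" by (rule fract_nonzero_cases)
    then have "degree a \<le> degree b" using * False by (auto simp: deg_le_def rdeg_Fract)
    then show ?thesis unfolding proper_def using ab by blast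
  qed
qed

text \<open>
  Division with remainder of the numerator by the denominator. The strictly proper part is what makes it
  possible to correct a polynomial vector by one of smaller degree, and to combine congruences at the finite
  places with congruences at infinity.
\<close>

lemma polynomial_part:
  fixes f :: "'a::field poly fract"
  obtains p h where "f = to_fract p + h" "deg_le h (- 1)"
proof (cases f)
  case (Fract a b)
  have "to_fract a = to_fract b * to_fract (a div b) + to_fract (a mod b)"
    by (simp flip: to_fract_mult to_fract_add)
  then have "f = to_fract (a div b) + to_fract (a mod b) / to_fract b"
    using Fract by (simp add: field_simps Fract_conv_to_fract)
  moreover have "deg_le (to_fract (a mod b) / to_fract b) (- 1)"
    using Fract degree_mod_less[of b a]
    by (cases "a mod b = 0") (auto simp: deg_le_def rdeg_divide rdeg_to_fract)
  ultimately show ?thesis using that by blast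
qed

lemma polynomial_deg_le_negative:
  assumes "deg_le (to_fract p) d" "d < 0"
  shows "p = 0"
  using assms by (cases "p = 0") (auto simp: deg_le_to_fract)

lemma rdeg_prod_lessThan: "(\<And>i. i < (n::nat) \<Longrightarrow> f i \<noteq> 0) \<Longrightarrow> rdeg (\<Prod>i<n. f i) = (\<Sum>i<n. rdeg (f i))"
  by (rule rdeg_prod) auto

lemma to_fract_monom: "to_fract (monom 1 d) = s_var powi int d"
proof -
  have "monom 1 d = ([:0, 1:] :: 'a poly) ^ d" by (rule monom_altdef[of 1, simplified])
  moreover have "to_fract (p ^ d) = to_fract p ^ d" for p :: "'a poly" by (induction d) auto
  ultimately show ?thesis by simp
qed

section \<open>Matrices over a subring of a field\<close>

text \<open>
  Only two subrings occur, the polynomials and the proper functions, but the arguments are the same for both.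
\<close>

locale subring_of_field =
  fixes S :: "'b::field set"
  assumes zero_mem [simp, intro]: "0 \<in> S"
    and one_mem [simp, intro]: "1 \<in> S"
    and add_mem [intro]: "x \<in> S \<Longrightarrow> y \<in> S \<Longrightarrow> x + y \<in> S"
    and uminus_mem [intro]: "x \<in> S \<Longrightarrow> - x \<in> S"
    and mult_mem [intro]: "x \<in> S \<Longrightarrow> y \<in> S \<Longrightarrow> x * y \<in> S"
begin

lemma diff_mem [intro]: "x \<in> S \<Longrightarrow> y \<in> S \<Longrightarrow> x - y \<in> S"
  using add_mem[of x "- y"] by auto

lemma sum_mem [intro]: "(\<And>i. i \<in> A \<Longrightarrow> f i \<in> S) \<Longrightarrow> sum f A \<in> S"
  by (induction A rule: infinite_finite_induct) auto

lemma prod_mem [intro]: "(\<And>i. i \<in> A \<Longrightarrow> f i \<in> S) \<Longrightarrow> prod f A \<in> S"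
  by (induction A rule: infinite_finite_induct) auto

lemma power_mem [intro]: "x \<in> S \<Longrightarrow> x ^ n \<in> S"
  by (induction n) auto

text \<open>
  Matrices with entries in \<open>S\<close> are kept as matrices over the field, so that both subrings can be
  used for the same matrix.
\<close>

definition over :: "'b mat \<Rightarrow> bool" where
  "over A \<longleftrightarrow> (\<forall>i < dim_row A. \<forall>j < dim_col A. A $$ (i, j) \<in> S)"

lemma over_iff_elements: "over A \<longleftrightarrow> elements_mat A \<subseteq> S"
  by (auto simp: over_def elements_mat_def UN_subset_iff image_subset_iff)

lemma over_one [simp]: "over (1\<^sub>m n)"
  by (auto simp: over_def one_mat_def)

lemma over_mult:
  assumes "over A" "over B" "dim_col A = dim_row B"
  shows "over (A * B)"
  using assms by (auto simp: over_def scalar_prod_def intro!: sum_mem mult_mem)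

lemma over_transpose [simp]: "over A\<^sup>T \<longleftrightarrow> over A"
  by (auto simp: over_def)

lemma det_mem:
  assumes "over A" "A \<in> carrier_mat n n"
  shows "det A \<in> S"
proof -
  have "signof p \<in> S" for p :: "nat \<Rightarrow> nat"
    by (auto simp: sign_def)
  then show ?thesis
    unfolding det_def'[OF assms(2)] using assms
    by (fastforce intro!: sum_mem mult_mem prod_mem simp: over_def dest: permutes_in_image)
qed

definition invertible_over :: "nat \<Rightarrow> 'b mat \<Rightarrow> bool" where
  "invertible_over n A \<longleftrightarrow> A \<in> carrier_mat n n \<and> over A \<and>
     (\<exists>B \<in> carrier_mat n n. over B \<and> A * B = 1\<^sub>m n \<and> B * A = 1\<^sub>m n)"

lemma invertible_over_carrier: "invertible_over n A \<Longrightarrow> A \<in> carrier_mat n n"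
  by (simp add: invertible_over_def)

lemma invertible_over_over: "invertible_over n A \<Longrightarrow> over A"
  by (simp add: invertible_over_def)

lemma invertible_overE:
  assumes "invertible_over n A"
  obtains B where "invertible_over n B" "A * B = 1\<^sub>m n" "B * A = 1\<^sub>m n"
  using assms by (auto simp: invertible_over_def)

lemma invertible_over_one [simp]: "invertible_over n (1\<^sub>m n)"
  by (auto simp: invertible_over_def intro!: bexI[of _ "1\<^sub>m n"])

lemma invertible_over_mult:
  assumes "invertible_over n A" "invertible_over n B"
  shows "invertible_over n (A * B)"
proof -
  obtain A' where A': "invertible_over n A'" "A * A' = 1\<^sub>m n" "A' * A = 1\<^sub>m n"
    using assms(1) by (rule invertible_overE)
  obtain B' where B': "invertible_over n B'" "B * B' = 1\<^sub>m n" "B' * B = 1\<^sub>m n"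
    using assms(2) by (rule invertible_overE)
  note c = invertible_over_carrier[OF assms(1)] invertible_over_carrier[OF assms(2)]
    invertible_over_carrier[OF A'(1)] invertible_over_carrier[OF B'(1)]
  note o = invertible_over_over[OF assms(1)] invertible_over_over[OF assms(2)]
    invertible_over_over[OF A'(1)] invertible_over_over[OF B'(1)]
  have "A * B * (B' * A') = A * (B * B') * A'"
    using c by (simp add: assoc_mult_mat[of _ n n _ n _ n])
  moreover have "B' * A' * (A * B) = B' * (A' * A) * B"
    using c by (simp add: assoc_mult_mat[of _ n n _ n _ n])
  ultimately show ?thesis unfolding invertible_over_def
    using A' B' c o by (intro conjI bexI[of _ "B' * A'"] over_mult) auto
qed

lemma invertible_over_transpose:
  assumes "invertible_over n A"
  shows "invertible_over n A\<^sup>T"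
proof -
  obtain B where B: "invertible_over n B" "A * B = 1\<^sub>m n" "B * A = 1\<^sub>m n"
    using assms by (rule invertible_overE)
  note c = invertible_over_carrier[OF assms(1)] invertible_over_carrier[OF B(1)]
  have "A\<^sup>T * B\<^sup>T = 1\<^sub>m n" "B\<^sup>T * A\<^sup>T = 1\<^sub>m n"
    using B c by (metis transpose_mult transpose_one)+
  then show ?thesis unfolding invertible_over_def
    using assms B c by (intro conjI bexI[of _ "B\<^sup>T"]) (auto simp: invertible_over_over)
qed

text \<open>
  The adjugate matrix consists of minors, so it is again a matrix over \<open>S\<close>.
\<close>

lemma invertible_over_if_det:
  assumes A: "A \<in> carrier_mat n n" "over A" and u: "det A * u = 1" "u \<in> S"
  shows "invertible_over n A"
proof -
  have "over (u \<cdot>\<^sub>m adj_mat A)"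
    unfolding over_def
  proof (intro allI impI)
    fix i j assume ij: "i < dim_row (u \<cdot>\<^sub>m adj_mat A)" "j < dim_col (u \<cdot>\<^sub>m adj_mat A)"
    have "over (mat_delete A j i)"
      using A ij by (auto simp: over_def mat_delete_def adj_mat_def)
    then have "det (mat_delete A j i) \<in> S"
      using A by (intro det_mem[of _ "n - 1"]) (auto simp: mat_delete_def)
    then show "(u \<cdot>\<^sub>m adj_mat A) $$ (i, j) \<in> S"
      using ij u A by (auto simp: adj_mat_def cofactor_def intro!: mult_mem power_mem)
  qed
  moreover have "u \<cdot>\<^sub>m (det A \<cdot>\<^sub>m 1\<^sub>m n) = 1\<^sub>m n"
    using u by (intro eq_matI) (auto simp: mult.commute)
  then have "A * (u \<cdot>\<^sub>m adj_mat A) = 1\<^sub>m n" "(u \<cdot>\<^sub>m adj_mat A) * A = 1\<^sub>m n"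
    using adj_mat[OF A(1)] A u
    by (auto simp: mult_smult_distrib mult_smult_assoc_mat[of _ n n])
  ultimately show ?thesis
    unfolding invertible_over_def using A adj_mat(1)[OF A(1)] by (intro conjI bexI[of _ "u \<cdot>\<^sub>m adj_mat A"]) auto
qed

end

interpretation polyring: subring_of_field "range (to_fract :: 'a::field poly \<Rightarrow> 'a poly fract)"
proof
  show "0 \<in> range (to_fract :: 'a poly \<Rightarrow> 'a poly fract)" by (metis rangeI to_fract_0)
  show "1 \<in> range (to_fract :: 'a poly \<Rightarrow> 'a poly fract)" by (metis rangeI to_fract_1)
qed (auto simp flip: to_fract_add to_fract_mult to_fract_uminus)

interpretation properring: subring_of_field "Collect (proper :: 'a::field poly fract \<Rightarrow> bool)"
proof
  show "1 \<in> Collect (proper :: 'a poly fract \<Rightarrow> bool)"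
    by (simp add: proper_iff_deg_le deg_le_def)
qed (auto simp: proper_iff_deg_le deg_le_add intro: deg_le_mult[where d = 0 and e = 0, simplified])

lemma biproper_iff: "biproper n B \<longleftrightarrow> properring.invertible_over n B"
  by (auto simp: biproper_def properring.invertible_over_def properring.over_iff_elements)

lemma map_to_fract_over: "polyring.over (map_mat to_fract A)"
  by (auto simp: polyring.over_def)

lemma over_polyD:
  assumes "polyring.over A"
  obtains A' where "A' \<in> carrier_mat (dim_row A) (dim_col A)" "A = map_mat to_fract A'"
proof -
  have "A = map_mat to_fract (map_mat (inv_into UNIV to_fract) A)"
    using assms by (intro eq_matI) (auto simp: polyring.over_def f_inv_into_f)
  then show ?thesis using that[of "map_mat (inv_into UNIV to_fract) A"] by auto
qed

lemma map_to_fract_mult: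
  assumes "A \<in> carrier_mat a b" "B \<in> carrier_mat b c"
  shows "map_mat to_fract (A * B) = map_mat to_fract A * map_mat to_fract B"
  using assms by (intro eq_matI) (auto simp: scalar_prod_def)

lemma map_to_fract_one [simp]: "map_mat to_fract (1\<^sub>m n) = 1\<^sub>m n"
  by (intro eq_matI) auto

lemma map_to_fract_inj: "map_mat to_fract A = map_mat to_fract B \<Longrightarrow> A = B"
  by (metis (no_types, lifting) eq_matI index_map_mat(1) index_map_mat(2) index_map_mat(3) to_fract_eq_iff)

lemma unimodular_imp_invertible_over:
  assumes "U \<in> carrier_mat n n" "invertible_mat U"
  shows "polyring.invertible_over n (map_mat to_fract U)"
proof -
  obtain W where W: "U * W = 1\<^sub>m (dim_row U)" "W * U = 1\<^sub>m (dim_row W)"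
    using assms(2) by (auto simp: invertible_mat_def inverts_mat_def)
  have "W \<in> carrier_mat n n"
    using W assms(1) by (metis carrier_matD carrier_matI index_mult_mat(2,3) index_one_mat(2,3))
  then show ?thesis
    unfolding polyring.invertible_over_def using W assms(1)
    by (auto simp: map_to_fract_over simp flip: map_to_fract_mult
        intro!: bexI[of _ "map_mat to_fract W"])
qed

lemma invertible_over_imp_unimodular:
  assumes "polyring.invertible_over n A"
  obtains U where "U \<in> carrier_mat n n" "invertible_mat U" "A = map_mat to_fract U"
proof -
  obtain B where B: "polyring.invertible_over n B" "A * B = 1\<^sub>m n" "B * A = 1\<^sub>m n"
    using assms by (rule polyring.invertible_overE)
  obtain U where U: "U \<in> carrier_mat n n" "A = map_mat to_fract U"
    using over_polyD[OF polyring.invertible_over_over[OF assms]]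
      polyring.invertible_over_carrier[OF assms] by (metis carrier_matD)
  obtain W where W: "W \<in> carrier_mat n n" "B = map_mat to_fract W"
    using over_polyD[OF polyring.invertible_over_over[OF B(1)]]
      polyring.invertible_over_carrier[OF B(1)] by (metis carrier_matD)
  have "U * W = 1\<^sub>m n" "W * U = 1\<^sub>m n"
    using B(2,3) U W by (metis map_to_fract_inj map_to_fract_mult map_to_fract_one)+
  then have "invertible_mat U"
    using U W unfolding invertible_mat_def inverts_mat_def by auto
  then show ?thesis using that U by blast
qed

section \<open>Matrix computations\<close>

lemma mult_mat_vec_index_sum:
  assumes "P \<in> carrier_mat m r" "c \<in> carrier_vec r" "i < m"
  shows "(P *\<^sub>v c) $ i = (\<Sum>j<r. P $$ (i, j) * c $ j)"
  using assms by (simp add: scalar_prod_def atLeast0LessThan)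

lemma mult_mat_index_sum:
  "A \<in> carrier_mat p q \<Longrightarrow> B \<in> carrier_mat q u \<Longrightarrow> i < p \<Longrightarrow> j < u \<Longrightarrow>
    (A * B) $$ (i, j) = (\<Sum>k<q. A $$ (i, k) * B $$ (k, j))"
  by (simp add: scalar_prod_def atLeast0LessThan)

lemma mult_mat_zero_vec: "A \<in> carrier_mat nr nc \<Longrightarrow> A *\<^sub>v 0\<^sub>v nc = (0\<^sub>v nr :: 'b::semiring_0 vec)"
  by (intro eq_vecI) auto

text \<open>
  Inserting scalings and their inverses on both sides of the middle factor: this is how \<open>P E
  Q\<^sup>T\<close> is rewritten as \<open>(P s\<^sup>-\<^sup>k) (s\<^sup>k E s\<^sup>l) (Q
  s\<^sup>-\<^sup>l)\<^sup>T\<close>.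
\<close>

lemma sandwich_cancel:
  fixes P :: "'b::comm_ring_1 mat"
  assumes P: "P \<in> carrier_mat m r" and A: "A1 \<in> carrier_mat r r" "A2 \<in> carrier_mat r r"
    and E: "E \<in> carrier_mat r r" and B: "B1 \<in> carrier_mat r r" "B2 \<in> carrier_mat r r"
    and Q: "Q \<in> carrier_mat r n" and inv: "A1 * A2 = 1\<^sub>m r" "B1 * B2 = 1\<^sub>m r"
  shows "P * A1 * (A2 * E * B1) * (B2 * Q) = P * E * Q"
proof -
  have "P * A1 * (A2 * E * B1) * (B2 * Q) = P * (A1 * A2) * (E * ((B1 * B2) * Q))"
    using P A E B Q
    by (simp add: assoc_mult_mat[of _ m r _ r _ r] assoc_mult_mat[of _ m r _ r _ n]
        assoc_mult_mat[of _ r r _ r _ r] assoc_mult_mat[of _ r r _ r _ n])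
  then show ?thesis unfolding inv using P E Q by (simp add: assoc_mult_mat[of _ m r _ r _ n])
qed

lemma right_inverse_mult_transpose:
  fixes A :: "'b::comm_ring_1 mat"
  assumes A: "A \<in> carrier_mat r r" and C: "C \<in> carrier_mat r r" "A * C = 1\<^sub>m r"
    and B: "B \<in> carrier_mat c r" and N: "N \<in> carrier_mat r c" "N * B = 1\<^sub>m r"
  shows "A * B\<^sup>T * (N\<^sup>T * C) = 1\<^sub>m r"
proof -
  have T: "B\<^sup>T \<in> carrier_mat r c" "N\<^sup>T \<in> carrier_mat c r" using B N by auto
  have "B\<^sup>T * N\<^sup>T = 1\<^sub>m r" using transpose_mult[OF N(1) B] N(2) by simp
  then have BN: "B\<^sup>T * (N\<^sup>T * C) = C"
    using assoc_mult_mat[OF T(1,2) C(1)] left_mult_one_mat[OF C(1)] by simp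
  have "A * B\<^sup>T * (N\<^sup>T * C) = A * (B\<^sup>T * (N\<^sup>T * C))"
    by (rule assoc_mult_mat[OF A T(1) mult_carrier_mat[OF T(2) C(1)]])
  then show ?thesis unfolding BN C(2) .
qed

definition diag_of :: "nat \<Rightarrow> (nat \<Rightarrow> 'b::zero) \<Rightarrow> 'b mat" where
  "diag_of n d = mat n n (\<lambda>(i, j). if i = j then d i else 0)"

lemma diag_of_carrier [simp]: "diag_of n d \<in> carrier_mat n n"
  by (simp add: diag_of_def)

lemma diag_of_dim [simp]: "dim_row (diag_of n d) = n" "dim_col (diag_of n d) = n"
  by (simp_all add: diag_of_def)

lemma diag_of_mult_index:
  fixes d :: "nat \<Rightarrow> 'b::comm_ring_1"
  assumes "A \<in> carrier_mat n c" "i < n" "j < c"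
  shows "(diag_of n d * A) $$ (i, j) = d i * A $$ (i, j)"
proof -
  have "(diag_of n d * A) $$ (i, j) = (\<Sum>k = 0..<n. (if i = k then d i else 0) * A $$ (k, j))"
    using assms by (auto simp: diag_of_def scalar_prod_def intro!: sum.cong)
  also have "\<dots> = (\<Sum>k = 0..<n. if k = i then d i * A $$ (i, j) else 0)"
    by (intro sum.cong) auto
  finally show ?thesis using assms by simp
qed

lemma mult_diag_of_index:
  fixes d :: "nat \<Rightarrow> 'b::comm_ring_1"
  assumes "A \<in> carrier_mat c n" "i < c" "j < n"
  shows "(A * diag_of n d) $$ (i, j) = A $$ (i, j) * d j"
proof -
  have "(A * diag_of n d) $$ (i, j) = (\<Sum>k = 0..<n. A $$ (i, k) * (if k = j then d k else 0))"
    using assms by (auto simp: diag_of_def scalar_prod_def intro!: sum.cong)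
  also have "\<dots> = (\<Sum>k = 0..<n. if k = j then A $$ (i, j) * d j else 0)"
    by (intro sum.cong) auto
  finally show ?thesis using assms by simp
qed

lemma diag_of_mult: "diag_of n (d :: nat \<Rightarrow> 'b::comm_ring_1) * diag_of n e = diag_of n (\<lambda>i. d i * e i)"
  by (intro eq_matI) (auto simp: diag_of_mult_index[of _ n n] simp del: index_mult_mat(1), auto simp: diag_of_def)

lemma diag_of_one: "(\<And>i. i < n \<Longrightarrow> d i = 1) \<Longrightarrow> diag_of n d = 1\<^sub>m n"
  by (intro eq_matI) (auto simp: diag_of_def)

lemma det_diag_of: "det (diag_of n (d :: nat \<Rightarrow> 'b::comm_ring_1)) = (\<Prod>i<n. d i)"
proof -
  have "det (diag_of n d) = prod_list (diag_mat (diag_of n d))"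
    by (rule det_upper_triangular[of _ n]) (auto simp: diag_of_def)
  also have "diag_mat (diag_of n d) = map d [0..<n]"
    by (auto simp: diag_mat_def diag_of_def)
  finally show ?thesis by (simp add: prod.list_conv_set_nth atLeast0LessThan)
qed

definition s_diag :: "nat \<Rightarrow> (nat \<Rightarrow> int) \<Rightarrow> 'a::field poly fract mat" where
  "s_diag n k = diag_of n (\<lambda>i. s_var powi k i)"

lemma s_diag_carrier [simp]: "s_diag n k \<in> carrier_mat n n"
  by (simp add: s_diag_def)

lemma s_diag_mult: "s_diag n k * s_diag n l = s_diag n (\<lambda>i. k i + l i)"
  by (simp add: s_diag_def diag_of_mult power_int_add)

lemma s_diag_inverse: "s_diag n k * s_diag n (\<lambda>i. - k i) = 1\<^sub>m n" "s_diag n (\<lambda>i. - k i) * s_diag n k = 1\<^sub>m n"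
  by (simp_all add: s_diag_mult) (simp_all add: s_diag_def diag_of_one)

lemma det_s_diag_nonzero: "det (s_diag n k) \<noteq> 0"
  by (simp add: s_diag_def det_diag_of)

lemma rdeg_det_s_diag: "rdeg (det (s_diag n k)) = (\<Sum>i<n. k i)"
  by (simp add: s_diag_def det_diag_of rdeg_prod)

lemma s_diag_0: "s_diag r (\<lambda>_. 0) = 1\<^sub>m r"
  by (simp add: s_diag_def diag_of_one)

lemma transpose_s_diag [simp]: "(s_diag n k)\<^sup>T = s_diag n k"
  by (intro eq_matI) (auto simp: s_diag_def diag_of_def)

lemma s_diag_sandwich_index:
  fixes X :: "'a::field poly fract mat"
  assumes X: "X \<in> carrier_mat n n" and ij: "i < n" "j < n"
  shows "(s_diag n k * X * s_diag n l) $$ (i, j) = s_var powi k i * X $$ (i, j) * s_var powi l j"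
  unfolding s_diag_def using ij
  by (subst mult_diag_of_index[OF mult_carrier_mat[OF diag_of_carrier X]])
    (auto simp: diag_of_mult_index[OF X] simp del: index_mult_mat(1))

text \<open>
  Scaling rows and columns by powers of \<open>s\<close> turns a minor of \<open>E\<close> into the
  corresponding minor of \<open>s\<^sup>k E s\<^sup>l\<close>; this is the link between the finite and the
  infinite invariants.
\<close>

lemma scaled_minor:
  fixes E :: "'a::field poly fract mat"
  assumes E: "E \<in> carrier_mat r r" and fh: "\<And>a. a < t \<Longrightarrow> f a < r \<and> h a < r"
  shows "det (mat t t (\<lambda>(a, b). (s_diag r k * E * s_diag r l) $$ (f a, h b))) =
    det (s_diag t (k \<circ> f)) * det (mat t t (\<lambda>(a, b). E $$ (f a, h b))) * det (s_diag t (l \<circ> h))"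
proof -
  define M where "M = mat t t (\<lambda>(a, b). E $$ (f a, h b))"
  have M: "M \<in> carrier_mat t t" by (simp add: M_def)
  have "mat t t (\<lambda>(a, b). (s_diag r k * E * s_diag r l) $$ (f a, h b)) = s_diag t (k \<circ> f) * M * s_diag t (l \<circ> h)"
  proof (rule eq_matI)
    fix a b assume "a < dim_row (s_diag t (k \<circ> f) * M * s_diag t (l \<circ> h))"
      "b < dim_col (s_diag t (k \<circ> f) * M * s_diag t (l \<circ> h))"
    then have ab: "a < t" "b < t" by (auto simp: s_diag_def)
    have "(s_diag r k * E * s_diag r l) $$ (f a, h b) = s_var powi k (f a) * E $$ (f a, h b) * s_var powi l (h b)"
      using fh[OF ab(1)] fh[OF ab(2)] by (intro s_diag_sandwich_index[OF E]) auto
    moreover have "(s_diag t (k \<circ> f) * M * s_diag t (l \<circ> h)) $$ (a, b) = s_var powi k (f a) * M $$ (a, b) * s_var powi l (h b)"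
      using s_diag_sandwich_index[OF M ab] by simp
    ultimately show "mat t t (\<lambda>(a, b). (s_diag r k * E * s_diag r l) $$ (f a, h b)) $$ (a, b) =
      (s_diag t (k \<circ> f) * M * s_diag t (l \<circ> h)) $$ (a, b)"
      using ab by (simp add: M_def del: index_mult_mat(1))
  qed (auto simp: s_diag_def)
  then show ?thesis
    using M by (simp add: M_def det_mult[of _ t] mult_carrier_mat[of _ t t])
qed

lemma diagonal_form_carrier [simp]: "diagonal_form m n ds \<in> carrier_mat m n"
  by (simp add: diagonal_form_def)

lemma diagonal_form_mult_index:
  fixes ds :: "'b::comm_ring_1 list"
  assumes A: "A \<in> carrier_mat t m" and B: "B \<in> carrier_mat n u"
    and len: "length ds \<le> min m n" and ij: "i < t" "j < u"
  shows "(A * diagonal_form m n ds * B) $$ (i, j) =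
    (\<Sum>a<length ds. A $$ (i, a) * (ds ! a) * B $$ (a, j))"
proof -
  have AD: "(A * diagonal_form m n ds) $$ (i, b) = (if b < length ds then A $$ (i, b) * (ds ! b) else 0)"
    if b: "b < n" for b
  proof -
    have "(A * diagonal_form m n ds) $$ (i, b) = (\<Sum>a = 0..<m. A $$ (i, a) * (if a = b \<and> a < length ds then ds ! a else 0))"
      using A ij b by (simp add: diagonal_form_def scalar_prod_def)
    also have "\<dots> = (\<Sum>a = 0..<m. if a = b then (if b < length ds then A $$ (i, b) * (ds ! b) else 0) else 0)"
      by (intro sum.cong) auto
    finally show ?thesis using len by auto
  qed
  have "(A * diagonal_form m n ds * B) $$ (i, j) =
    (\<Sum>b = 0..<n. (A * diagonal_form m n ds) $$ (i, b) * B $$ (b, j))"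
    using A B ij by (simp add: diagonal_form_def scalar_prod_def)
  also have "\<dots> = (\<Sum>b = 0..<n. (if b < length ds then A $$ (i, b) * (ds ! b) * B $$ (b, j) else 0))"
    by (intro sum.cong) (auto simp: AD)
  also have "\<dots> = (\<Sum>b<length ds. A $$ (i, b) * (ds ! b) * B $$ (b, j))"
    using len by (intro sum.mono_neutral_cong_right) auto
  finally show ?thesis .
qed

lemma in_col_space_iff:
  assumes "(P :: 'b::field mat) \<in> carrier_mat m r"
  shows "v \<in> vec_space.col_space m P \<longleftrightarrow> (\<exists>c \<in> carrier_vec r. v = P *\<^sub>v c)"
  using vec_space.col_space_eq[OF assms] assms by auto

text \<open>
  \<open>P L\<close> acts as the identity on the column space of \<open>P\<close>.
\<close>

lemma left_inverse_factor:
  assumes "(P :: 'b::field mat) \<in> carrier_mat m r" "L \<in> carrier_mat r m" "L * P = 1\<^sub>m r"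
    and "A \<in> carrier_mat m n" "vec_space.col_space m A \<subseteq> vec_space.col_space m P"
  shows "A = P * (L * A)"
proof (rule mat_col_eqI)
  fix j assume "j < dim_col (P * (L * A))"
  then have j: "j < n" using assms by simp
  have "col A j = A *\<^sub>v unit_vec n j" using assms j by (intro eq_vecI) auto
  then have "col A j \<in> vec_space.col_space m A"
    using in_col_space_iff[OF assms(4)] unit_vec_carrier by blast
  then have "col A j \<in> vec_space.col_space m P" using assms(5) by blast
  then obtain c where c: "c \<in> carrier_vec r" "col A j = P *\<^sub>v c"
    using in_col_space_iff[OF assms(1)] by auto
  have "col (P * (L * A)) j = P *\<^sub>v (L *\<^sub>v col A j)"
    by (simp only: col_mult2[OF assms(1) mult_carrier_mat[OF assms(2,4)] j] col_mult2[OF assms(2,4) j])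
  also have "L *\<^sub>v col A j = (L * P) *\<^sub>v c"
    unfolding c(2) by (simp only: assoc_mult_mat_vec[OF assms(2,1) c(1)])
  finally show "col A j = col (P * (L * A)) j" using c assms(3) by simp
qed (use assms in auto)

lemma col_space_mult_right_invertible:
  fixes P X :: "'b::field mat"
  assumes P: "P \<in> carrier_mat m r" and X: "X \<in> carrier_mat r n" and Y: "Y \<in> carrier_mat n r" "X * Y = 1\<^sub>m r"
  shows "vec_space.col_space m (P * X) = vec_space.col_space m P"
proof (intro equalityI subsetI)
  have PX: "P * X \<in> carrier_mat m n" using P X by simp
  fix v assume "v \<in> vec_space.col_space m (P * X)"
  then obtain c where "c \<in> carrier_vec n" "v = P * X *\<^sub>v c" using in_col_space_iff[OF PX] by blast
  then show "v \<in> vec_space.col_space m P"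
    using in_col_space_iff[OF P] mult_mat_vec_carrier[OF X] assoc_mult_mat_vec[OF P X] by blast
next
  have PX: "P * X \<in> carrier_mat m n" using P X by simp
  fix v assume "v \<in> vec_space.col_space m P"
  then obtain c where c: "c \<in> carrier_vec r" "v = P *\<^sub>v c" using in_col_space_iff[OF P] by blast
  have Yc: "Y *\<^sub>v c \<in> carrier_vec n" using mult_mat_vec_carrier[OF Y(1) c(1)] .
  have "P * X *\<^sub>v (Y *\<^sub>v c) = P *\<^sub>v (X * Y *\<^sub>v c)"
    by (simp only: assoc_mult_mat_vec[OF P X Yc] assoc_mult_mat_vec[OF X Y(1) c(1)])
  then have "v = P * X *\<^sub>v (Y *\<^sub>v c)" using c Y(2) by simp
  then show "v \<in> vec_space.col_space m (P * X)" using in_col_space_iff[OF PX] Yc by blast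
qed

section \<open>Left inverses of saturated matrices\<close>

text \<open>
  The vectors \<open>p 0, \<dots>, p (r - 1)\<close> of length \<open>m\<close> are saturated if a combination
  of them with coefficients in the field has entries in \<open>S\<close> only when the coefficients are in
  \<open>S\<close>. The dual vectors over \<open>S\<close> are built by induction on \<open>r\<close>. A
  saturated vector \<open>v = p (r - 1)\<close> generates the unit ideal, so \<open>u \<bullet> v = 1\<close>
  for some \<open>u\<close> over \<open>S\<close> by the Bezout hypothesis. Projecting the other vectors along
  \<open>v\<close> to the kernel of \<open>u\<close> keeps them saturated, and dual vectors of the projections
  are easily corrected to dual vectors of the original family.
\<close>

lemma (in subring_of_field) saturated_imp_left_inverse:
  fixes p :: "nat \<Rightarrow> nat \<Rightarrow> 'b"
  assumes bezout: "\<And>v. (\<forall>i<m. v i \<in> S) \<Longrightarrow> (\<forall>c. (\<forall>i<m. c * v i \<in> S) \<longrightarrow> c \<in> S) \<Longrightarrow>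
      \<exists>u. (\<forall>i<m. u i \<in> S) \<and> (\<Sum>i<m. u i * v i) = 1"
    and "\<And>j i. j < r \<Longrightarrow> i < m \<Longrightarrow> p j i \<in> S"
    and "\<And>c. \<forall>i<m. (\<Sum>j<r. c j * p j i) \<in> S \<Longrightarrow> \<forall>j<r. c j \<in> S"
  shows "\<exists>w. (\<forall>a<r. \<forall>i<m. w a i \<in> S) \<and>
    (\<forall>a<r. \<forall>b<r. (\<Sum>i<m. w a i * p b i) = (if a = b then 1 else 0))"
  using assms(2,3)
proof (induction r arbitrary: p)
  case (Suc r)
  define v where "v = p r"
  have "c \<in> S" if c: "\<forall>i<m. c * v i \<in> S" for c
  proof -
    have "(\<Sum>j<Suc r. (if j = r then c else 0) * p j i) = c * v i" for i
      by (simp add: v_def)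
    then have "\<forall>j<Suc r. (if j = r then c else 0) \<in> S"
      using c by (intro Suc.prems(2)) (simp only:)
    then show ?thesis by (auto split: if_splits)
  qed
  moreover have "\<forall>i<m. v i \<in> S" using Suc.prems(1) by (auto simp: v_def)
  ultimately obtain u where u: "\<forall>i<m. u i \<in> S" "(\<Sum>i<m. u i * v i) = 1"
    using bezout by blast
  define up where "up j = (\<Sum>i<m. u i * p j i)" for j
  have up: "up j \<in> S" if "j < r" for j
    unfolding up_def using u Suc.prems(1) that by (auto intro!: sum_mem mult_mem)
  define p' where "p' j i = p j i - up j * v i" for j i
  have "\<exists>w. (\<forall>a<r. \<forall>i<m. w a i \<in> S) \<and>
    (\<forall>a<r. \<forall>b<r. (\<Sum>i<m. w a i * p' b i) = (if a = b then 1 else 0))"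
  proof (rule Suc.IH)
    fix j i assume "j < r" "i < m"
    then show "p' j i \<in> S" unfolding p'_def using Suc.prems(1) up
      by (auto intro!: diff_mem mult_mem simp: v_def)
  next
    fix c assume c: "\<forall>i<m. (\<Sum>j<r. c j * p' j i) \<in> S"
    define c' where "c' j = (if j = r then - (\<Sum>j<r. c j * up j) else c j)" for j
    have "(\<Sum>j<Suc r. c' j * p j i) = (\<Sum>j<r. c j * p' j i)" for i
    proof -
      have "(\<Sum>j<r. c' j * p j i) = (\<Sum>j<r. c j * p j i)"
        by (intro sum.cong) (auto simp: c'_def)
      then show ?thesis
        by (simp add: c'_def p'_def v_def right_diff_distrib sum_subtractf sum_distrib_right
            mult.assoc)
    qed
    then have "\<forall>j<Suc r. c' j \<in> S" using c Suc.prems(2) by auto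
    then show "\<forall>j<r. c j \<in> S" by (auto simp: c'_def less_Suc_eq split: if_splits)
  qed
  then obtain w' where w': "\<And>a i. a < r \<Longrightarrow> i < m \<Longrightarrow> w' a i \<in> S"
    "\<And>a b. a < r \<Longrightarrow> b < r \<Longrightarrow> (\<Sum>i<m. w' a i * p' b i) = (if a = b then 1 else 0)"
    by blast
  define X where "X a = (\<Sum>l<m. w' a l * v l)" for a
  have X: "X a \<in> S" if "a < r" for a
    unfolding X_def using that w'(1) Suc.prems(1) by (auto intro!: sum_mem mult_mem simp: v_def)
  define w1 where "w1 a i = w' a i - X a * u i" for a i
  define w where "w a i = (if a = r then u i - (\<Sum>j<r. up j * w1 j i) else w1 a i)" for a i
  have w1S: "w1 a i \<in> S" if "a < r" "i < m" for a i
    unfolding w1_def using that w' X u by (auto intro!: diff_mem mult_mem)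
  have w1v: "(\<Sum>i<m. w1 a i * v i) = 0" for a
    using u(2) by (simp add: w1_def left_diff_distrib sum_subtractf mult.assoc
        flip: sum_distrib_left) (simp add: X_def)
  have w1p: "(\<Sum>i<m. w1 a i * p b i) = (if a = b then 1 else 0)" if "a < r" "b < r" for a b
  proof -
    have "(\<Sum>i<m. w1 a i * p b i) = (\<Sum>i<m. w' a i * p b i) - X a * up b"
      by (simp add: w1_def left_diff_distrib sum_subtractf mult.assoc up_def sum_distrib_left)
    also have "\<dots> = (\<Sum>i<m. w' a i * p' b i)"
      by (simp add: p'_def right_diff_distrib sum_subtractf X_def sum_distrib_left sum_distrib_right
          mult.left_commute mult.assoc mult.commute)
    finally show ?thesis using w'(2) that by simp
  qed
  have wr: "(\<Sum>i<m. w r i * y i) = (\<Sum>i<m. u i * y i) - (\<Sum>j<r. up j * (\<Sum>i<m. w1 j i * y i))" for y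
  proof -
    have "(\<Sum>i<m. w r i * y i) = (\<Sum>i<m. u i * y i) - (\<Sum>i<m. \<Sum>j<r. up j * w1 j i * y i)"
      by (simp add: w_def left_diff_distrib sum_subtractf sum_distrib_right)
    also have "(\<Sum>i<m. \<Sum>j<r. up j * w1 j i * y i) = (\<Sum>j<r. up j * (\<Sum>i<m. w1 j i * y i))"
      by (subst sum.swap) (simp add: sum_distrib_left mult.assoc)
    finally show ?thesis .
  qed
  show ?case
  proof (intro exI[of _ w] conjI allI impI)
    fix a i assume "a < Suc r" "i < m"
    then show "w a i \<in> S"
      using u w1S up by (auto simp: w_def less_Suc_eq intro!: diff_mem sum_mem mult_mem)
  next
    fix a b assume ab: "a < Suc r" "b < Suc r"
    consider "a = r" "b = r" | "a = r" "b < r" | "a < r" "b = r" | "a < r" "b < r"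
      using ab by linarith
    then show "(\<Sum>i<m. w a i * p b i) = (if a = b then 1 else 0)"
    proof cases
      case 1
      then show ?thesis using wr[of "p r"] w1v u(2) by (simp add: v_def)
    next
      case 2
      then have "(\<Sum>j<r. up j * (\<Sum>i<m. w1 j i * p b i)) = (\<Sum>j<r. if j = b then up b else 0)"
        using w1p by (intro sum.cong) auto
      then show ?thesis using wr[of "p b"] 2 by (simp add: up_def)
    next
      case 3
      then show ?thesis using w1v[of a] by (simp add: w_def v_def)
    next
      case 4
      then show ?thesis using w1p by (simp add: w_def)
    qed
  qed
qed auto

lemma (in subring_of_field) saturated_mat_left_inverse:
  assumes P: "P \<in> carrier_mat m r" "over P"
    and bezout: "\<And>v. (\<forall>i<m. v i \<in> S) \<Longrightarrow> (\<forall>c. (\<forall>i<m. c * v i \<in> S) \<longrightarrow> c \<in> S) \<Longrightarrow>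
      \<exists>u. (\<forall>i<m. u i \<in> S) \<and> (\<Sum>i<m. u i * v i) = 1"
    and sat: "\<And>c. c \<in> carrier_vec r \<Longrightarrow> \<forall>i<m. (P *\<^sub>v c) $ i \<in> S \<Longrightarrow> \<forall>j<r. c $ j \<in> S"
  shows "\<exists>L \<in> carrier_mat r m. over L \<and> L * P = 1\<^sub>m r"
proof -
  have "\<exists>w. (\<forall>a<r. \<forall>i<m. w a i \<in> S) \<and>
    (\<forall>a<r. \<forall>b<r. (\<Sum>i<m. w a i * P $$ (i, b)) = (if a = b then 1 else 0))"
  proof (rule saturated_imp_left_inverse[OF bezout])
    show "P $$ (i, j) \<in> S" if "j < r" "i < m" for i j using that P by (auto simp: over_def)
    show "\<forall>j<r. c j \<in> S" if c: "\<forall>i<m. (\<Sum>j<r. c j * P $$ (i, j)) \<in> S" for c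
    proof -
      have "\<forall>i<m. (P *\<^sub>v vec r c) $ i \<in> S"
        using c by (auto simp: mult_mat_vec_index_sum[OF P(1)] mult.commute)
      then show ?thesis using sat[of "vec r c"] by auto
    qed
  qed auto
  then obtain w where w: "\<forall>a<r. \<forall>i<m. w a i \<in> S"
    "\<forall>a<r. \<forall>b<r. (\<Sum>i<m. w a i * P $$ (i, b)) = (if a = b then 1 else 0)" by blast
  have "mat r m (\<lambda>(a, i). w a i) * P = 1\<^sub>m r"
    using w(2) P(1) by (intro eq_matI) (auto simp: scalar_prod_def atLeast0LessThan)
  then show ?thesis using w(1)
    by (intro bexI[of _ "mat r m (\<lambda>(a, i). w a i)"]) (auto simp: over_def)
qed

lemma finite_maximizer:
  fixes f :: "'b \<Rightarrow> 'c::linorder"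
  assumes "finite I" "I \<noteq> {}"
  shows "\<exists>a\<in>I. \<forall>i\<in>I. f i \<le> f a"
proof -
  have "Max (f ` I) \<in> f ` I" using assms by simp
  then obtain a where "a \<in> I" "f a = Max (f ` I)" by force
  then show ?thesis using assms by (intro bexI[of _ a]) auto
qed

text \<open>
  The saturation hypothesis on \<open>v\<close> says that its entries have no common divisor. The ideal of the
  entries is generated by a nonzero element of least degree, which therefore is a unit.
\<close>

lemma poly_bezout:
  fixes v :: "nat \<Rightarrow> 'a::field poly fract"
  assumes "\<forall>i<m. v i \<in> range to_fract" "\<forall>c. (\<forall>i<m. c * v i \<in> range to_fract) \<longrightarrow> c \<in> range to_fract"
  shows "\<exists>u. (\<forall>i<m. u i \<in> range to_fract) \<and> (\<Sum>i<m. u i * v i) = 1"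
proof -
  define w where "w i = inv_into UNIV to_fract (v i)" for i
  have w: "v i = to_fract (w i)" if "i < m" for i
    using assms(1) that by (simp add: w_def f_inv_into_f)
  define J where "J = {\<Sum>i<m. u i * w i | u. True}"
  have J_comb: "x - y * z \<in> J" if "x \<in> J" "z \<in> J" for x y z
  proof -
    obtain u where u: "x = (\<Sum>i<m. u i * w i)" using \<open>x \<in> J\<close> unfolding J_def by blast
    obtain u' where u': "z = (\<Sum>i<m. u' i * w i)" using \<open>z \<in> J\<close> unfolding J_def by blast
    from u u'
 have "x - y * z = (\<Sum>i<m. (u i - y * u' i) * w i)"
      by (simp add: left_diff_distrib sum_subtractf sum_distrib_left mult.assoc)
    then show ?thesis unfolding J_def by (intro CollectI exI[of _ "\<lambda>i. u i - y * u' i"]) simp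
  qed
  have wJ: "w i \<in> J" if "i < m" for i
  proof -
    have "(\<Sum>a<m. (if a = i then 1 else 0) * w a) = (\<Sum>a<m. if a = i then w i else 0)"
      by (intro sum.cong) auto
    then have "w i = (\<Sum>a<m. (if a = i then 1 else 0) * w a)" using that by simp
    then show ?thesis unfolding J_def
      by (intro CollectI exI[of _ "\<lambda>a. if a = i then 1 else 0"] conjI TrueI)
  qed
  have "\<exists>i<m. w i \<noteq> 0"
  proof (rule ccontr)
    assume "\<not> ?thesis"
    then have "inverse s_var * v i = 0" if "i < m" for i using w[OF that] that by auto
    then have "inverse s_var * v i \<in> range to_fract" if "i < m" for i
      using that polyring.zero_mem by (metis (no_types))
    then have "inverse s_var \<in> range (to_fract :: 'a poly \<Rightarrow> _)"
      using assms(2) by blast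
    then obtain e where e: "inverse s_var = to_fract (e :: 'a poly)" by auto
    have "rdeg (inverse s_var :: 'a poly fract) = -1"
      using rdeg_s_powi[of 1] by (simp add: rdeg_inverse)
    moreover have "e \<noteq> 0" using e by auto
    ultimately show False by (simp add: e rdeg_to_fract)
  qed
  then have ex: "\<exists>g. g \<in> J \<and> g \<noteq> 0" using wJ by blast
  define g where "g = arg_min degree (\<lambda>g. g \<in> J \<and> g \<noteq> 0)"
  have g: "g \<in> J" "g \<noteq> 0" "\<And>y. y \<in> J \<Longrightarrow> y \<noteq> 0 \<Longrightarrow> degree g \<le> degree y"
    using arg_min_natI[of "\<lambda>g. g \<in> J \<and> g \<noteq> 0" _ degree] ex
      arg_min_nat_le[of "\<lambda>g. g \<in> J \<and> g \<noteq> 0" _ degree] unfolding g_def by blast+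
  have "g dvd w i" if "i < m" for i
  proof -
    have "w i mod g = w i - (w i div g) * g" by (simp add: minus_div_mult_eq_mod)
    then have "w i mod g \<in> J" using J_comb[OF wJ[OF that] g(1)] by simp
    then have "w i mod g = 0" using g(2,3) degree_mod_less[of g "w i"] by fastforce
    then show ?thesis by (simp add: mod_eq_0_iff_dvd)
  qed
  then have "to_fract (w i) = to_fract g * to_fract (w i div g)" if "i < m" for i
    using that by (simp flip: to_fract_mult)
  then have "inverse (to_fract g) * v i = to_fract (w i div g)" if "i < m" for i
    using that w[OF that] g(2) by (simp add: field_simps)
  then have "inverse (to_fract g) * v i \<in> range to_fract" if "i < m" for i
    using that by simp
  then have "inverse (to_fract g) \<in> range to_fract" using assms(2) by blast
  then obtain e where "inverse (to_fract g) = to_fract e" by auto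
  then have "to_fract (e * g) = to_fract 1" using g(2) by (simp add: field_simps)
  then have eg: "e * g = 1" by (simp only: to_fract_eq_iff)
  obtain u where u: "g = (\<Sum>i<m. u i * w i)" using g(1) unfolding J_def by blast
  have "(\<Sum>i<m. to_fract (e * u i) * v i) = to_fract (\<Sum>i<m. e * u i * w i)"
    by (simp add: w to_fract_sum)
  also have "(\<Sum>i<m. e * u i * w i) = 1"
    using eg u by (simp add: sum_distrib_left mult.assoc)
  finally show ?thesis by (intro exI[of _ "\<lambda>i. to_fract (e * u i)"]) auto
qed

text \<open>
  The proper functions form a valuation ring: an entry of largest degree divides all the others, and saturation makes it a unit.
\<close>

lemma proper_bezout:
  fixes v :: "nat \<Rightarrow> 'a::field poly fract"
  assumes "\<forall>i<m. v i \<in> Collect proper" "\<forall>c. (\<forall>i<m. c * v i \<in> Collect proper) \<longrightarrow> c \<in> Collect proper"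
  shows "\<exists>u. (\<forall>i<m. u i \<in> Collect proper) \<and> (\<Sum>i<m. u i * v i) = 1"
proof -
  define I where "I = {i. i < m \<and> v i \<noteq> 0}"
  have "I \<noteq> {}"
  proof
    assume "I = {}"
    then have "proper (s_var * v i)" if "i < m" for i
      using that by (auto simp: I_def proper_iff_deg_le)
    then have "proper (s_var :: 'a poly fract)" using assms(2) by blast
    then have "deg_le (s_var powi 1 :: 'a poly fract) 0" by (simp add: proper_iff_deg_le)
    then show False unfolding deg_le_s_powi by simp
  qed
  moreover have "finite I" by (simp add: I_def)
  ultimately obtain a where a: "a \<in> I" "\<And>i. i \<in> I \<Longrightarrow> rdeg (v i) \<le> rdeg (v a)"
    using finite_maximizer[of I "\<lambda>i. rdeg (v i)"] by blast
  have va: "v a \<noteq> 0" "a < m" using a(1) by (auto simp: I_def)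
  have "proper (inverse (v a) * v i)" if "i < m" for i
  proof (cases "v i = 0")
    case False
    then show ?thesis using a(2)[of i] that va
      by (simp add: proper_iff_deg_le deg_le_def rdeg_mult rdeg_inverse I_def)
  qed (simp add: proper_iff_deg_le)
  then have "proper (inverse (v a))" using assms(2) by blast
  moreover have "(\<Sum>i<m. (if i = a then inverse (v a) else 0) * v i) = (\<Sum>i<m. if i = a then 1 else 0)"
    using va by (intro sum.cong) auto
  ultimately show ?thesis using va
    by (intro exI[of _ "\<lambda>i. if i = a then inverse (v a) else 0"]) (auto simp: proper_iff_deg_le)
qed

section \<open>Minors and divisor chains\<close>

lemma (in subring_of_field) chain_quotient_mem:
  fixes d :: "nat \<Rightarrow> 'b"
  assumes "\<And>i. Suc i < r \<Longrightarrow> d (Suc i) / d i \<in> S" "\<And>i. i < r \<Longrightarrow> d i \<noteq> 0" "i \<le> j" "j < r"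
  shows "d j / d i \<in> S"
  using assms(3,4)
proof (induction j rule: dec_induct)
  case base
  then show ?case using assms(2) by simp
next
  case (step j)
  then have "d j \<noteq> 0" using assms(2)[of j] by simp
  then have "d (Suc j) / d i = (d (Suc j) / d j) * (d j / d i)" by simp
  moreover have "d (Suc j) / d j \<in> S" "d j / d i \<in> S" using step assms(1) by auto
  ultimately show ?case by (metis mult_mem)
qed

text \<open>
  Compare the largest index in \<open>T\<close>, which is at least \<open>card T - 1\<close>, with that bound, and induct.
\<close>

lemma (in subring_of_field) chain_prod_mem:
  fixes d :: "nat \<Rightarrow> 'b"
  assumes chain: "\<And>i. Suc i < r \<Longrightarrow> d (Suc i) / d i \<in> S" "\<And>i. i < r \<Longrightarrow> d i \<noteq> 0"
    and "T \<subseteq> {..<r}"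
  shows "\<exists>s\<in>S. prod d T = prod d {..<card T} * s"
  using assms(3)
proof (induction "card T" arbitrary: T)
  case 0
  then have "T = {}" using finite_subset[of T "{..<r}"] by auto
  then show ?case by auto
next
  case (Suc t)
  have fin: "finite T" "T \<noteq> {}" using Suc finite_subset[of T "{..<r}"] by auto
  define x where "x = Max T"
  have x: "x \<in> T" using fin by (simp add: x_def)
  have "T \<subseteq> {..x}" using fin by (auto simp: x_def)
  then have "card T \<le> Suc x" using card_mono[of "{..x}" T] by simp
  then have "t \<le> x" using Suc(2) by simp
  have ct: "card (T - {x}) = t" using Suc(2) x fin by simp
  then obtain s where s: "s \<in> S" "prod d (T - {x}) = prod d {..<t} * s"
    using Suc(1)[of "T - {x}"] Suc(3) by auto
  have "d x / d t \<in> S"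
    using chain_quotient_mem[of r d t x] chain \<open>t \<le> x\<close> x Suc(3) by auto
  then have "s * (d x / d t) \<in> S" using s(1) by (rule mult_mem[rotated])
  moreover have "d t \<noteq> 0" using chain(2) x \<open>t \<le> x\<close> Suc(3) by auto
  then have "prod d T = prod d {..<card T} * (s * (d x / d t))"
    using s fin x by (simp add: prod.remove[of T x] flip: Suc(2))
  ultimately show ?case by (intro bexI[of _ "s * (d x / d t)"])
qed

text \<open>
  Expanding the determinant of \<open>A D B\<close> by linearity in the rows gives a sum over functions \<open>f\<close> from
  rows to indices. A function that is not injective contributes zero because of two equal rows; an
  injective one contributes a multiple of the product of the \<open>d\<close>'s over its range. This takes the place of
  the Cauchy--Binet formula.
\<close>

lemma (in subring_of_field) det_diag_product_mem:
  fixes d :: "nat \<Rightarrow> 'b"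
  assumes chain: "\<And>i. Suc i < r \<Longrightarrow> d (Suc i) / d i \<in> S" "\<And>i. i < r \<Longrightarrow> d i \<noteq> 0"
    and A: "A \<in> carrier_mat t r" "over A" and B: "B \<in> carrier_mat r t" "over B"
  shows "\<exists>s\<in>S. det (A * mat r t (\<lambda>(i, j). d i * B $$ (i, j))) = prod d {..<t} * s"
proof -
  define X where "X = mat r t (\<lambda>(i, j). d i * B $$ (i, j))"
  have X: "X \<in> carrier_mat r t" by (simp add: X_def)
  define F where "F = {f. (\<forall>i\<in>{0..<t}. f i \<in> {0..<r}) \<and> (\<forall>i. i \<notin> {0..<t} \<longrightarrow> f i = i)}"
  have "det (A * X) = (\<Sum>f\<in>F. det (mat\<^sub>r t t (\<lambda>i. A $$ (i, f i) \<cdot>\<^sub>v row X (f i))))"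
    unfolding mat_mul_finsum_alt[OF A(1) X] F_def
    by (rule det_linear_rows_sum) (use X in auto)
  moreover have "\<exists>s\<in>S. det (mat\<^sub>r t t (\<lambda>i. A $$ (i, f i) \<cdot>\<^sub>v row X (f i))) = prod d {..<t} * s"
    if f: "f \<in> F" for f
  proof -
    have fr: "f i < r" if "i < t" for i using f that by (auto simp: F_def)
    have row: "row X (f i) = d (f i) \<cdot>\<^sub>v row B (f i)" if "i < t" for i
      using fr[OF that] B by (intro eq_vecI) (auto simp: X_def)
    have "mat\<^sub>r t t (\<lambda>i. A $$ (i, f i) \<cdot>\<^sub>v row X (f i)) =
      mat\<^sub>r t t (\<lambda>i. (A $$ (i, f i) * d (f i)) \<cdot>\<^sub>v row B (f i))"
      using B by (intro eq_matI) (auto simp: row)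
    then have eq: "det (mat\<^sub>r t t (\<lambda>i. A $$ (i, f i) \<cdot>\<^sub>v row X (f i))) =
      prod (\<lambda>i. A $$ (i, f i) * d (f i)) {0..<t} * det (mat\<^sub>r t t (\<lambda>i. row B (f i)))"
      by (simp only:) (subst det_rows_mul, use B fr in auto)
    show ?thesis
    proof (cases "inj_on f {0..<t}")
      case True
      have T: "f ` {0..<t} \<subseteq> {..<r}" "card (f ` {0..<t}) = t"
        using fr True by (auto simp: card_image)
      obtain s where s: "s \<in> S" "prod d (f ` {0..<t}) = prod d {..<t} * s"
        using chain_prod_mem[of r d "f ` {0..<t}"] chain T by auto
      have dB: "det (mat\<^sub>r t t (\<lambda>i. row B (f i))) \<in> S"
        using B fr by (intro det_mem[of _ t]) (auto simp: over_def)
      have pA: "(\<Prod>i\<in>{0..<t}. A $$ (i, f i)) \<in> S"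
        using A fr by (intro prod_mem) (auto simp: over_def)
      have "prod (\<lambda>i. d (f i)) {0..<t} = prod d {..<t} * s"
        using s(2) True by (simp add: prod.reindex)
      then have "det (mat\<^sub>r t t (\<lambda>i. A $$ (i, f i) \<cdot>\<^sub>v row X (f i))) =
        prod d {..<t} * (s * ((\<Prod>i\<in>{0..<t}. A $$ (i, f i)) * det (mat\<^sub>r t t (\<lambda>i. row B (f i)))))"
        by (simp add: eq prod.distrib mult_ac)
      then show ?thesis using s dB pA by (auto intro!: mult_mem)
    next
      case False
      then obtain i j where ij: "i < t" "j < t" "i \<noteq> j" "f i = f j" by (auto simp: inj_on_def)
      have "det (mat\<^sub>r t t (\<lambda>i. row B (f i))) = 0"
        by (rule det_identical_rows[of _ t i j]) (use ij B in \<open>auto\<close>)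
      then show ?thesis using eq by auto
    qed
  qed
  then obtain s where s: "\<And>f. f \<in> F \<Longrightarrow> s f \<in> S"
    "\<And>f. f \<in> F \<Longrightarrow> det (mat\<^sub>r t t (\<lambda>i. A $$ (i, f i) \<cdot>\<^sub>v row X (f i))) = prod d {..<t} * s f"
    by metis
  ultimately have "det (A * X) = prod d {..<t} * (\<Sum>f\<in>F. s f)"
    by (simp add: sum_distrib_left)
  moreover have "(\<Sum>f\<in>F. s f) \<in> S" using s by auto
  ultimately show ?thesis by (auto simp: X_def)
qed

lemma (in subring_of_field) minors_of_diagonal_product_mem:
  assumes A: "A \<in> carrier_mat p m" "over A" and B: "B \<in> carrier_mat n q" "over B"
    and len: "length ds \<le> min m n"
    and chain: "\<And>i. Suc i < length ds \<Longrightarrow> ds ! Suc i / ds ! i \<in> S" "\<And>i. i < length ds \<Longrightarrow> ds ! i \<noteq> 0"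
    and fh: "\<And>a. a < t \<Longrightarrow> f a < p \<and> h a < q"
  shows "\<exists>s\<in>S. det (mat t t (\<lambda>(a, b). (A * diagonal_form m n ds * B) $$ (f a, h b))) = (\<Prod>i<t. ds ! i) * s"
proof -
  define A' where "A' = mat t (length ds) (\<lambda>(a, i). A $$ (f a, i))"
  define B' where "B' = mat (length ds) t (\<lambda>(i, b). B $$ (i, h b))"
  have "mat t t (\<lambda>(a, b). (A * diagonal_form m n ds * B) $$ (f a, h b)) =
    A' * mat (length ds) t (\<lambda>(i, j). ds ! i * B' $$ (i, j))"
    using fh by (intro eq_matI)
      (auto simp: diagonal_form_mult_index[OF A(1) B(1) len] A'_def B'_def scalar_prod_def atLeast0LessThan
        mult.assoc simp del: index_mult_mat(1) intro!: sum.cong, auto simp: scalar_prod_def atLeast0LessThan mult.assoc)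
  moreover have "over A'" "over B'"
    using A B fh len by (auto simp: over_def A'_def B'_def)
  ultimately show ?thesis
    using det_diag_product_mem[of "length ds" "\<lambda>i. ds ! i" A' t B'] chain by (auto simp: A'_def B'_def)
qed

text \<open>
  Determinantal divisors for \<open>R = P G Q\<^sup>T\<close>. Since \<open>P\<close> and \<open>Q\<close> are
  left invertible over \<open>S\<close>, \<open>G\<close> has the form \<open>A D B\<close> with
  \<open>D\<close> the diagonal form of \<open>R\<close> and \<open>A\<close>, \<open>B\<close> over
  \<open>S\<close>, which bounds the minors of \<open>G\<close>. Conversely, the leading block of
  \<open>D\<close> has the form \<open>X G Y\<close> with \<open>X\<close>, \<open>Y\<close> over
  \<open>S\<close>, so the largest determinantal divisors agree up to a unit. The lemma is applied over the
  polynomials to \<open>E\<close> and over the proper functions to \<open>s\<^sup>k E s\<^sup>l\<close>.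
\<close>

lemma (in subring_of_field) determinantal_comparison:
  assumes P: "P \<in> carrier_mat m r" "over P" and Q: "Q \<in> carrier_mat n r" "over Q"
    and L: "L \<in> carrier_mat r m" "over L" "L * P = 1\<^sub>m r"
    and M: "M \<in> carrier_mat r n" "over M" "M * Q = 1\<^sub>m r"
    and G: "G \<in> carrier_mat r r" and R: "R = P * G * Q\<^sup>T"
    and UV: "invertible_over m U" "invertible_over n V" "U * R * V = diagonal_form m n ds"
    and len: "length ds = r" "r \<le> min m n"
    and chain: "\<And>i. Suc i < r \<Longrightarrow> ds ! Suc i / ds ! i \<in> S" "\<And>i. i < r \<Longrightarrow> ds ! i \<noteq> 0"
  shows "\<exists>s\<in>S. (\<Prod>i<r. ds ! i) = det G * s"
    and "\<And>t f h. (\<And>a. a < t \<Longrightarrow> f a < r \<and> h a < r) \<Longrightarrow>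
      \<exists>s\<in>S. det (mat t t (\<lambda>(a, b). G $$ (f a, h b))) = (\<Prod>i<t. ds ! i) * s"
proof -
  note Uc = invertible_over_carrier[OF UV(1)] and Vc = invertible_over_carrier[OF UV(2)]
  obtain U' where U': "invertible_over m U'" "U * U' = 1\<^sub>m m" "U' * U = 1\<^sub>m m"
    using UV(1) by (rule invertible_overE)
  obtain V' where V': "invertible_over n V'" "V * V' = 1\<^sub>m n" "V' * V = 1\<^sub>m n"
    using UV(2) by (rule invertible_overE)
  note U'c = invertible_over_carrier[OF U'(1)] and V'c = invertible_over_carrier[OF V'(1)]
  have Rc: "R \<in> carrier_mat m n" unfolding R using P Q G by auto
  have Gcomp: "G = L * U' * diagonal_form m n ds * (V' * M\<^sup>T)"
  proof -
    have "L * U' * diagonal_form m n ds * (V' * M\<^sup>T) = L * (U' * U) * R * ((V * V') * M\<^sup>T)"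
      unfolding UV(3)[symmetric] using L M Uc Vc U'c V'c Rc
      by (simp add: assoc_mult_mat[of _ _ m _ m _ n] assoc_mult_mat[of _ r m _ m _ m]
          assoc_mult_mat[of _ r m _ n _ n] assoc_mult_mat[of _ m m _ n _ n]
          assoc_mult_mat[of _ n n _ n _ r] assoc_mult_mat[of _ m n _ n _ r]
          assoc_mult_mat[of _ r m _ n _ r] assoc_mult_mat[of _ m m _ n _ r]
          assoc_mult_mat[of _ m m _ m _ n] assoc_mult_mat[of _ r m _ m _ r] assoc_mult_mat[of _ m m _ m _ r])
    moreover have "L * (P * X) = X" if "X \<in> carrier_mat r r" for X
      using L P that by (simp flip: assoc_mult_mat[of _ r m _ r _ r])
    moreover have "Q\<^sup>T * M\<^sup>T = 1\<^sub>m r"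
      using M Q by (metis transpose_mult transpose_one)
    ultimately show ?thesis
      unfolding U' V' R using L M P Q G
      by (simp add: assoc_mult_mat[of _ r m _ r _ r] assoc_mult_mat[of _ r m _ r _ n]
          assoc_mult_mat[of _ r m _ n _ r] assoc_mult_mat[of _ m r _ r _ n] assoc_mult_mat[of _ m r _ r _ r]
          assoc_mult_mat[of _ m r _ n _ r] assoc_mult_mat[of _ r r _ n _ r])
  qed
  show "\<exists>s\<in>S. det (mat t t (\<lambda>(a, b). G $$ (f a, h b))) = (\<Prod>i<t. ds ! i) * s"
    if fh: "\<And>a. a < t \<Longrightarrow> f a < r \<and> h a < r" for t f h
    unfolding Gcomp
  proof (rule minors_of_diagonal_product_mem[of _ r m _ n r ds t f h])
    show "over (L * U')" "over (V' * M\<^sup>T)"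
      using L M U' V' invertible_over_over U'c V'c by (auto intro!: over_mult)
  qed (use L M U'c V'c len chain fh in auto)
  define X where "X = mat r r (\<lambda>(i, j). (U * P) $$ (i, j))"
  define Y where "Y = mat r r (\<lambda>(i, j). (Q\<^sup>T * V) $$ (i, j))"
  have UP: "U * P \<in> carrier_mat m r" "over (U * P)"
    using Uc P invertible_over_over[OF UV(1)] by (auto intro!: over_mult)
  have QV: "Q\<^sup>T * V \<in> carrier_mat r n" "over (Q\<^sup>T * V)"
    using Vc Q invertible_over_over[OF UV(2)] by (auto intro!: over_mult)
  have "diagonal_form m n ds = (U * P) * G * (Q\<^sup>T * V)"
    unfolding UV(3)[symmetric] R using Uc Vc P Q G
    by (simp add: assoc_mult_mat[of _ m m _ r _ n] assoc_mult_mat[of _ m m _ n _ n]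
          assoc_mult_mat[of _ m r _ r _ n] assoc_mult_mat[of _ m r _ n _ n] assoc_mult_mat[of _ r r _ n _ n]
          assoc_mult_mat[of _ m m _ r _ r])
  then have D: "diagonal_form m n ds = (U * P) * (G * (Q\<^sup>T * V))"
    using UP QV G by (simp only: assoc_mult_mat[of _ m r _ r _ n])
  have "diag_of r (\<lambda>i. ds ! i) = X * (G * Y)"
  proof (rule eq_matI)
    fix i j assume "i < dim_row (X * (G * Y))" "j < dim_col (X * (G * Y))"
    then have ij: "i < r" "j < r" by (auto simp: X_def Y_def)
    then have ij': "i < m" "j < n" using len by auto
    have Xc: "X \<in> carrier_mat r r" and Yc: "Y \<in> carrier_mat r r" by (auto simp: X_def Y_def)
    have GY: "(G * (Q\<^sup>T * V)) $$ (a, j) = (G * Y) $$ (a, j)" if "a < r" for a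
      unfolding mult_mat_index_sum[OF G QV(1) that ij'(2)] mult_mat_index_sum[OF G Yc that ij(2)]
      using ij by (intro sum.cong) (auto simp: Y_def)
    have "diag_of r (\<lambda>i. ds ! i) $$ (i, j) = diagonal_form m n ds $$ (i, j)"
      using ij len by (auto simp: diag_of_def diagonal_form_def)
    also have "\<dots> = (\<Sum>a<r. (U * P) $$ (i, a) * (G * (Q\<^sup>T * V)) $$ (a, j))"
      unfolding D by (rule mult_mat_index_sum[OF UP(1) mult_carrier_mat[OF G QV(1)] ij'])
    also have "\<dots> = (\<Sum>a<r. X $$ (i, a) * (G * Y) $$ (a, j))"
      using ij by (intro sum.cong) (auto simp: GY X_def simp del: index_mult_mat(1))
    also have "\<dots> = (X * (G * Y)) $$ (i, j)"
      by (rule mult_mat_index_sum[OF Xc mult_carrier_mat[OF G Yc] ij, symmetric])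
    finally show "diag_of r (\<lambda>i. ds ! i) $$ (i, j) = (X * (G * Y)) $$ (i, j)" .
  qed (auto simp: X_def Y_def)
  then have "(\<Prod>i<r. ds ! i) = det X * (det G * det Y)"
    using G by (simp add: X_def Y_def det_mult[of _ r] flip: det_diag_of)
  moreover have "over X" "over Y"
    using UP QV Uc P(1) Vc Q(1) len by (auto simp: over_def X_def Y_def simp del: index_mult_mat(1))
  then have "det X \<in> S" "det Y \<in> S" using det_mem[of _ r] by (auto simp: X_def Y_def)
  ultimately show "\<exists>s\<in>S. (\<Prod>i<r. ds ! i) = det G * s"
    by (intro bexI[of _ "det X * det Y"]) (auto simp: mult_ac)
qed

section \<open>Nonsingular minors of large weight\<close>

text \<open>
  By the pigeonhole principle every permutation maps some row index of the block to a column index of the block,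
  so every term of the Leibniz formula vanishes.
\<close>

lemma det_zero_block:
  fixes A :: "'b::comm_ring_1 mat"
  assumes A: "A \<in> carrier_mat n n" and "C \<subseteq> {..<n}" "R \<subseteq> {..<n}" "card C + card R > n"
    and zero: "\<And>i j. i \<in> C \<Longrightarrow> j \<in> R \<Longrightarrow> A $$ (i, j) = 0"
  shows "det A = 0"
  unfolding det_def'[OF A]
proof (intro sum.neutral ballI)
  fix p assume "p \<in> {p. p permutes {0..<n}}"
  then have p: "p permutes {0..<n}" by simp
  have "card (p ` C) = card C"
    using permutes_inj_on[OF p] by (rule card_image)
  have sub: "p ` C \<union> R \<subseteq> {..<n}"
    using assms(2,3) permutes_in_image[OF p] by auto
  have "p ` C \<inter> R \<noteq> {}"
  proof
    assume "p ` C \<inter> R = {}"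
    then have "card (p ` C \<union> R) = card C + card R"
      using \<open>card (p ` C) = card C\<close> assms(2,3) finite_subset[of _ "{..<n}"]
      by (subst card_Un_disjoint) auto
    then show False using card_mono[OF _ sub] assms(4) by simp
  qed
  then obtain i where i: "i \<in> C" "p i \<in> R" by auto
  then have "(\<Prod>i = 0..<n. A $$ (i, p i)) = 0"
    using zero[OF i] assms(2) i(1) by (intro prod_zero) (auto intro!: bexI[of _ i])
  then show "signof p * (\<Prod>i = 0..<n. A $$ (i, p i)) = 0" by simp
qed

text \<open>
  Otherwise the adjugate, which is nonsingular, would have a zero block with \<open>i0 + 1\<close> rows and
  \<open>n + 1 - i0\<close> columns.
\<close>

lemma exists_nonzero_cofactor:
  fixes E :: "'b::field mat"
  assumes E: "E \<in> carrier_mat (Suc n) (Suc n)" "det E \<noteq> 0" and "i0 \<le> n"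
  obtains i j where "i0 \<le> i" "i \<le> n" "n - i0 \<le> j" "j \<le> n" "det (mat_delete E i j) \<noteq> 0"
proof -
  have "\<exists>i j. i0 \<le> i \<and> i \<le> n \<and> n - i0 \<le> j \<and> j \<le> n \<and> det (mat_delete E i j) \<noteq> 0"
  proof (rule ccontr)
    assume "\<not> ?thesis"
    then have "adj_mat E $$ (j, i) = 0" if "j \<in> {n - i0..n}" "i \<in> {i0..n}" for i j
      using that E by (auto simp: adj_mat_def cofactor_def)
    then have "det (adj_mat E) = 0"
      using assms(3) adj_mat(1)[OF E(1)]
      by (intro det_zero_block[of _ "Suc n" "{n - i0..n}" "{i0..n}"]) auto
    then have "det (E * adj_mat E) = 0"
      using det_mult[OF E(1) adj_mat(1)[OF E(1)]] by simp
    then show False using adj_mat(2)[OF E(1)] E(2) by simp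
  qed
  then show ?thesis using that by blast
qed

text \<open>
  The minor is reached by deleting one row and one column at a time. An index \<open>i0\<close> outside
  \<open>T\<close> would ideally be deleted together with its partner \<open>n - i0\<close>; instead, a row
  \<open>i \<ge> i0\<close> and a column \<open>j \<ge> n - i0\<close> are deleted that leave the matrix
  nonsingular. As \<open>k\<close> and \<open>l\<close> are nonincreasing, what remains weighs at least as much
  as after the ideal deletion. The functions \<open>f\<close> and \<open>h\<close> list the rows and columns of
  the minor; they are injective because the minor does not vanish.
\<close>

lemma exists_nonsingular_minor:
  fixes E :: "'b::field mat" and k l :: "nat \<Rightarrow> int"
  assumes "E \<in> carrier_mat n n" "det E \<noteq> 0"
    and "\<And>i j. i \<le> j \<Longrightarrow> j < n \<Longrightarrow> k j \<le> k i" "\<And>i j. i \<le> j \<Longrightarrow> j < n \<Longrightarrow> l j \<le> l i"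
    and "T \<subseteq> {..<n}"
  shows "\<exists>f h. (\<forall>a < card T. f a < n \<and> h a < n) \<and>
    det (mat (card T) (card T) (\<lambda>(a, b). E $$ (f a, h b))) \<noteq> 0 \<and>
    (\<Sum>i\<in>T. k i + l (n - 1 - i)) \<le> (\<Sum>a<card T. k (f a) + l (h a))"
  using assms
proof (induction n arbitrary: E k l T)
  case 0
  then show ?case by auto
next
  case (Suc n)
  note antimono = Suc.prems(3,4)
  show ?case
  proof (cases "T = {..<Suc n}")
    case True
    have "mat (Suc n) (Suc n) (\<lambda>(a, b). E $$ (a, b)) = E"
      using Suc.prems(1) by (intro eq_matI) auto
    moreover have "(\<Sum>i<Suc n. l (n - i)) = (\<Sum>i<Suc n. l i)"
      using sum.nat_diff_reindex[of l "Suc n"] by simp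
    ultimately show ?thesis
      using True Suc.prems(2) by (intro exI[of _ "\<lambda>x. x"]) (auto simp: sum.distrib simp del: sum.lessThan_Suc)
  next
    case False
    then obtain i0 where i0: "i0 \<notin> T" "i0 \<le> n" using Suc.prems(5) by fastforce
    obtain i j where ij: "i0 \<le> i" "i \<le> n" "n - i0 \<le> j" "j \<le> n" "det (mat_delete E i j) \<noteq> 0"
      using exists_nonzero_cofactor[OF Suc.prems(1,2) i0(2)] by blast
    define k' where "k' = k \<circ> insert_index i"
    define l' where "l' = l \<circ> insert_index j"
    define T' where "T' = delete_index i0 ` T"
    have inj: "inj_on (delete_index i0) T"
      using i0 by (intro inj_onI) (metis insert_delete_index)
    have "delete_index i0 x < n" if "x \<in> T" for x
    proof -
      have "x \<noteq> i0" "x < Suc n" using that i0 Suc.prems(5) by auto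
      then show ?thesis using i0(2) by (simp add: delete_index_def) linarith
    qed
    then have T': "T' \<subseteq> {..<n}" "card T' = card T"
      using inj by (auto simp: T'_def card_image)
    have "\<exists>f h. (\<forall>a < card T'. f a < n \<and> h a < n) \<and>
      det (mat (card T') (card T') (\<lambda>(a, b). mat_delete E i j $$ (f a, h b))) \<noteq> 0 \<and>
      (\<Sum>i\<in>T'. k' i + l' (n - 1 - i)) \<le> (\<Sum>a<card T'. k' (f a) + l' (h a))"
    proof (rule Suc.IH)
      show "mat_delete E i j \<in> carrier_mat n n"
        using mat_delete_carrier[OF Suc.prems(1)] by simp
      show "k' b \<le> k' a" if "a \<le> b" "b < n" for a b
        using antimono that by (auto simp: k'_def insert_index_def)
      show "l' b \<le> l' a" if "a \<le> b" "b < n" for a b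
        using antimono that by (auto simp: l'_def insert_index_def)
    qed (use ij T' in auto)
    then obtain f h where fh: "\<forall>a < card T. f a < n \<and> h a < n"
      "det (mat (card T) (card T) (\<lambda>(a, b). mat_delete E i j $$ (f a, h b))) \<noteq> 0"
      "(\<Sum>i\<in>T'. k' i + l' (n - 1 - i)) \<le> (\<Sum>a<card T. k' (f a) + l' (h a))"
      unfolding T'(2) by blast
    have "mat (card T) (card T) (\<lambda>(a, b). mat_delete E i j $$ (f a, h b)) =
      mat (card T) (card T) (\<lambda>(a, b). E $$ ((insert_index i \<circ> f) a, (insert_index j \<circ> h) b))"
      using Suc.prems(1) fh(1) by (intro eq_matI) (auto simp: mat_delete_def insert_index_def)
    moreover have "(\<Sum>x\<in>T. k x + l (n - x)) \<le> (\<Sum>x\<in>T'. k' x + l' (n - 1 - x))"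
    proof -
      have "k x + l (n - x) \<le> k' (delete_index i0 x) + l' (n - 1 - delete_index i0 x)"
        if "x \<in> T" for x
      proof -
        have x: "x \<noteq> i0" "x \<le> n" using that i0 Suc.prems(5) by auto
        have "k x \<le> k (insert_index i (delete_index i0 x))"
          using x ij i0 by (intro antimono) (auto simp: insert_index_def delete_index_def)
        moreover have "l (n - x) \<le> l (insert_index j (n - 1 - delete_index i0 x))"
          using x ij i0 by (intro antimono) (auto simp: insert_index_def delete_index_def)
        ultimately show ?thesis by (simp add: k'_def l'_def)
      qed
      then show ?thesis unfolding T'_def sum.reindex[OF inj] o_def by (rule sum_mono)
    qed
    moreover have "(insert_index i \<circ> f) a < Suc n \<and> (insert_index j \<circ> h) a < Suc n" if "a < card T" for a
      using fh(1) that by (auto simp: insert_index_def)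
    ultimately show ?thesis using fh(2,3)
      by (intro exI[of _ "insert_index i \<circ> f"] exI[of _ "insert_index j \<circ> h"])
        (auto simp: k'_def l'_def)
  qed
qed

section \<open>Polynomial bases as matrices\<close>

definition fract_mat_of_cols :: "nat \<Rightarrow> 'a::field poly vec list \<Rightarrow> 'a poly fract mat" where
  "fract_mat_of_cols m ps = mat_of_cols m (map (map_vec to_fract) ps)"

lemma fract_mat_of_cols_carrier [simp]: "fract_mat_of_cols m ps \<in> carrier_mat m (length ps)"
  unfolding fract_mat_of_cols_def by (metis length_map mat_of_cols_carrier(1))

lemma fract_mat_of_cols_index:
  assumes "set ps \<subseteq> carrier_vec m" "i < m" "j < length ps"
  shows "fract_mat_of_cols m ps $$ (i, j) = to_fract (ps ! j $ i)"
proof -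
  have "ps ! j \<in> carrier_vec m" using assms(1,3) nth_mem by blast
  then show ?thesis using assms by (simp add: fract_mat_of_cols_def mat_of_cols_index)
qed

lemma map_vec_to_fract_inj: "inj_on (map_vec (to_fract :: 'a::field poly \<Rightarrow> _)) A"
proof (rule inj_onI)
  fix v w :: "'a poly vec" assume eq: "map_vec to_fract v = map_vec to_fract w"
  then have "dim_vec v = dim_vec w" by (metis index_map_vec(2))
  then show "v = w" using eq by (intro eq_vecI) (auto dest!: arg_cong[of _ _ "\<lambda>x. x $ _"] simp: vec_eq_iff)
qed

lemma cols_fract_mat_of_cols:
  "set ps \<subseteq> carrier_vec m \<Longrightarrow> cols (fract_mat_of_cols m ps) = map (map_vec to_fract) ps"
  unfolding fract_mat_of_cols_def by (rule cols_mat_of_cols) auto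

text \<open>
  Bases of a subspace are defined with respect to the structure with restricted carrier; linear independence and
  span can be computed in the whole space.
\<close>

lemma basis_in_subspace_iff:
  assumes "R \<in> carrier_mat m n"
  defines "W \<equiv> vec_space.col_space m (R :: 'b::field mat)"
  shows "vectorspace.basis class_ring (module_vec TYPE('b) m\<lparr>carrier := W\<rparr>) X \<longleftrightarrow>
    X \<subseteq> carrier_vec m \<and> \<not> module.lin_dep class_ring (module_vec TYPE('b) m) X \<and>
    LinearCombinations.module.span class_ring (module_vec TYPE('b) m) X = W"
proof -
  interpret vec_space "TYPE('b)" m .
  have c: "set (cols R) \<subseteq> carrier_vec m" using assms(1) cols_dim by fastforce
  have sm: "submodule class_ring W V" unfolding W_def col_space_def by (rule span_is_submodule[OF c])
  have vs: "vectorspace class_ring (vs W)"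
    unfolding W_def col_space_def by (rule subspace_is_vs[OF span_is_subspace[OF c]])
  have Wc: "W \<subseteq> carrier_vec m" using span_is_subset2[OF c] by (simp add: W_def col_space_def)
  show ?thesis
  proof
    assume "vectorspace.basis class_ring (vs W) X"
    then have *: "\<not> module.lin_dep class_ring (vs W) X"
      "LinearCombinations.module.span class_ring (vs W) X = W" "X \<subseteq> W"
      by (auto simp: vectorspace.basis_def[OF vs])
    then show "X \<subseteq> carrier_vec m \<and> lin_indpt X \<and> span X = W"
      using span_li_not_depend[OF *(3) sm] Wc by auto
  next
    assume *: "X \<subseteq> carrier_vec m \<and> lin_indpt X \<and> span X = W"
    then have XW: "X \<subseteq> W" using in_own_span[of X] by auto
    show "vectorspace.basis class_ring (vs W) X"
      using * XW span_li_not_depend[OF XW sm] by (auto simp: vectorspace.basis_def[OF vs])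
  qed
qed

lemma basis_card_eq_dim:
  assumes "R \<in> carrier_mat m n"
  defines "W \<equiv> vec_space.col_space m (R :: 'b::field mat)"
  assumes "finite X" "vectorspace.basis class_ring (module_vec TYPE('b) m\<lparr>carrier := W\<rparr>) X"
  shows "card X = vec_space.rank m R"
proof -
  interpret vec_space "TYPE('b)" m .
  have c: "set (cols R) \<subseteq> carrier_vec m" using assms(1) cols_dim by fastforce
  have vs: "vectorspace class_ring (vs W)"
    unfolding W_def col_space_def by (rule subspace_is_vs[OF span_is_subspace[OF c]])
  show ?thesis
    using vectorspace.dim_basis[OF vs assms(3,4)] by (simp add: rank_def W_def col_space_def)
qed

text \<open>
  Together with the next lemma: a list of polynomial vectors is a basis of the column space of \<open>R\<close>
  if and only if the matrix with these columns is injective and has the same column space.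
\<close>

lemma polynomial_basis_imp_kernel_range:
  fixes ps :: "'a::field poly vec list"
  assumes "R \<in> carrier_mat m n" "polynomial_basis m (vec_space.col_space m R) (set ps)" "distinct ps"
  defines "P \<equiv> fract_mat_of_cols m ps"
  shows "\<And>c. c \<in> carrier_vec (length ps) \<Longrightarrow> P *\<^sub>v c = 0\<^sub>v m \<Longrightarrow> c = 0\<^sub>v (length ps)"
    and "vec_space.col_space m P = vec_space.col_space m R"
    and "set ps \<subseteq> carrier_vec m"
proof -
  interpret vec_space "TYPE('a poly fract)" m .
  show ps: "set ps \<subseteq> carrier_vec m" using assms(2) by (simp add: polynomial_basis_def)
  have X: "set (cols P) = map_vec to_fract ` set ps"
    unfolding P_def cols_fract_mat_of_cols[OF ps] by simp
  have *: "lin_indpt (set (cols P))" "span (set (cols P)) = col_space R"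
    using assms(2) unfolding polynomial_basis_def basis_in_subspace_iff[OF assms(1)] X by auto
  show "col_space P = col_space R" using *(2) by (simp add: col_space_def)
  have "distinct (cols P)"
    unfolding P_def cols_fract_mat_of_cols[OF ps]
    using assms(3) map_vec_to_fract_inj by (simp add: distinct_map)
  then show "c = 0\<^sub>v (length ps)" if "c \<in> carrier_vec (length ps)" "P *\<^sub>v c = 0\<^sub>v m" for c
    using lin_depI[of P "length ps" c] that * by (auto simp: P_def)
qed

lemma kernel_range_imp_polynomial_basis:
  fixes ps :: "'a::field poly vec list"
  assumes "R \<in> carrier_mat m n" "set ps \<subseteq> carrier_vec m"
  defines "P \<equiv> fract_mat_of_cols m ps"
  assumes ker: "\<And>c. c \<in> carrier_vec (length ps) \<Longrightarrow> P *\<^sub>v c = 0\<^sub>v m \<Longrightarrow> c = 0\<^sub>v (length ps)"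
    and ran: "vec_space.col_space m P = vec_space.col_space m R"
  shows "polynomial_basis m (vec_space.col_space m R) (set ps)" "distinct ps"
proof -
  interpret vec_space "TYPE('a poly fract)" m .
  have Pc: "P \<in> carrier_mat m (length ps)" by (simp add: P_def)
  have X: "set (cols P) = map_vec to_fract ` set ps"
    unfolding P_def cols_fract_mat_of_cols[OF assms(2)] by simp
  show dist: "distinct ps"
    unfolding distinct_conv_nth
  proof (intro allI impI)
    fix i j assume ij: "i < length ps" "j < length ps" "i \<noteq> j"
    show "ps ! i \<noteq> ps ! j"
    proof
      assume eq: "ps ! i = ps ! j"
      define c where "c = unit_vec (length ps) i - (unit_vec (length ps) j :: 'a poly fract vec)"
      have "P *\<^sub>v c = P *\<^sub>v unit_vec (length ps) i - P *\<^sub>v unit_vec (length ps) j"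
        unfolding c_def using Pc by (intro mult_minus_distrib_mat_vec) auto
      also have "\<dots> = col P i - col P j" using Pc ij by (intro eq_vecI) auto
      also have "col P i = col P j"
        using eq ij assms(2) Pc
        by (intro eq_vecI) (auto simp: P_def fract_mat_of_cols_index carrier_matD[OF fract_mat_of_cols_carrier])
      also have "col P j - col P j = 0\<^sub>v m" using Pc by (intro eq_vecI) auto
      finally have "c = 0\<^sub>v (length ps)" by (intro ker) (auto simp: c_def)
      then have "c $ i = 0" using ij by simp
      then show False using ij by (simp add: c_def)
    qed
  qed
  have "distinct (cols P)"
    unfolding P_def cols_fract_mat_of_cols[OF assms(2)]
    using dist map_vec_to_fract_inj by (simp add: distinct_map)
  then have "lin_indpt (set (cols P))"
    using lin_depE[OF Pc] ker by metis
  moreover have "set (cols P) \<subseteq> carrier_vec m" using Pc cols_dim by blast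
  ultimately show "polynomial_basis m (col_space R) (set ps)"
    unfolding polynomial_basis_def basis_in_subspace_iff[OF assms(1)] X[symmetric]
    using ran assms(2) by (auto simp: col_space_def)
qed

lemma fract_mat_of_cols_dim [simp]:
  "dim_row (fract_mat_of_cols m ps) = m" "dim_col (fract_mat_of_cols m ps) = length ps"
  by (rule carrier_matD[OF fract_mat_of_cols_carrier])+

lemma degree_le_vec_degree: "i < dim_vec v \<Longrightarrow> degree (v $ i) \<le> vec_degree v"
  unfolding vec_degree_def by (rule Max_ge) auto

lemma vec_degree_attained:
  assumes "dim_vec v > 0"
  obtains i where "i < dim_vec v" "degree (v $ i) = vec_degree v"
proof -
  have "vec_degree v \<in> {degree (v $ i) | i. i < dim_vec v}"
    unfolding vec_degree_def using assms by (intro Max_in) auto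
  then show ?thesis using that by auto
qed

lemma deg_le_fract_mat_of_cols:
  assumes "set ps \<subseteq> carrier_vec m" "i < m" "j < length ps"
  shows "deg_le (fract_mat_of_cols m ps $$ (i, j)) (int (vec_degree (ps ! j)))"
proof -
  have "dim_vec (ps ! j) = m" using assms(1,3) nth_mem by (metis carrier_vecD subsetD)
  then show ?thesis
    using degree_le_vec_degree[of i "ps ! j"] assms
    by (cases "ps ! j $ i = 0") (auto simp: fract_mat_of_cols_index deg_le_to_fract)
qed

lemma sum_set_distinct: "distinct ps \<Longrightarrow> sum f (set ps) = (\<Sum>i<length ps. f (ps ! i))"
  by (metis (no_types, lifting) atLeast0LessThan length_map nth_map sum.cong
      sum_list_distinct_conv_sum_set sum_list_sum_nth lessThan_iff)

lemma fract_mat_of_cols_over: "set ps \<subseteq> carrier_vec m \<Longrightarrow> polyring.over (fract_mat_of_cols m ps)"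
  by (auto simp: polyring.over_def fract_mat_of_cols_index)

lemma fract_mat_of_cols_scaled_proper:
  assumes ps: "set ps \<subseteq> carrier_vec m"
  shows "properring.over (fract_mat_of_cols m ps * s_diag (length ps) (\<lambda>j. - int (vec_degree (ps ! j))))"
  (is "properring.over (?P * s_diag ?r ?k)")
  unfolding properring.over_def
proof (intro allI impI)
  fix i j assume "i < dim_row (?P * s_diag ?r ?k)" "j < dim_col (?P * s_diag ?r ?k)"
  then have ij: "i < m" "j < ?r" by (auto simp: s_diag_def)
  have "deg_le (?P $$ (i, j) * s_var powi ?k j) (int (vec_degree (ps ! j)) + ?k j)"
    using deg_le_fract_mat_of_cols[OF ps ij] by (intro deg_le_mult) auto
  then show "(?P * s_diag ?r ?k) $$ (i, j) \<in> Collect proper"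
    using ij unfolding s_diag_def
    by (subst mult_diag_of_index[OF fract_mat_of_cols_carrier]) (auto simp: proper_iff_deg_le)
qed

section \<open>Minimal bases and left inverses\<close>

text \<open>
  If the coefficient \<open>b $ j\<close> were nonzero, replacing the vector with index \<open>j\<close> by the
  polynomial vector \<open>P b\<close> would give another polynomial basis of smaller order. Both saturation
  properties below come from this exchange.
\<close>

lemma minimal_basis_no_reduction:
  fixes ps :: "'a::field poly vec list"
  assumes R: "R \<in> carrier_mat m n" and m: "m > 0"
    and min: "minimal_basis m (vec_space.col_space m R) (set ps)" and dist: "distinct ps"
  defines "P \<equiv> fract_mat_of_cols m ps" and "r \<equiv> length ps"
  assumes b: "b \<in> carrier_vec r" and j: "j < r"
    and poly: "\<And>i. i < m \<Longrightarrow> (P *\<^sub>v b) $ i \<in> range to_fract"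
    and deg: "\<And>i. i < m \<Longrightarrow> deg_le ((P *\<^sub>v b) $ i) (int (vec_degree (ps ! j)) - 1)"
  shows "b $ j = 0"
proof (rule ccontr)
  assume bj: "b $ j \<noteq> 0"
  note basis = polynomial_basis_imp_kernel_range[OF R _ dist, folded P_def r_def]
  have pb: "polynomial_basis m (vec_space.col_space m R) (set ps)"
    using min by (simp add: minimal_basis_def)
  note ker = basis(1)[OF pb] and ran = basis(2)[OF pb] and ps = basis(3)[OF pb]
  have Pc: "P \<in> carrier_mat m r" by (simp add: P_def r_def)
  define v where "v = vec m (\<lambda>i. inv_into UNIV to_fract ((P *\<^sub>v b) $ i))"
  have v: "to_fract (v $ i) = (P *\<^sub>v b) $ i" if "i < m" for i
    using poly[OF that] that by (simp add: v_def f_inv_into_f)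
  have vc: "v \<in> carrier_vec m" by (simp add: v_def)
  define ps' where "ps' = ps[j := v]"
  define P' where "P' = fract_mat_of_cols m ps'"
  have ps': "set ps' \<subseteq> carrier_vec m" using ps vc set_update_subset_insert[of ps j v] by (auto simp: ps'_def)
  have len: "length ps' = r" by (simp add: ps'_def r_def)
  have P'c: "P' \<in> carrier_mat m r" using len fract_mat_of_cols_carrier[of m ps'] by (simp add: P'_def)
  have P': "P' $$ (i, a) = (if a = j then (P *\<^sub>v b) $ i else P $$ (i, a))" if "i < m" "a < r" for i a
    using that ps ps' v len by (auto simp: P'_def P_def fract_mat_of_cols_index r_def ps'_def)
  \<comment> \<open>The coordinates with respect to the old basis in terms of those with respect to the new one.\<close>
  define T where "T c = vec r (\<lambda>i. (if i = j then 0 else c $ i) + c $ j * b $ i)" for c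
  have T: "P' *\<^sub>v c = P *\<^sub>v T c" if c: "c \<in> carrier_vec r" for c
  proof (rule eq_vecI)
    fix i assume "i < dim_vec (P *\<^sub>v T c)"
    then have i: "i < m" using Pc by simp
    have "(P' *\<^sub>v c) $ i = (\<Sum>a<r. P' $$ (i, a) * c $ a)"
      by (rule mult_mat_vec_index_sum[OF P'c c i])
    also have "\<dots> = (P *\<^sub>v b) $ i * c $ j + (\<Sum>a\<in>{..<r} - {j}. P $$ (i, a) * c $ a)"
      using i j by (subst sum.remove[of _ j]) (auto simp: P' intro!: sum.cong)
    also have "(\<Sum>a\<in>{..<r} - {j}. P $$ (i, a) * c $ a) = (\<Sum>a<r. P $$ (i, a) * (if a = j then 0 else c $ a))"
      using j by (subst (2) sum.remove[of _ j]) (auto intro!: sum.cong)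
    also have "(P *\<^sub>v b) $ i * c $ j = (\<Sum>a<r. P $$ (i, a) * (c $ j * b $ a))"
      by (simp only: mult_mat_vec_index_sum[OF Pc b i] sum_distrib_right) (simp add: mult_ac)
    also have "(\<Sum>a<r. P $$ (i, a) * (c $ j * b $ a)) + (\<Sum>a<r. P $$ (i, a) * (if a = j then 0 else c $ a)) =
      (\<Sum>a<r. P $$ (i, a) * T c $ a)"
      unfolding sum.distrib[symmetric] by (intro sum.cong refl) (simp add: T_def distrib_left add.commute)
    also have "\<dots> = (P *\<^sub>v T c) $ i"
      by (rule mult_mat_vec_index_sum[OF Pc _ i, symmetric]) (simp add: T_def)
    finally show "(P' *\<^sub>v c) $ i = (P *\<^sub>v T c) $ i" .
  qed (use Pc P'c in auto)
  have kerP': "c = 0\<^sub>v (length ps')" if c: "c \<in> carrier_vec (length ps')" "P' *\<^sub>v c = 0\<^sub>v m" for c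
  proof -
    have cr: "c \<in> carrier_vec r" using c len by simp
    have "T c = 0\<^sub>v r" using ker[of "T c"] T[OF cr] c by (simp add: T_def)
    then have z: "T c $ i = 0" if "i < r" for i using that by simp
    have "c $ j = 0" using z[OF j] j bj by (simp add: T_def)
    then have "c $ i = 0" if "i < r" for i using z[OF that] that by (auto simp: T_def split: if_splits)
    then show ?thesis using cr len by (intro eq_vecI) auto
  qed
  have "vec_space.col_space m P' = vec_space.col_space m P"
  proof (intro equalityI subsetI)
    fix x assume "x \<in> vec_space.col_space m P'"
    then obtain c where "c \<in> carrier_vec r" "x = P' *\<^sub>v c" using in_col_space_iff[OF P'c] by blast
    then show "x \<in> vec_space.col_space m P"
      using in_col_space_iff[OF Pc] T by (auto intro!: bexI[of _ "T c"] simp: T_def)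
  next
    fix x assume "x \<in> vec_space.col_space m P"
    then obtain c where c: "c \<in> carrier_vec r" "x = P *\<^sub>v c" using in_col_space_iff[OF Pc] by blast
    define c' where "c' = vec r (\<lambda>i. if i = j then c $ j / b $ j else c $ i - (c $ j / b $ j) * b $ i)"
    have "T c' = c" using c bj j by (intro eq_vecI) (auto simp: T_def c'_def)
    then show "x \<in> vec_space.col_space m P'"
      using in_col_space_iff[OF P'c] T[of c'] c by (auto intro!: bexI[of _ c'] simp: c'_def)
  qed
  then have pb': "polynomial_basis m (vec_space.col_space m R) (set ps')" "distinct ps'"
    using kernel_range_imp_polynomial_basis[OF R ps'] kerP' ran by (auto simp: P'_def)
  have "sum vec_degree (set ps) \<le> sum vec_degree (set ps')"
    using min pb'(1) by (simp add: minimal_basis_def)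
  moreover have "sum vec_degree (set ps) = vec_degree (ps ! j) + (\<Sum>i\<in>{..<r} - {j}. vec_degree (ps ! i))"
    unfolding sum_set_distinct[OF dist] r_def[symmetric] using j by (intro sum.remove) auto
  moreover have "sum vec_degree (set ps') = vec_degree (ps' ! j) + (\<Sum>i\<in>{..<r} - {j}. vec_degree (ps' ! i))"
    unfolding sum_set_distinct[OF pb'(2)] len using j by (intro sum.remove) auto
  moreover have "(\<Sum>i\<in>{..<r} - {j}. vec_degree (ps' ! i)) = (\<Sum>i\<in>{..<r} - {j}. vec_degree (ps ! i))"
    by (intro sum.cong) (auto simp: ps'_def)
  moreover have "ps' ! j = v" using j by (simp add: ps'_def r_def)
  ultimately have le: "vec_degree (ps ! j) \<le> vec_degree v" by simp
  obtain i where i: "i < m" "degree (v $ i) = vec_degree v"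
    using vec_degree_attained[of v] m vc by auto
  have "v $ i = 0"
    using deg[OF i(1)] i le by (cases "v $ i = 0") (auto simp flip: v simp: deg_le_def rdeg_to_fract)
  then have "vec_degree (ps ! j) = 0" using i le by simp
  then have "(P *\<^sub>v b) $ i = 0" if "i < m" for i
    using deg[OF that] polynomial_deg_le_negative[of "v $ i" "- 1"] v[OF that] by force
  then have "P *\<^sub>v b = 0\<^sub>v m" using Pc by (intro eq_vecI) auto
  then have "b = 0\<^sub>v r" using ker b by blast
  then show False using bj j by simp
qed

text \<open>
  Subtracting the polynomial parts of the coefficients, one may assume that they are strictly proper. Then
  each term has smaller degree than the vector it multiplies, so the combination contradicts minimality for
  the vector of largest degree that occurs.
\<close>

lemma minimal_basis_saturated:
  fixes ps :: "'a::field poly vec list"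
  assumes R: "R \<in> carrier_mat m n" and m: "m > 0"
    and min: "minimal_basis m (vec_space.col_space m R) (set ps)" and dist: "distinct ps"
  defines "P \<equiv> fract_mat_of_cols m ps" and "r \<equiv> length ps"
  assumes c: "c \<in> carrier_vec r" and poly: "\<forall>i<m. (P *\<^sub>v c) $ i \<in> range to_fract"
  shows "\<forall>j<r. c $ j \<in> range to_fract"
proof (rule ccontr)
  assume neg: "\<not> ?thesis"
  note basis = polynomial_basis_imp_kernel_range[OF R _ dist, folded P_def r_def]
  have pb: "polynomial_basis m (vec_space.col_space m R) (set ps)"
    using min by (simp add: minimal_basis_def)
  note ps = basis(3)[OF pb]
  have Pc: "P \<in> carrier_mat m r" by (simp add: P_def r_def)
  have "\<exists>p h. c $ j = to_fract p + h \<and> deg_le h (- 1)" for j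
    using polynomial_part[of "c $ j"] by blast
  then obtain p h where ph: "\<And>j. c $ j = to_fract (p j) + h j" "\<And>j. deg_le (h j) (- 1)"
    by metis
  define J where "J = {j. j < r \<and> h j \<noteq> 0}"
  have "J \<noteq> {}" using neg ph(1) by (auto simp: J_def)
  moreover have "finite J" by (simp add: J_def)
  ultimately obtain j where j: "j \<in> J" "\<forall>i\<in>J. vec_degree (ps ! i) \<le> vec_degree (ps ! j)"
    using finite_maximizer[of J "\<lambda>i. vec_degree (ps ! i)"] by blast
  define b where "b = vec r h"
  have b: "b \<in> carrier_vec r" by (simp add: b_def)
  have "b $ j = 0"
  proof (rule minimal_basis_no_reduction[OF R m min dist, folded P_def r_def, OF b])
    show "j < r" using j by (simp add: J_def)
    show "(P *\<^sub>v b) $ i \<in> range to_fract" if i: "i < m" for i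
    proof -
      have "(P *\<^sub>v b) $ i = (P *\<^sub>v c) $ i - (\<Sum>a<r. P $$ (i, a) * to_fract (p a))"
        by (simp only: mult_mat_vec_index_sum[OF Pc _ i] b c)
          (auto simp: b_def ph(1) distrib_left sum.distrib intro!: sum.cong)
      moreover have "(\<Sum>a<r. P $$ (i, a) * to_fract (p a)) \<in> range to_fract"
        using i ps by (auto intro!: polyring.sum_mem polyring.mult_mem simp: P_def r_def fract_mat_of_cols_index)
      ultimately show ?thesis using poly i by auto
    qed
    show "deg_le ((P *\<^sub>v b) $ i) (int (vec_degree (ps ! j)) - 1)" if i: "i < m" for i
      unfolding mult_mat_vec_index_sum[OF Pc b i]
    proof (rule deg_le_sum)
      fix a assume "a \<in> {..<r}"
      then have a: "a < r" by simp
      show "deg_le (P $$ (i, a) * b $ a) (int (vec_degree (ps ! j)) - 1)"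
      proof (cases "h a = 0")
        case False
        then have "vec_degree (ps ! a) \<le> vec_degree (ps ! j)" using a j by (simp add: J_def)
        moreover have "deg_le (P $$ (i, a) * b $ a) (int (vec_degree (ps ! a)) + - 1)"
          using deg_le_fract_mat_of_cols[OF ps i, of a] a ph(2)
          by (intro deg_le_mult) (auto simp: P_def b_def r_def)
        ultimately show ?thesis by (auto elim: deg_le_mono)
      qed (use a in \<open>simp add: b_def\<close>)
    qed
  qed
  then show False using j by (simp add: b_def J_def)
qed

text \<open>
  The same exchange at infinity. Among the coefficients of largest degree \<open>\<delta> > 0\<close> choose the
  one whose vector has the largest degree \<open>k j\<close>. Multiplying the combination by \<open>s\<close> to
  the power \<open>k j - \<delta>\<close> gives coefficients \<open>b\<close> whose polynomial parts combine to
  a vector of degree less than \<open>k j\<close>, although \<open>b j\<close> has degree zero.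
\<close>

lemma minimal_basis_saturated_at_infinity:
  fixes ps :: "'a::field poly vec list"
  assumes R: "R \<in> carrier_mat m n" and m: "m > 0"
    and min: "minimal_basis m (vec_space.col_space m R) (set ps)" and dist: "distinct ps"
  defines "P \<equiv> fract_mat_of_cols m ps" and "r \<equiv> length ps"
    and "k \<equiv> \<lambda>j. int (vec_degree (ps ! j))"
  assumes c: "c \<in> carrier_vec r" and prp: "\<forall>i<m. (P * s_diag r (\<lambda>j. - k j) *\<^sub>v c) $ i \<in> Collect proper"
  shows "\<forall>j<r. c $ j \<in> Collect proper"
proof (rule ccontr)
  assume neg: "\<not> ?thesis"
  note basis = polynomial_basis_imp_kernel_range[OF R _ dist, folded P_def r_def]
  have pb: "polynomial_basis m (vec_space.col_space m R) (set ps)"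
    using min by (simp add: minimal_basis_def)
  note ps = basis(3)[OF pb]
  have Pc: "P \<in> carrier_mat m r" by (simp add: P_def r_def)
  define I where "I = {j. j < r \<and> c $ j \<noteq> 0}"
  have "I \<noteq> {}" using neg by (auto simp: I_def proper_iff_deg_le deg_le_def)
  moreover have finI: "finite I" by (simp add: I_def)
  ultimately obtain j0 where j0: "j0 \<in> I" "\<forall>i\<in>I. rdeg (c $ i) \<le> rdeg (c $ j0)"
    using finite_maximizer[of I "\<lambda>i. rdeg (c $ i)"] by blast
  define \<delta> where "\<delta> = rdeg (c $ j0)"
  have \<delta>: "\<delta> > 0"
    using neg j0 unfolding \<delta>_def I_def proper_iff_deg_le deg_le_def mem_Collect_eq by fastforce
  have deg_c: "deg_le (c $ i) \<delta>" if "i < r" for i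
    using j0 that by (auto simp: deg_le_def \<delta>_def I_def)
  define J where "J = {j \<in> I. rdeg (c $ j) = \<delta>}"
  have "J \<noteq> {}" "finite J" using j0 finI by (auto simp: J_def \<delta>_def)
  then obtain j where j: "j \<in> J" "\<forall>i\<in>J. k i \<le> k j"
    using finite_maximizer[of J k] by blast
  have jr: "j < r" "c $ j \<noteq> 0" "rdeg (c $ j) = \<delta>" using j(1) by (auto simp: J_def I_def)
  \<comment> \<open>Column \<open>i\<close> of \<open>P\<close> has degree \<open>k i\<close>, so \<open>b i\<close> may have degree \<open>k j - k i\<close>; for \<open>i = j\<close> it is a unit at infinity.\<close>
  define b where "b i = s_var powi (k j - \<delta> - k i) * c $ i" for i
  have deg_b: "deg_le (b i) (k j - k i)" if "i < r" for i
    using deg_le_mult[of "s_var powi (k j - \<delta> - k i)" "k j - \<delta> - k i" "c $ i" \<delta>] deg_c[OF that]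
    by (simp add: b_def)
  have "\<exists>p h. b j = to_fract p + h \<and> deg_le h (- 1)" for j
    using polynomial_part[of "b j"] by blast
  then obtain p h where ph: "\<And>j. b j = to_fract (p j) + h j" "\<And>j. deg_le (h j) (- 1)"
    by metis
  define b' where "b' = vec r (\<lambda>i. to_fract (p i))"
  have b': "b' \<in> carrier_vec r" by (simp add: b'_def)
  have hdeg: "deg_le (P $$ (i, a) * h a) (k j - 1)" if i: "i < m" and a: "a < r" for i a
  proof (cases "k a \<le> k j")
    case True
    have "deg_le (P $$ (i, a) * h a) (k a + - 1)"
      using deg_le_fract_mat_of_cols[OF ps i, of a] a ph(2)
      by (intro deg_le_mult) (auto simp: P_def k_def r_def)
    then show ?thesis using True by (auto elim: deg_le_mono)
  next
    case False
    have "deg_le (to_fract (p a)) (- 1)"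
      using deg_le_diff[of "b a" "- 1" "h a"] deg_le_mono[OF deg_b[OF a], of "- 1"] False ph by simp
    then have "p a = 0" by (rule polynomial_deg_le_negative) simp
    then have hb: "h a = b a" using ph(1) by simp
    have "a \<notin> J" using j False by auto
    then have "deg_le (c $ a) (\<delta> - 1)" using deg_c[OF a] a by (auto simp: J_def I_def deg_le_def)
    then have "deg_le (b a) (k j - \<delta> - k a + (\<delta> - 1))"
      unfolding b_def by (intro deg_le_mult) simp_all
    then have "deg_le (P $$ (i, a) * h a) (k a + (k j - \<delta> - k a + (\<delta> - 1)))"
      using deg_le_fract_mat_of_cols[OF ps i, of a] a hb
      by (intro deg_le_mult) (auto simp: P_def k_def r_def)
    then show ?thesis by simp
  qed
  have "b' $ j = 0"
  proof (rule minimal_basis_no_reduction[OF R m min dist, folded P_def r_def, OF b'])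
    show "j < r" using jr by simp
    show "(P *\<^sub>v b') $ i \<in> range to_fract" if i: "i < m" for i
      unfolding mult_mat_vec_index_sum[OF Pc b' i] using i ps
      by (auto intro!: polyring.sum_mem polyring.mult_mem simp: P_def r_def b'_def fract_mat_of_cols_index)
    show "deg_le ((P *\<^sub>v b') $ i) (int (vec_degree (ps ! j)) - 1)" if i: "i < m" for i
    proof -
      have "(P * s_diag r (\<lambda>j. - k j) *\<^sub>v c) $ i = (\<Sum>a<r. (P * s_diag r (\<lambda>j. - k j)) $$ (i, a) * c $ a)"
        by (rule mult_mat_vec_index_sum[OF _ c i]) (use Pc in auto)
      also have "\<dots> = (\<Sum>a<r. P $$ (i, a) * (s_var powi (- k a)) * c $ a)"
        unfolding s_diag_def by (intro sum.cong) (auto simp: mult_diag_of_index[OF Pc i])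
      finally have "s_var powi (k j - \<delta>) * (P * s_diag r (\<lambda>j. - k j) *\<^sub>v c) $ i =
        (\<Sum>a<r. s_var powi (k j - \<delta>) * (P $$ (i, a) * (s_var powi (- k a)) * c $ a))"
        by (simp add: sum_distrib_left)
      also have "\<dots> = (\<Sum>a<r. P $$ (i, a) * b a)"
      proof (intro sum.cong refl)
        fix a
        have "(s_var :: 'a poly fract) powi (k j - \<delta> - k a) = s_var powi (k j - \<delta>) * s_var powi (- k a)"
          by (simp flip: power_int_add)
        then show "s_var powi (k j - \<delta>) * (P $$ (i, a) * s_var powi - k a * c $ a) = P $$ (i, a) * b a"
          by (simp add: b_def mult_ac)
      qed
      finally have eq: "s_var powi (k j - \<delta>) * (P * s_diag r (\<lambda>j. - k j) *\<^sub>v c) $ i = (\<Sum>a<r. P $$ (i, a) * b a)" .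
      have "deg_le (s_var powi (k j - \<delta>) * (P * s_diag r (\<lambda>j. - k j) *\<^sub>v c) $ i) (k j - \<delta> + 0)"
        using prp i by (intro deg_le_mult) (auto simp: proper_iff_deg_le)
      then have "deg_le (\<Sum>a<r. P $$ (i, a) * b a) (k j - 1)"
        unfolding eq using \<delta> by (auto elim: deg_le_mono)
      moreover have "deg_le (\<Sum>a<r. P $$ (i, a) * h a) (k j - 1)"
        using hdeg i by (intro deg_le_sum) auto
      moreover have "(P *\<^sub>v b') $ i = (\<Sum>a<r. P $$ (i, a) * b a) - (\<Sum>a<r. P $$ (i, a) * h a)"
        by (simp only: mult_mat_vec_index_sum[OF Pc b' i])
          (auto simp: b'_def ph(1) distrib_left sum.distrib intro!: sum.cong)
      ultimately have "deg_le ((P *\<^sub>v b') $ i) (k j - 1)" by (simp only: deg_le_diff)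
      then show ?thesis by (simp add: k_def)
    qed
  qed
  then have "deg_le (b j) (- 1)" using ph jr by (simp add: b'_def)
  moreover have "b j \<noteq> 0" "rdeg (b j) = 0" using jr by (auto simp: b_def rdeg_mult)
  ultimately show False by (simp add: deg_le_def)
qed

lemma minimal_basis_left_inverses:
  fixes ps :: "'a::field poly vec list"
  assumes R: "R \<in> carrier_mat m n" and m: "m > 0"
    and min: "minimal_basis m (vec_space.col_space m R) (set ps)" and dist: "distinct ps"
  defines "P \<equiv> fract_mat_of_cols m ps" and "r \<equiv> length ps"
    and "k \<equiv> \<lambda>j. int (vec_degree (ps ! j))"
  shows "\<exists>L \<in> carrier_mat r m. polyring.over L \<and> L * P = 1\<^sub>m r"
    and "\<exists>L \<in> carrier_mat r m. properring.over L \<and> L * (P * s_diag r (\<lambda>j. - k j)) = 1\<^sub>m r"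
proof -
  have pb: "polynomial_basis m (vec_space.col_space m R) (set ps)"
    using min by (simp add: minimal_basis_def)
  note ps = polynomial_basis_imp_kernel_range(3)[OF R pb dist]
  have Pc: "P \<in> carrier_mat m r" by (simp add: P_def r_def)
  have "polyring.over P" unfolding P_def by (rule fract_mat_of_cols_over[OF ps])
  then show "\<exists>L \<in> carrier_mat r m. polyring.over L \<and> L * P = 1\<^sub>m r"
    using minimal_basis_saturated[OF R m min dist]
    by (intro polyring.saturated_mat_left_inverse[OF Pc _ poly_bezout]) (auto simp: P_def r_def)
  have P2c: "P * s_diag r (\<lambda>j. - k j) \<in> carrier_mat m r" using Pc by simp
  have "properring.over (P * s_diag r (\<lambda>j. - k j))"
    unfolding P_def r_def k_def by (rule fract_mat_of_cols_scaled_proper[OF ps])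
  then show "\<exists>L \<in> carrier_mat r m. properring.over L \<and> L * (P * s_diag r (\<lambda>j. - k j)) = 1\<^sub>m r"
    using minimal_basis_saturated_at_infinity[OF R m min dist]
    by (intro properring.saturated_mat_left_inverse[OF P2c _ proper_bezout])
      (auto simp: P_def r_def k_def)
qed

text \<open>
  If \<open>P' = P T\<close> is another polynomial basis, the polynomial left inverse makes \<open>T\<close>
  polynomial, so \<open>det T\<close> has nonnegative degree. The left inverse at infinity makes
  \<open>s\<^sup>k T s\<^sup>-\<^sup>k\<^sup>'\<close> proper, so the degree of \<open>det T\<close> is at most
  the difference of the orders of the two bases.
\<close>

lemma left_inverses_imp_minimal_basis:
  fixes ps :: "'a::field poly vec list"
  assumes ps: "set ps \<subseteq> carrier_vec m"
  defines "P \<equiv> fract_mat_of_cols m ps" and "r \<equiv> length ps"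
    and "k \<equiv> \<lambda>j. int (vec_degree (ps ! j))"
  assumes L: "L \<in> carrier_mat r m" "polyring.over L" "L * P = 1\<^sub>m r"
    and L': "L' \<in> carrier_mat r m" "properring.over L'" "L' * (P * s_diag r (\<lambda>j. - k j)) = 1\<^sub>m r"
    and R: "R \<in> carrier_mat m n" "vec_space.col_space m P = vec_space.col_space m R"
  shows "minimal_basis m (vec_space.col_space m R) (set ps)" "distinct ps" "vec_space.rank m R = r"
proof -
  have Pc: "P \<in> carrier_mat m r" by (simp add: P_def r_def)
  have ker: "c = 0\<^sub>v r" if "c \<in> carrier_vec r" "P *\<^sub>v c = 0\<^sub>v m" for c
  proof -
    have "c = (L * P) *\<^sub>v c" using that L by simp
    also have "\<dots> = L *\<^sub>v (P *\<^sub>v c)" using L Pc that by (intro assoc_mult_mat_vec) auto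
    finally have "c = L *\<^sub>v 0\<^sub>v m" using that by simp
    moreover have "L *\<^sub>v 0\<^sub>v m = 0\<^sub>v r" using L by (simp add: mult_mat_zero_vec)
    ultimately show ?thesis by simp
  qed
  have pb: "polynomial_basis m (vec_space.col_space m R) (set ps)" and dist: "distinct ps"
    using kernel_range_imp_polynomial_basis[OF R(1) ps, folded P_def r_def] ker R(2) by blast+
  show "distinct ps" by fact
  have card_basis: "card B = vec_space.rank m R"
    if "polynomial_basis m (vec_space.col_space m R) B" for B
  proof -
    have "card (map_vec to_fract ` B) = vec_space.rank m R"
      using that by (intro basis_card_eq_dim[OF R(1)]) (auto simp: polynomial_basis_def)
    then show ?thesis by (simp add: card_image map_vec_to_fract_inj)
  qed
  show rk: "vec_space.rank m R = r"
    using card_basis[OF pb] dist by (simp add: distinct_card r_def)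
  show "minimal_basis m (vec_space.col_space m R) (set ps)"
    unfolding minimal_basis_def
  proof (intro conjI allI impI pb)
    fix B assume B: "polynomial_basis m (vec_space.col_space m R) B"
    then obtain ps' where ps': "set ps' = B" "distinct ps'"
      using finite_distinct_list by (auto simp: polynomial_basis_def)
    define P' where "P' = fract_mat_of_cols m ps'"
    define k' where "k' = (\<lambda>j. int (vec_degree (ps' ! j)))"
    have len: "length ps' = r" using card_basis[OF B] ps' rk distinct_card by metis
    have P'c: "P' \<in> carrier_mat m r" using len fract_mat_of_cols_carrier[of m ps'] by (simp add: P'_def)
    note kr = polynomial_basis_imp_kernel_range[OF R(1), of ps', folded P'_def, unfolded ps'(1) len, OF B ps'(2)]
    define T where "T = L * P'"
    have T: "T \<in> carrier_mat r r" using L P'c by (simp add: T_def)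
    have PT: "P' = P * T"
      unfolding T_def using kr(2) R(2) by (intro left_inverse_factor[OF Pc L(1,3) P'c]) auto
    have detT: "det T \<noteq> 0"
    proof
      assume "det T = 0"
      then obtain c where c: "c \<in> carrier_vec r" "c \<noteq> 0\<^sub>v r" "T *\<^sub>v c = 0\<^sub>v r"
        using det_0_iff_vec_prod_zero_field[OF T] by blast
      then have "P' *\<^sub>v c = 0\<^sub>v m" unfolding PT using Pc T by (simp add: assoc_mult_mat_vec[of _ m r _ r] mult_mat_zero_vec[of _ m r])
      then show False using kr(1) c by blast
    qed
    have "set ps' \<subseteq> carrier_vec m" using kr(3) ps'(1) by simp
    then have over': "polyring.over P'" "properring.over (P' * s_diag r (\<lambda>j. - k' j))"
      using fract_mat_of_cols_over fract_mat_of_cols_scaled_proper[of ps' m]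
      by (auto simp: P'_def k'_def len)
    have "polyring.over T" unfolding T_def using L over' P'c by (intro polyring.over_mult) auto
    then have "det T \<in> range to_fract" using polyring.det_mem T by blast
    then have degT: "rdeg (det T) \<ge> 0" using detT by (auto simp: rdeg_to_fract)
    define Z where "Z = L' * (P' * s_diag r (\<lambda>j. - k' j))"
    have L'P: "L' * P = s_diag r k"
    proof -
      have "L' * (P * s_diag r (\<lambda>j. - k j)) * s_diag r k = L' * (P * s_diag r (\<lambda>j. - k j) * s_diag r k)"
        by (rule assoc_mult_mat[OF L'(1) mult_carrier_mat[OF Pc s_diag_carrier] s_diag_carrier])
      also have "P * s_diag r (\<lambda>j. - k j) * s_diag r k = P"
        using Pc by (simp add: assoc_mult_mat[OF Pc s_diag_carrier s_diag_carrier] s_diag_inverse)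
      finally show ?thesis unfolding L'(3) left_mult_one_mat[OF s_diag_carrier] ..
    qed
    have "Z = s_diag r k * (T * s_diag r (\<lambda>j. - k' j))"
      unfolding Z_def PT using L' Pc T
      by (simp add: assoc_mult_mat[of _ m r _ r _ r] assoc_mult_mat[of L' r m P r _ r, symmetric] L'P)
    then have detZ: "det Z = det (s_diag r k) * (det T * det (s_diag r (\<lambda>j. - k' j)))"
      using T by (simp add: det_mult[of _ r])
    have "properring.over Z"
      unfolding Z_def by (rule properring.over_mult[OF L'(2) over'(2)]) (use L' P'c in auto)
    then have "deg_le (det Z) 0"
      using properring.det_mem[of Z r] L' P'c by (auto simp: Z_def proper_iff_deg_le)
    moreover have "det Z \<noteq> 0" using detT by (simp add: detZ det_s_diag_nonzero)
    ultimately have "rdeg (det Z) \<le> 0" by (simp add: deg_le_def)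
    then have "(\<Sum>i<r. k i) + (rdeg (det T) + (\<Sum>i<r. - k' i)) \<le> 0"
      using detT by (simp add: detZ rdeg_mult det_s_diag_nonzero rdeg_det_s_diag)
    then have "(\<Sum>i<r. k i) \<le> (\<Sum>i<r. k' i)" using degT by (simp add: sum_negf)
    moreover have "sum vec_degree (set ps) = (\<Sum>i<r. vec_degree (ps ! i))"
      "sum vec_degree B = (\<Sum>i<r. vec_degree (ps' ! i))"
      using sum_set_distinct[OF dist] sum_set_distinct[OF ps'(2)] len ps'(1) by (auto simp: r_def)
    ultimately show "sum vec_degree (set ps) \<le> sum vec_degree B"
      by (simp add: k_def k'_def flip: of_nat_sum)
  qed
qed

lemma sort_eqI: "sorted ys \<Longrightarrow> mset ys = mset xs \<Longrightarrow> sort xs = (ys :: 'b::linorder list)"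
  by (rule properties_for_sort)

lemma minimal_indicesE:
  assumes "minimal_indices p W ks"
  obtains ps where "distinct ps" "minimal_basis p W (set ps)" "map vec_degree ps = ks"
proof -
  obtain B where B: "minimal_basis p W B"
    "ks = rev (sorted_list_of_multiset (image_mset vec_degree (mset_set B)))"
    using assms by (auto simp: minimal_indices_def)
  have "finite B" using B(1) by (simp add: minimal_basis_def polynomial_basis_def)
  then obtain xs where xs: "set xs = B" "distinct xs" using finite_distinct_list by blast
  have "map vec_degree (sort_key vec_degree xs) = sort (map vec_degree xs)"
    by (rule properties_for_sort[symmetric]) auto
  moreover have "image_mset vec_degree (mset_set B) = mset (map vec_degree xs)"
    using xs by (metis mset_map mset_set_set)
  ultimately have "map vec_degree (rev (sort_key vec_degree xs)) = ks"
    using B(2) by (simp flip: mset_map rev_map)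
  then show ?thesis using that[of "rev (sort_key vec_degree xs)"] xs B(1) by simp
qed

lemma minimal_indicesI:
  assumes "distinct ps" "minimal_basis p W (set ps)" "rev ks = sort (map vec_degree ps)"
  shows "minimal_indices p W ks"
proof -
  have "image_mset vec_degree (mset_set (set ps)) = mset (map vec_degree ps)"
    using assms(1) by (metis mset_map mset_set_set)
  then show ?thesis unfolding minimal_indices_def using assms(2,3)
    by (intro exI[of _ "set ps"]) (metis rev_swap sorted_list_of_multiset_mset)
qed

section \<open>Necessity\<close>

text \<open>
  \<open>det P\<close> is a unit among the polynomials and \<open>det (P s\<^sup>-\<^sup>k)\<close> a unit among
  the proper functions, so both have degree zero.
\<close>

lemma square_left_inverses_degree_sum:
  fixes P :: "'a::field poly fract mat"
  assumes P: "P \<in> carrier_mat m m" "polyring.over P" "properring.over (P * s_diag m (\<lambda>j. - k j))"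
    and L: "L \<in> carrier_mat m m" "polyring.over L" "L * P = 1\<^sub>m m"
    and L': "L' \<in> carrier_mat m m" "properring.over L'" "L' * (P * s_diag m (\<lambda>j. - k j)) = 1\<^sub>m m"
  shows "(\<Sum>i<m. k i) = 0"
proof -
  have "det L * det P = 1" using L P det_mult[of L m P] by simp
  moreover from this have nz: "det L \<noteq> 0" "det P \<noteq> 0" by auto
  ultimately have "rdeg (det L) + rdeg (det P) = 0" by (metis rdeg_mult rdeg_1)
  moreover have "det L \<in> range to_fract" "det P \<in> range to_fract"
    using polyring.det_mem L P by blast+
  ultimately have degP: "rdeg (det P) = 0" using nz by (auto simp: rdeg_to_fract)
  have "det L' * (det P * det (s_diag m (\<lambda>j. - k j))) = 1"
    using L' P det_mult[of L' m "P * s_diag m (\<lambda>j. - k j)"] by (simp add: det_mult[of _ m])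
  moreover from this have nz': "det L' \<noteq> 0" by auto
  ultimately have "rdeg (det L') + rdeg (det P * det (s_diag m (\<lambda>j. - k j))) = 0"
    using nz by (metis rdeg_mult rdeg_1 det_s_diag_nonzero mult_eq_0_iff)
  moreover have "deg_le (det L') 0"
    using properring.det_mem[OF L'(2,1)] by (simp add: proper_iff_deg_le)
  then have "rdeg (det L') \<le> 0" using nz' by (simp add: deg_le_def)
  moreover have "deg_le (det (P * s_diag m (\<lambda>j. - k j))) 0"
    using properring.det_mem[OF P(3), of m] P by (simp add: proper_iff_deg_le)
  then have "rdeg (det P * det (s_diag m (\<lambda>j. - k j))) \<le> 0"
    using P nz by (simp add: det_mult[of _ m] deg_le_def det_s_diag_nonzero)
  ultimately have "rdeg (det P * det (s_diag m (\<lambda>j. - k j))) = 0" by linarith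
  then show ?thesis using nz degP by (simp add: rdeg_mult det_s_diag_nonzero rdeg_det_s_diag sum_negf)
qed

text \<open>
  A minimal basis of the column space in the form in which it is used below: as a matrix with both left inverses.
\<close>

lemma col_space_as_basis:
  fixes R :: "'a::field poly fract mat"
  assumes R: "R \<in> carrier_mat m n" "m > 0" and ci: "col_span_minimal_indices R k"
  obtains P L L' where "P \<in> carrier_mat m (length k)" "polyring.over P"
    "properring.over (P * s_diag (length k) (\<lambda>j. - int (k ! j)))"
    "L \<in> carrier_mat (length k) m" "polyring.over L" "L * P = 1\<^sub>m (length k)"
    "L' \<in> carrier_mat (length k) m" "properring.over L'"
    "L' * (P * s_diag (length k) (\<lambda>j. - int (k ! j))) = 1\<^sub>m (length k)" "R = P * (L * R)"
proof -
  have "minimal_indices m (vec_space.col_space m R) k"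
    using ci R by (simp add: col_span_minimal_indices_def)
  then obtain ps where ps: "distinct ps" "minimal_basis m (vec_space.col_space m R) (set ps)"
    "map vec_degree ps = k" by (rule minimal_indicesE)
  have pb: "polynomial_basis m (vec_space.col_space m R) (set ps)"
    using ps(2) by (simp add: minimal_basis_def)
  note kr = polynomial_basis_imp_kernel_range[OF R(1) pb ps(1)]
  have len: "length ps = length k" using ps(3) by auto
  define P where "P = fract_mat_of_cols m ps"
  have sd: "s_diag (length ps) (\<lambda>j. - int (vec_degree (ps ! j))) = s_diag (length k) (\<lambda>j. - int (k ! j))"
    using ps(3) len by (auto simp: s_diag_def diag_of_def)
  have P: "P \<in> carrier_mat m (length k)" by (simp add: P_def flip: len)
  from minimal_basis_left_inverses(1)[OF R ps(2,1), folded P_def, unfolded len]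
  obtain L where L: "L \<in> carrier_mat (length k) m" "polyring.over L" "L * P = 1\<^sub>m (length k)"
    by (elim bexE conjE)
  from minimal_basis_left_inverses(2)[OF R ps(2,1), folded P_def, unfolded sd, unfolded len]
  obtain L' where L': "L' \<in> carrier_mat (length k) m" "properring.over L'"
    "L' * (P * s_diag (length k) (\<lambda>j. - int (k ! j))) = 1\<^sub>m (length k)"
    by (elim bexE conjE)
  have "R = P * (L * R)"
    using kr(2) by (intro left_inverse_factor[OF P L(1,3) R(1)]) (simp add: P_def)
  moreover have "polyring.over P" "properring.over (P * s_diag (length k) (\<lambda>j. - int (k ! j)))"
    using fract_mat_of_cols_over[OF kr(3)] fract_mat_of_cols_scaled_proper[OF kr(3)]
    unfolding sd by (simp_all add: P_def)
  ultimately show ?thesis using that[OF P _ _ L L'] by blast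
qed

lemma invariant_quotients_mem:
  fixes eps psi :: "'a::field poly list"
  assumes "length psi = length eps" "\<forall>p \<in> set eps \<union> set psi. lead_coeff p = 1"
    "sorted_wrt (dvd) eps" "sorted_wrt (\<lambda>p q. q dvd p) psi"
  shows "\<And>i. i < length eps \<Longrightarrow> map2 Fract eps psi ! i \<noteq> 0"
    and "\<And>i. i < length eps \<Longrightarrow> rdeg (map2 Fract eps psi ! i) = int (degree (eps ! i)) - int (degree (psi ! i))"
    and "\<And>i. Suc i < length eps \<Longrightarrow> map2 Fract eps psi ! Suc i / map2 Fract eps psi ! i \<in> range to_fract"
proof -
  have nz: "eps ! i \<noteq> 0" "psi ! i \<noteq> 0" if "i < length eps" for i
    using assms(1,2) that by (metis UnI1 UnI2 leading_coeff_0_iff nth_mem zero_neq_one)+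
  show "map2 Fract eps psi ! i \<noteq> 0" if "i < length eps" for i
    using nz[OF that] that assms(1) by (simp add: Fract_conv_to_fract)
  show "rdeg (map2 Fract eps psi ! i) = int (degree (eps ! i)) - int (degree (psi ! i))"
    if "i < length eps" for i
    using nz[OF that] that assms(1) by (simp add: rdeg_Fract)
  show "map2 Fract eps psi ! Suc i / map2 Fract eps psi ! i \<in> range to_fract" if i: "Suc i < length eps" for i
  proof -
    have "eps ! i dvd eps ! Suc i" "psi ! Suc i dvd psi ! i"
      using assms i by (auto simp: sorted_wrt_iff_nth_less)
    then obtain x y where xy: "eps ! Suc i = eps ! i * x" "psi ! i = psi ! Suc i * y" by (auto elim!: dvdE)
    have "map2 Fract eps psi ! Suc i / map2 Fract eps psi ! i =
      Fract (eps ! Suc i) (psi ! Suc i) / Fract (eps ! i) (psi ! i)"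
      using i assms(1) by simp
    also have "\<dots> = to_fract (x * y)"
      using nz[of i] nz[of "Suc i"] i unfolding xy Fract_conv_to_fract by (auto simp: field_simps)
    finally show ?thesis by (metis rangeI)
  qed
qed

lemma s_powi_quotients_mem:
  assumes "sorted q"
  shows "\<And>i. i < length q \<Longrightarrow> map (\<lambda>x. (s_var :: 'a::field poly fract) powi (- x)) q ! i \<noteq> 0"
    and "\<And>i. i < length q \<Longrightarrow> rdeg (map (\<lambda>x. (s_var :: 'a poly fract) powi (- x)) q ! i) = - (q ! i)"
    and "\<And>i. Suc i < length q \<Longrightarrow> map (\<lambda>x. (s_var :: 'a poly fract) powi (- x)) q ! Suc i /
      map (\<lambda>x. s_var powi (- x)) q ! i \<in> Collect proper"
proof -
  fix i assume i: "Suc i < length q"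
  then have "q ! i \<le> q ! Suc i" using assms by (simp add: sorted_nth_mono)
  then show "map (\<lambda>x. (s_var :: 'a poly fract) powi (- x)) q ! Suc i /
      map (\<lambda>x. s_var powi (- x)) q ! i \<in> Collect proper"
    using i by (simp add: proper_iff_deg_le deg_le_def rdeg_divide)
qed auto

text \<open>
  The degree comparison for minors, in the form without reordering. The indices of \<open>l\<close> are reversed
  in the first statement because the \<open>i\<close>-th largest \<open>k\<close> is paired with the
  \<open>i\<close>-th smallest \<open>l\<close>.
\<close>

lemma has_invariants_necessary:
  fixes R :: "'a::field poly fract mat"
  assumes R: "R \<in> carrier_mat m n" "m > 0" "n > 0" and inv: "has_invariants R r eps psi q k l"
    and len: "length eps = r" "length psi = r" "length q = r" "length k = r" "length l = r" "r \<le> min m n"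
    and desc: "sorted_wrt (\<ge>) k" "sorted_wrt (\<ge>) l"
  defines "a \<equiv> \<lambda>i. int (degree (eps ! i)) - int (degree (psi ! i)) + q ! i"
  shows "\<And>T. T \<subseteq> {..<r} \<Longrightarrow>
      (\<Sum>i\<in>T. int (k ! i) + int (l ! (r - 1 - i))) \<le> - (\<Sum>i<card T. a i)"
    and "(\<Sum>i<r. int (k ! i)) + (\<Sum>i<r. int (l ! i)) = - (\<Sum>i<r. a i)"
    and "r = m \<Longrightarrow> \<forall>x\<in>set k. x = 0"
    and "r = n \<Longrightarrow> \<forall>x\<in>set l. x = 0"
proof -
  define K where "K i = int (k ! i)" for i
  define \<Lambda> where "\<Lambda> i = int (l ! i)" for i
  obtain P L L' where P: "P \<in> carrier_mat m r" "polyring.over P"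
    "properring.over (P * s_diag r (\<lambda>j. - K j))"
    and L: "L \<in> carrier_mat r m" "polyring.over L" "L * P = 1\<^sub>m r"
    and L': "L' \<in> carrier_mat r m" "properring.over L'" "L' * (P * s_diag r (\<lambda>j. - K j)) = 1\<^sub>m r"
    and RP: "R = P * (L * R)"
    using col_space_as_basis[OF R(1,2), of k] inv unfolding has_invariants_def K_def len by blast
  have RT: "R\<^sup>T \<in> carrier_mat n m" using R by simp
  obtain Q M M' where Q: "Q \<in> carrier_mat n r" "polyring.over Q"
    "properring.over (Q * s_diag r (\<lambda>j. - \<Lambda> j))"
    and M: "M \<in> carrier_mat r n" "polyring.over M" "M * Q = 1\<^sub>m r"
    and M': "M' \<in> carrier_mat r n" "properring.over M'" "M' * (Q * s_diag r (\<lambda>j. - \<Lambda> j)) = 1\<^sub>m r"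
    and RQ: "R\<^sup>T = Q * (M * R\<^sup>T)"
    using col_space_as_basis[OF RT R(3), of l] inv
    unfolding has_invariants_def row_span_minimal_indices_def \<Lambda>_def len by blast
  show "\<forall>x\<in>set k. x = 0" if "r = m"
  proof -
    have "(\<Sum>i<m. K i) = 0"
      using square_left_inverses_degree_sum[OF P[unfolded that] L[unfolded that] L'[unfolded that]] .
    then have "\<forall>i<m. k ! i = 0" by (simp add: K_def sum_nonneg_eq_0_iff flip: of_nat_sum)
    then show ?thesis using that len by (auto simp: in_set_conv_nth)
  qed
  show "\<forall>x\<in>set l. x = 0" if "r = n"
  proof -
    have "(\<Sum>i<n. \<Lambda> i) = 0"
      using square_left_inverses_degree_sum[OF Q[unfolded that] M[unfolded that] M'[unfolded that]] .
    then have "\<forall>i<n. l ! i = 0" by (simp add: \<Lambda>_def sum_nonneg_eq_0_iff flip: of_nat_sum)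
    then show ?thesis using that len by (auto simp: in_set_conv_nth)
  qed
  define E where "E = L * R * M\<^sup>T"
  have E: "E \<in> carrier_mat r r" using L M R by (auto simp: E_def)
  have RE: "R = P * E * Q\<^sup>T"
  proof -
    have "R = (Q * (M * R\<^sup>T))\<^sup>T" using RQ by (metis transpose_transpose)
    also have "\<dots> = R * M\<^sup>T * Q\<^sup>T"
      using Q M R by (simp add: transpose_mult[of _ n r _ m] transpose_mult[of _ r n _ m])
    finally have "R = R * M\<^sup>T * Q\<^sup>T" .
    then have "R = P * (L * (R * M\<^sup>T * Q\<^sup>T))" using RP by simp
    also have "\<dots> = P * E * Q\<^sup>T"
      unfolding E_def using P L R M Q
      by (simp add: assoc_mult_mat[of _ r m _ n _ r] assoc_mult_mat[of _ m r _ r _ n]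
          assoc_mult_mat[of _ r m _ r _ n] assoc_mult_mat[of _ m n _ r _ n] assoc_mult_mat[of _ r n _ r _ n]
          assoc_mult_mat[of _ r m _ n _ n])
    finally show ?thesis .
  qed
  define F where "F = s_diag r K * E * s_diag r \<Lambda>"
  have F: "F \<in> carrier_mat r r"
    unfolding F_def by (intro mult_carrier_mat[of _ r r] E s_diag_carrier)
  have RF: "R = (P * s_diag r (\<lambda>j. - K j)) * F * (Q * s_diag r (\<lambda>j. - \<Lambda> j))\<^sup>T"
  proof -
    have "(P * s_diag r (\<lambda>j. - K j)) * F * (Q * s_diag r (\<lambda>j. - \<Lambda> j))\<^sup>T =
      P * s_diag r (\<lambda>j. - K j) * F * (s_diag r (\<lambda>j. - \<Lambda> j) * Q\<^sup>T)"
      using Q by (simp add: transpose_mult[of _ n r _ r])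
    also have "\<dots> = P * E * Q\<^sup>T"
      unfolding F_def
      by (rule sandwich_cancel[OF P(1) s_diag_carrier s_diag_carrier E s_diag_carrier s_diag_carrier])
        (use Q(1) in \<open>auto simp: s_diag_inverse\<close>)
    finally show ?thesis using RE by simp
  qed
  define ds where "ds = map2 Fract eps psi"
  define es :: "'a poly fract list" where "es = map (\<lambda>x. s_var powi (- x)) q"
  have irf: "invariant_rational_functions R eps psi" and ioi: "invariant_orders_at_infinity R q"
    using inv by (auto simp: has_invariants_def)
  obtain U V where UV: "U \<in> carrier_mat m m" "V \<in> carrier_mat n n" "invertible_mat U" "invertible_mat V"
    "map_mat to_fract U * R * map_mat to_fract V = diagonal_form m n ds"
    using irf R unfolding invariant_rational_functions_def ds_def by auto
  obtain B1 B2 where B: "properring.invertible_over m B1" "properring.invertible_over n B2"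
    "B1 * R * B2 = diagonal_form m n es"
    using ioi R unfolding invariant_orders_at_infinity_def es_def biproper_iff by auto
  have lends: "length ds = r" "length es = r" using len by (auto simp: ds_def es_def)
  have "\<forall>p \<in> set eps \<union> set psi. lead_coeff p = 1" "sorted_wrt (dvd) eps" "sorted_wrt (\<lambda>p q. q dvd p) psi"
    using irf by (auto simp: invariant_rational_functions_def)
  then have ds: "ds ! i \<noteq> 0" "rdeg (ds ! i) = int (degree (eps ! i)) - int (degree (psi ! i))"
    "Suc i < r \<Longrightarrow> ds ! Suc i / ds ! i \<in> range to_fract" if "i < r" for i
    using invariant_quotients_mem[of psi eps] that len unfolding ds_def by auto
  have "sorted q" using ioi by (simp add: invariant_orders_at_infinity_def)
  then have es: "es ! i \<noteq> 0" "rdeg (es ! i) = - (q ! i)"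
    "Suc i < r \<Longrightarrow> es ! Suc i / es ! i \<in> Collect proper" if "i < r" for i
    using s_powi_quotients_mem[OF \<open>sorted q\<close>, where 'a = 'a] that len unfolding es_def by auto
  have tT: "L' * (P * s_diag r (\<lambda>j. - K j)) = 1\<^sub>m r" "P * s_diag r (\<lambda>j. - K j) \<in> carrier_mat m r"
    "Q * s_diag r (\<lambda>j. - \<Lambda> j) \<in> carrier_mat n r" using L' P Q by auto
  note fin = polyring.determinantal_comparison[OF P(1,2) Q(1,2) L M E RE
      unimodular_imp_invertible_over[OF UV(1,3)] unimodular_imp_invertible_over[OF UV(2,4)] UV(5) lends(1) len(6)]
  note inf = properring.determinantal_comparison[OF tT(2) P(3) tT(3) Q(3) L' M' F RF B lends(2) len(6)]
  have fin1: "\<exists>s\<in>range to_fract. (\<Prod>i<r. ds ! i) = det E * s" by (rule fin(1)) (use ds in auto)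
  have inf1: "\<exists>s\<in>Collect proper. (\<Prod>i<r. es ! i) = det F * s" by (rule inf(1)) (use es in auto)
  have prod_nz: "(\<Prod>i<r. ds ! i) \<noteq> 0" "(\<Prod>i<r. es ! i) \<noteq> 0" using ds es by auto
  then have nz: "det E \<noteq> 0" "det F \<noteq> 0" using fin1 inf1 by auto
  have upper: "(\<Sum>i\<in>T. K i + \<Lambda> (r - 1 - i)) \<le> - (\<Sum>i<card T. a i)" if T: "T \<subseteq> {..<r}" for T
  proof -
    have ct: "card T \<le> r" using card_mono[OF _ T] by simp
    have mono: "K j \<le> K i" "\<Lambda> j \<le> \<Lambda> i" if "i \<le> j" "j < r" for i j
      using desc len that unfolding K_def \<Lambda>_def by (auto simp: sorted_wrt_iff_nth_less le_less)
    obtain f h where fh: "\<forall>a < card T. f a < r \<and> h a < r"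
      "det (mat (card T) (card T) (\<lambda>(a, b). E $$ (f a, h b))) \<noteq> 0"
      "(\<Sum>i\<in>T. K i + \<Lambda> (r - 1 - i)) \<le> (\<Sum>a<card T. K (f a) + \<Lambda> (h a))"
      using exists_nonsingular_minor[of E r K \<Lambda> T] E nz mono T by blast
    define \<mu> where "\<mu> = det (mat (card T) (card T) (\<lambda>(a, b). E $$ (f a, h b)))"
    have \<mu>: "\<mu> \<noteq> 0" using fh(2) by (simp add: \<mu>_def)
    have "\<exists>s\<in>range to_fract. \<mu> = (\<Prod>i<card T. ds ! i) * s"
      unfolding \<mu>_def by (rule fin(2)) (use ds fh in auto)
    then obtain s where s: "\<mu> = (\<Prod>i<card T. ds ! i) * to_fract s" by auto
    then have "rdeg \<mu> = (\<Sum>i<card T. rdeg (ds ! i)) + int (degree s)"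
      using \<mu> ds ct by (auto simp: rdeg_mult rdeg_prod_lessThan rdeg_to_fract)
    then have low: "(\<Sum>i<card T. rdeg (ds ! i)) \<le> rdeg \<mu>" by simp
    have "\<exists>s\<in>Collect proper. det (mat (card T) (card T) (\<lambda>(a, b). F $$ (f a, h b))) = (\<Prod>i<card T. es ! i) * s"
      by (rule inf(2)) (use es fh in auto)
    then obtain s' where s': "proper s'"
      "det (s_diag (card T) (K \<circ> f)) * \<mu> * det (s_diag (card T) (\<Lambda> \<circ> h)) = (\<Prod>i<card T. es ! i) * s'"
      unfolding F_def \<mu>_def using fh(1) by (subst (asm) scaled_minor[OF E]) auto
    have lhs: "det (s_diag (card T) (K \<circ> f)) * \<mu> * det (s_diag (card T) (\<Lambda> \<circ> h)) \<noteq> 0"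
      using \<mu> by (simp add: det_s_diag_nonzero)
    then have s'nz: "s' \<noteq> 0" using s'(2) by auto
    have "rdeg (det (s_diag (card T) (K \<circ> f)) * \<mu> * det (s_diag (card T) (\<Lambda> \<circ> h))) =
      (\<Sum>a<card T. K (f a)) + rdeg \<mu> + (\<Sum>a<card T. \<Lambda> (h a))"
      using \<mu> by (simp add: rdeg_mult det_s_diag_nonzero rdeg_det_s_diag)
    moreover have "rdeg ((\<Prod>i<card T. es ! i) * s') = (\<Sum>i<card T. rdeg (es ! i)) + rdeg s'"
      using s'nz es ct by (simp add: rdeg_mult rdeg_prod_lessThan)
    moreover have "rdeg s' \<le> 0" using s'(1) s'nz by (simp add: proper_iff_deg_le deg_le_def)
    ultimately have "(\<Sum>a<card T. K (f a) + \<Lambda> (h a)) + rdeg \<mu> \<le> (\<Sum>i<card T. rdeg (es ! i))"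
      using s'(2) by (simp add: sum.distrib)
    then have "(\<Sum>i\<in>T. K i + \<Lambda> (r - 1 - i)) \<le> (\<Sum>i<card T. rdeg (es ! i)) - (\<Sum>i<card T. rdeg (ds ! i))"
      using low fh(3) by linarith
    also have "\<dots> = - (\<Sum>i<card T. a i)"
      unfolding sum_subtractf[symmetric] sum_negf[symmetric]
      using ds es ct by (intro sum.cong) (auto simp: a_def)
    finally show ?thesis .
  qed
  then show "(\<Sum>i\<in>T. int (k ! i) + int (l ! (r - 1 - i))) \<le> - (\<Sum>i<card T. a i)" if "T \<subseteq> {..<r}" for T
    using that by (simp add: K_def \<Lambda>_def)
  have refl: "(\<Sum>i<r. \<Lambda> (r - 1 - i)) = (\<Sum>i<r. \<Lambda> i)"
    using sum.nat_diff_reindex[of \<Lambda> r] by simp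
  have "(\<Sum>i<r. K i) + (\<Sum>i<r. \<Lambda> i) \<le> - (\<Sum>i<r. a i)"
    using upper[of "{..<r}"] refl by (simp add: sum.distrib)
  moreover have "- (\<Sum>i<r. a i) \<le> (\<Sum>i<r. K i) + (\<Sum>i<r. \<Lambda> i)"
  proof -
    obtain s where s: "(\<Prod>i<r. ds ! i) = det E * to_fract s" using fin1 by auto
    then have "rdeg (\<Prod>i<r. ds ! i) = rdeg (det E) + int (degree s)"
      using prod_nz by (auto simp: rdeg_mult rdeg_to_fract)
    then have 1: "rdeg (det E) \<le> (\<Sum>i<r. rdeg (ds ! i))" using ds by (simp add: rdeg_prod_lessThan)
    obtain s' where s': "proper s'" "(\<Prod>i<r. es ! i) = det F * s'" using inf1 by auto
    then have "s' \<noteq> 0" using prod_nz by auto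
    then have "rdeg (\<Prod>i<r. es ! i) = rdeg (det F) + rdeg s'" "rdeg s' \<le> 0"
      using s' nz by (auto simp: rdeg_mult proper_iff_deg_le deg_le_def)
    then have 2: "(\<Sum>i<r. rdeg (es ! i)) \<le> rdeg (det F)" using es by (simp add: rdeg_prod_lessThan)
    have "det F = det (s_diag r K) * det E * det (s_diag r \<Lambda>)"
      unfolding F_def using E by (simp add: det_mult[of _ r] mult_carrier_mat[of _ r r])
    then have "rdeg (det F) = (\<Sum>i<r. K i) + rdeg (det E) + (\<Sum>i<r. \<Lambda> i)"
      using nz by (simp add: rdeg_mult det_s_diag_nonzero rdeg_det_s_diag)
    moreover have "(\<Sum>i<r. rdeg (es ! i)) - (\<Sum>i<r. rdeg (ds ! i)) = - (\<Sum>i<r. a i)"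
      unfolding sum_subtractf[symmetric] sum_negf[symmetric]
      using ds es by (intro sum.cong) (auto simp: a_def)
    ultimately show ?thesis using 1 2 by linarith
  qed
  ultimately show "(\<Sum>i<r. int (k ! i)) + (\<Sum>i<r. int (l ! i)) = - (\<Sum>i<r. a i)"
    by (simp add: K_def \<Lambda>_def)
qed

section \<open>Equivalence over a subring\<close>

context subring_of_field
begin

definition equivalent :: "nat \<Rightarrow> 'b mat \<Rightarrow> 'b mat \<Rightarrow> bool" where
  "equivalent n A D \<longleftrightarrow> A \<in> carrier_mat n n \<and>
     (\<exists>U V. invertible_over n U \<and> invertible_over n V \<and> U * A * V = D)"

lemma equivalentI:
  "A \<in> carrier_mat n n \<Longrightarrow> invertible_over n U \<Longrightarrow> invertible_over n V \<Longrightarrow> U * A * V = D \<Longrightarrow> equivalent n A D"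
  by (auto simp: equivalent_def)

lemma equivalent_trans:
  assumes "equivalent n A B" "equivalent n B C"
  shows "equivalent n A C"
proof -
  obtain U V where 1: "A \<in> carrier_mat n n" "invertible_over n U" "invertible_over n V" "B = U * A * V"
    using assms(1) by (auto simp: equivalent_def)
  obtain U' V' where 2: "invertible_over n U'" "invertible_over n V'" "C = U' * B * V'"
    using assms(2) by (auto simp: equivalent_def)
  note c = 1(1) invertible_over_carrier[OF 1(2)] invertible_over_carrier[OF 1(3)]
    invertible_over_carrier[OF 2(1)] invertible_over_carrier[OF 2(2)]
  have "(U' * U) * A * (V * V') = C"
    unfolding 1(4) 2(3) using c by (simp add: assoc_mult_mat[of _ n n _ n _ n])
  then show ?thesis using 1 2 by (intro equivalentI[of _ _ "U' * U" "V * V'"] invertible_over_mult)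
qed

text \<open>
  A permutation matrix with rescaled rows.
\<close>

definition monomial_mat :: "nat \<Rightarrow> (nat \<Rightarrow> 'b) \<Rightarrow> (nat \<Rightarrow> nat) \<Rightarrow> 'b mat" where
  "monomial_mat n u \<pi> = mat n n (\<lambda>(i, j). if j = \<pi> i then u i else 0)"

lemma monomial_mat_carrier [simp]: "monomial_mat n u \<pi> \<in> carrier_mat n n"
  by (simp add: monomial_mat_def)

lemma monomial_mat_mult_index:
  assumes \<pi>: "\<And>i. i < n \<Longrightarrow> \<pi> i < n" and A: "A \<in> carrier_mat n c" and ij: "i < n" "j < c"
  shows "(monomial_mat n u \<pi> * A) $$ (i, j) = u i * A $$ (\<pi> i, j)"
proof -
  have "(monomial_mat n u \<pi> * A) $$ (i, j) = (\<Sum>k<n. (if k = \<pi> i then u i else 0) * A $$ (k, j))"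
    by (subst mult_mat_index_sum[OF monomial_mat_carrier A ij]) (use ij in \<open>simp add: monomial_mat_def\<close>)
  also have "\<dots> = (\<Sum>k<n. if k = \<pi> i then u i * A $$ (\<pi> i, j) else 0)"
    by (intro sum.cong) auto
  finally show ?thesis using \<pi>[OF ij(1)] by simp
qed

lemma invertible_over_monomial_mat:
  assumes \<pi>: "bij_betw \<pi> {..<n} {..<n}"
    and u: "\<And>i. i < n \<Longrightarrow> u i \<in> S" "\<And>i. i < n \<Longrightarrow> inverse (u i) \<in> S" "\<And>i. i < n \<Longrightarrow> u i \<noteq> 0"
  shows "invertible_over n (monomial_mat n u \<pi>)"
proof -
  define M where "M = mat n n (\<lambda>(i, j). if i = \<pi> j then inverse (u j) else 0)"
  have \<pi>': "\<And>i. i < n \<Longrightarrow> \<pi> i < n" using \<pi> by (auto simp: bij_betw_def)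
  have M: "M \<in> carrier_mat n n" by (simp add: M_def)
  have "monomial_mat n u \<pi> * M = 1\<^sub>m n"
  proof (rule eq_matI)
    fix i j assume ij: "i < dim_row (1\<^sub>m n :: 'b mat)" "j < dim_col (1\<^sub>m n :: 'b mat)"
    then have "\<pi> i = \<pi> j \<longleftrightarrow> i = j" using \<pi> by (auto simp: bij_betw_def inj_on_def)
    then show "(monomial_mat n u \<pi> * M) $$ (i, j) = 1\<^sub>m n $$ (i, j)"
      using ij u(3) \<pi>' by (subst monomial_mat_mult_index[OF \<pi>' M]) (auto simp: M_def)
  qed (simp_all add: M_def monomial_mat_def)
  moreover from this have "M * monomial_mat n u \<pi> = 1\<^sub>m n"
    using mat_mult_left_right_inverse[OF monomial_mat_carrier M] by simp
  moreover have "over (monomial_mat n u \<pi>)" "over M"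
    using u by (auto simp: over_def monomial_mat_def M_def)
  ultimately show ?thesis unfolding invertible_over_def using M by auto
qed

lemma equivalent_reindex:
  assumes A: "A \<in> carrier_mat n n" and \<pi>: "bij_betw \<pi> {..<n} {..<n}" and \<sigma>: "bij_betw \<sigma> {..<n} {..<n}"
    and u: "\<And>i. i < n \<Longrightarrow> u i \<in> S" "\<And>i. i < n \<Longrightarrow> inverse (u i) \<in> S" "\<And>i. i < n \<Longrightarrow> u i \<noteq> 0"
  shows "equivalent n A (mat n n (\<lambda>(i, j). u i * A $$ (\<pi> i, \<sigma> j)))"
proof (rule equivalentI[OF A])
  have \<pi>': "\<And>i. i < n \<Longrightarrow> \<pi> i < n" and \<sigma>': "\<And>i. i < n \<Longrightarrow> \<sigma> i < n" using \<pi> \<sigma> by (auto simp: bij_betw_def)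
  show "invertible_over n (monomial_mat n u \<pi>)" by (rule invertible_over_monomial_mat[OF \<pi> u])
  show "invertible_over n (monomial_mat n (\<lambda>_. 1) \<sigma>)\<^sup>T"
    by (intro invertible_over_transpose invertible_over_monomial_mat[OF \<sigma>]) auto
  define B where "B = monomial_mat n u \<pi> * A"
  have B: "B \<in> carrier_mat n n" using A by (simp add: B_def mult_carrier_mat[of _ n n])
  have "B * (monomial_mat n (\<lambda>_. 1) \<sigma>)\<^sup>T = (monomial_mat n (\<lambda>_. 1) \<sigma> * B\<^sup>T)\<^sup>T"
    using B by (simp add: transpose_mult[of _ n n _ n])
  also have "\<dots> = mat n n (\<lambda>(i, j). u i * A $$ (\<pi> i, \<sigma> j))"
  proof (rule eq_matI)
    fix i j assume "i < dim_row (mat n n (\<lambda>(i, j). u i * A $$ (\<pi> i, \<sigma> j)))" "j < dim_col (mat n n (\<lambda>(i, j). u i * A $$ (\<pi> i, \<sigma> j)))"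
    then have ij: "i < n" "j < n" by auto
    have "(monomial_mat n (\<lambda>_. 1) \<sigma> * B\<^sup>T)\<^sup>T $$ (i, j) = (monomial_mat n (\<lambda>_. 1) \<sigma> * B\<^sup>T) $$ (j, i)"
      using ij B by (subst index_transpose_mat) (auto simp: monomial_mat_def)
    also have "\<dots> = 1 * B\<^sup>T $$ (\<sigma> j, i)"
      by (rule monomial_mat_mult_index[OF \<sigma>' _ ij(2,1)]) (use B in auto)
    also have "\<dots> = B $$ (i, \<sigma> j)" using B ij \<sigma>' by simp
    also have "\<dots> = u i * A $$ (\<pi> i, \<sigma> j)"
      unfolding B_def by (rule monomial_mat_mult_index[OF \<pi>' A]) (use ij \<sigma>' in auto)
    finally show "(monomial_mat n (\<lambda>_. 1) \<sigma> * B\<^sup>T)\<^sup>T $$ (i, j) = mat n n (\<lambda>(i, j). u i * A $$ (\<pi> i, \<sigma> j)) $$ (i, j)"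
      using ij by simp
  qed (auto simp: monomial_mat_def B_def)
  finally show "monomial_mat n u \<pi> * A * (monomial_mat n (\<lambda>_. 1) \<sigma>)\<^sup>T = mat n n (\<lambda>(i, j). u i * A $$ (\<pi> i, \<sigma> j))"
    by (simp add: B_def)
qed

lemma invertible_over_addrow_mat:
  assumes "a \<in> S" "k \<noteq> l"
  shows "invertible_over n (addrow_mat n a k l)"
  using assms by (intro invertible_over_if_det[of _ n 1])
    (auto simp: det_addrow_mat over_def id_def)

end

text \<open>
  Products of such matrices are again of this form, which keeps block computations short.
\<close>

definition bordered :: "'b::semiring_0 \<Rightarrow> 'b vec \<Rightarrow> 'b mat \<Rightarrow> 'b mat" where
  "bordered f x A = mat (Suc (dim_row A)) (Suc (dim_col A))
     (\<lambda>(i, j). if i = 0 then (if j = 0 then f else 0) else if j = 0 then x $ (i - 1) else A $$ (i - 1, j - 1))"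

lemma bordered_carrier [simp]: "A \<in> carrier_mat n n \<Longrightarrow> bordered f x A \<in> carrier_mat (Suc n) (Suc n)"
  by (auto simp: bordered_def)

lemma bordered_index:
  assumes "A \<in> carrier_mat n n" "i < Suc n" "j < Suc n"
  shows "bordered f x A $$ (i, j) = (if i = 0 then (if j = 0 then f else 0)
    else if j = 0 then x $ (i - 1) else A $$ (i - 1, j - 1))"
  using assms by (simp add: bordered_def)

lemma bordered_mult:
  fixes f g :: "'b::comm_ring_1"
  assumes A: "A \<in> carrier_mat n n" and B: "B \<in> carrier_mat n n"
    and x: "x \<in> carrier_vec n" and y: "y \<in> carrier_vec n"
  shows "bordered f x A * bordered g y B = bordered (f * g) (g \<cdot>\<^sub>v x + A *\<^sub>v y) (A * B)"
proof (rule eq_matI)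
  have AB: "A * B \<in> carrier_mat n n" using A B by simp
  fix i j assume "i < dim_row (bordered (f * g) (g \<cdot>\<^sub>v x + A *\<^sub>v y) (A * B))"
    "j < dim_col (bordered (f * g) (g \<cdot>\<^sub>v x + A *\<^sub>v y) (A * B))"
  then have ij: "i < Suc n" "j < Suc n" using AB by (auto simp: bordered_def)
  have "(bordered f x A * bordered g y B) $$ (i, j) = (\<Sum>k<Suc n. bordered f x A $$ (i, k) * bordered g y B $$ (k, j))"
    using A B ij by (intro mult_mat_index_sum) auto
  also have "\<dots> = bordered f x A $$ (i, 0) * bordered g y B $$ (0, j) +
    (\<Sum>k<n. bordered f x A $$ (i, Suc k) * bordered g y B $$ (Suc k, j))"
    by (rule sum.lessThan_Suc_shift)
  also have "\<dots> = bordered (f * g) (g \<cdot>\<^sub>v x + A *\<^sub>v y) (A * B) $$ (i, j)"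
  proof (cases i)
    case 0
    then show ?thesis using ij by (simp add: bordered_index[OF A] bordered_index[OF B] bordered_index[OF AB])
  next
    case (Suc i')
    then have i': "i' < n" using ij by simp
    show ?thesis
    proof (cases j)
      case 0
      then show ?thesis using ij Suc i' A x y
        by (simp add: bordered_index[OF A] bordered_index[OF B] bordered_index[OF AB] mult_mat_vec_index_sum[OF A y]
            mult.commute del: index_mult_mat_vec)
    next
      case (Suc j')
      then have j': "j' < n" using ij by simp
      then show ?thesis using ij Suc \<open>i = Suc i'\<close> i'
        by (simp add: bordered_index[OF A] bordered_index[OF B] bordered_index[OF AB] mult_mat_index_sum[OF A B]
            del: index_mult_mat(1))
    qed
  qed
  finally show "(bordered f x A * bordered g y B) $$ (i, j) = bordered (f * g) (g \<cdot>\<^sub>v x + A *\<^sub>v y) (A * B) $$ (i, j)" .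
qed (auto simp: bordered_def)

lemma bordered_one: "bordered 1 (0\<^sub>v n) (1\<^sub>m n) = (1\<^sub>m (Suc n) :: 'b::comm_ring_1 mat)"
  by (intro eq_matI) (auto simp: bordered_def)

context subring_of_field
begin

lemma invertible_over_bordered:
  assumes U: "invertible_over n U" and y: "y \<in> carrier_vec n" "\<And>i. i < n \<Longrightarrow> y $ i \<in> S"
  shows "invertible_over (Suc n) (bordered 1 y U)"
proof -
  obtain W where W: "invertible_over n W" "U * W = 1\<^sub>m n" "W * U = 1\<^sub>m n"
    using U by (rule invertible_overE)
  note c = invertible_over_carrier[OF U] invertible_over_carrier[OF W(1)]
  note o = invertible_over_over[OF U] invertible_over_over[OF W(1)]
  define z where "z = - (W *\<^sub>v y)"
  have z: "z \<in> carrier_vec n" using c y by (simp add: z_def)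
  have zS: "z $ i \<in> S" if "i < n" for i
  proof -
    have "z $ i = - (\<Sum>j<n. W $$ (i, j) * y $ j)"
      using mult_mat_vec_index_sum[OF c(2) y(1) that] that c by (simp add: z_def)
    then show ?thesis using o c y that by (auto simp: over_def intro!: uminus_mem sum_mem mult_mem)
  qed
  have "U *\<^sub>v z = - ((U * W) *\<^sub>v y)"
    unfolding z_def using c y by (intro eq_vecI) (auto simp: assoc_mult_mat_vec[of _ n n _ n])
  then have "y + U *\<^sub>v z = 0\<^sub>v n" using W y by (intro eq_vecI) auto
  moreover have "z + W *\<^sub>v y = 0\<^sub>v n" unfolding z_def using c y by (intro eq_vecI) auto
  ultimately have "bordered 1 y U * bordered 1 z W = 1\<^sub>m (Suc n)" "bordered 1 z W * bordered 1 y U = 1\<^sub>m (Suc n)"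
    using c y z W by (simp_all add: bordered_mult bordered_one)
  moreover have "over (bordered 1 y U)" "over (bordered 1 z W)"
    using c o y(2) zS by (auto simp: over_def bordered_def)
  ultimately show ?thesis unfolding invertible_over_def using c
    by (intro conjI bexI[of _ "bordered 1 z W"]) auto
qed

text \<open>
  On the rows and columns with indices \<open>0\<close> and \<open>j + 1\<close> the matrix is \<open>h
  d\<^sub>j, 0; d\<^sub>j, t d\<^sub>j\<close>. One row and one column operation clear both diagonal entries of
  this block; what is left of it are the off-diagonal entries \<open>d\<^sub>j\<close> and \<open>- h t
  d\<^sub>j\<close>, and \<open>h t d\<^sub>j\<close> is a unit times the next invariant.
\<close>

lemma equivalent_bordered_diag:
  assumes jr: "j < r" and h: "h \<in> S" and t: "t \<in> S"
    and w: "w \<in> S" "inverse w \<in> S" "w \<noteq> 0"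
    and d': "\<And>i. i < j \<Longrightarrow> d' i = d i" "d' j = t * d j" "\<And>i. j < i \<Longrightarrow> d' i = d (Suc i)"
    and htd: "h * t * d j = w * d (Suc j)"
  shows "equivalent (Suc r) (bordered (h * d j) (d j \<cdot>\<^sub>v unit_vec r j) (diag_of r d')) (diag_of (Suc r) d)"
proof -
  define N where "N = bordered (h * d j) (d j \<cdot>\<^sub>v unit_vec r j) (diag_of r d')"
  have N: "N \<in> carrier_mat (Suc r) (Suc r)" by (simp add: N_def)
  define A1 where "A1 = addrow (- h) 0 (Suc j) N"
  have A1: "A1 \<in> carrier_mat (Suc r) (Suc r)" "A1 = addrow_mat (Suc r) (- h) 0 (Suc j) * N"
    using N jr by (auto simp: A1_def addrow_mat[of _ "Suc r" "Suc r"])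
  define A2 where "A2 = addcol (- t) (Suc j) 0 A1"
  have A2: "A2 \<in> carrier_mat (Suc r) (Suc r)" "A2 = A1 * addrow_mat (Suc r) (- t) 0 (Suc j)"
    using A1(1) jr by (auto simp: A2_def addcol_mat[of _ "Suc r" "Suc r"])
  have e1: "equivalent (Suc r) N A2"
    using N h t by (intro equivalentI[of _ _ "addrow_mat (Suc r) (- h) 0 (Suc j)" "addrow_mat (Suc r) (- t) 0 (Suc j)"])
      (auto simp: A2 A1 intro!: invertible_over_addrow_mat)
  define \<pi> where "\<pi> i = (if i < j then Suc i else if i = j then Suc j else if i = Suc j then 0 else i)" for i
  define \<sigma> where "\<sigma> i = (if i < j then Suc i else if i = j then 0 else i)" for i
  \<comment> \<open>The entry at \<open>(0, j + 1)\<close> is \<open>- w * d (Suc j)\<close>, and row \<open>0\<close> moves to position \<open>j + 1\<close>.\<close>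
  define u where "u i = (if i = Suc j then - inverse w else 1)" for i
  have \<pi>: "bij_betw \<pi> {..<Suc r} {..<Suc r}"
    by (rule bij_betw_byWitness[where f' = "\<lambda>i. if i = 0 then Suc j else if i \<le> Suc j then i - 1 else i"])
      (use jr in \<open>auto simp: \<pi>_def\<close>)
  have \<sigma>: "bij_betw \<sigma> {..<Suc r} {..<Suc r}"
    by (rule bij_betw_byWitness[where f' = "\<lambda>i. if i = 0 then j else if i \<le> j then i - 1 else i"])
      (use jr in \<open>auto simp: \<sigma>_def\<close>)
  have e2: "equivalent (Suc r) A2 (mat (Suc r) (Suc r) (\<lambda>(i, k). u i * A2 $$ (\<pi> i, \<sigma> k)))"
    by (rule equivalent_reindex[OF A2(1) \<pi> \<sigma>]) (use w in \<open>auto simp: u_def\<close>)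
  have Nidx: "N $$ (a, b) = (if a = 0 then (if b = 0 then h * d j else 0)
      else if b = 0 then (if a = Suc j then d j else 0) else if a = b then d' (a - 1) else 0)"
    if "a < Suc r" "b < Suc r" for a b
    using that unfolding N_def by (subst bordered_index[OF diag_of_carrier]) (auto simp: diag_of_def unit_vec_def)
  have A1idx: "A1 $$ (a, b) = (if a = 0 then (if b = Suc j then - h * d' j else 0)
      else if b = 0 then (if a = Suc j then d j else 0) else if a = b then d' (a - 1) else 0)"
    if "a < Suc r" "b < Suc r" for a b
    using that N jr by (auto simp: A1_def Nidx)
  have A2idx: "A2 $$ (a, b) = (if a = 0 then (if b = Suc j then - h * d' j else 0)
      else if b = 0 then (if a = Suc j then d j else 0) else if a = b \<and> a \<noteq> Suc j then d' (a - 1) else 0)"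
    if "a < Suc r" "b < Suc r" for a b
    using that A1(1) jr d'(2) by (auto simp: A2_def A1idx)
  have hd: "h * d' j = w * d (Suc j)" using htd d'(2) by (simp add: mult.assoc)
  have "mat (Suc r) (Suc r) (\<lambda>(i, k). u i * A2 $$ (\<pi> i, \<sigma> k)) = diag_of (Suc r) d"
  proof (rule eq_matI)
    fix a b assume "a < dim_row (diag_of (Suc r) d)" "b < dim_col (diag_of (Suc r) d)"
    then have ab: "a < Suc r" "b < Suc r" by auto
    have "\<pi> a < Suc r" "\<sigma> b < Suc r" using ab jr by (auto simp: \<pi>_def \<sigma>_def)
    then have "mat (Suc r) (Suc r) (\<lambda>(i, k). u i * A2 $$ (\<pi> i, \<sigma> k)) $$ (a, b) =
      u a * (if \<pi> a = 0 then (if \<sigma> b = Suc j then - h * d' j else 0)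
      else if \<sigma> b = 0 then (if \<pi> a = Suc j then d j else 0)
      else if \<pi> a = \<sigma> b \<and> \<pi> a \<noteq> Suc j then d' (\<pi> a - 1) else 0)"
      using ab by (simp add: A2idx)
    also have "\<dots> = (if a = b then d a else 0)"
    proof -
      consider "a < j" | "a = j" | "a = Suc j" | "Suc j < a" by linarith
      then show ?thesis
      proof cases
        case 1
        then show ?thesis by (auto simp: \<pi>_def \<sigma>_def u_def d'(1))
      next
        case 2
        then show ?thesis by (auto simp: \<pi>_def \<sigma>_def u_def)
      next
        case 3
        then show ?thesis using w(3) hd by (auto simp: \<pi>_def \<sigma>_def u_def)
      next
        case 4
        then have "d' (a - Suc 0) = d a" using d'(3)[of "a - 1"] by simp
        then show ?thesis using 4 by (auto simp: \<pi>_def \<sigma>_def u_def)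
      qed
    qed
    finally show "mat (Suc r) (Suc r) (\<lambda>(i, k). u i * A2 $$ (\<pi> i, \<sigma> k)) $$ (a, b) = diag_of (Suc r) d $$ (a, b)"
      using ab by (simp add: diag_of_def)
  qed (auto simp: diag_of_def)
  then show ?thesis using equivalent_trans[OF e1 e2] by (simp add: N_def)
qed

text \<open>
  The inverse step of merging two neighbouring invariants: bordering \<open>A\<close> by \<open>f\<close> and a
  suitable column splits the merged invariant \<open>d' j\<close> into \<open>d j\<close> and \<open>d (Suc
  j)\<close>. The column may be changed by multiples of \<open>f\<close>, since these can be removed by row
  operations; this freedom is needed to satisfy the condition for both subrings with one matrix.
\<close>

lemma equivalent_bordered:
  assumes A: "equivalent r A (diag_of r d')"
    and jr: "j < r" and h: "h \<in> S" and t: "t \<in> S"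
    and w: "w \<in> S" "inverse w \<in> S" "w \<noteq> 0"
    and d': "\<And>i. i < j \<Longrightarrow> d' i = d i" "d' j = t * d j" "\<And>i. j < i \<Longrightarrow> d' i = d (Suc i)"
    and htd: "h * t * d j = w * d (Suc j)" and f: "f = h * d j"
  shows "\<exists>\<alpha>. \<forall>x \<in> carrier_vec r. (\<forall>i<r. \<exists>y\<in>S. x $ i = \<alpha> i + f * y) \<longrightarrow>
    equivalent (Suc r) (bordered f x A) (diag_of (Suc r) d)"
proof -
  obtain U V where UV: "A \<in> carrier_mat r r" "invertible_over r U" "invertible_over r V" "U * A * V = diag_of r d'"
    using A by (auto simp: equivalent_def)
  obtain W where W: "invertible_over r W" "U * W = 1\<^sub>m r" "W * U = 1\<^sub>m r"
    using UV(2) by (rule invertible_overE)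
  note c = UV(1) invertible_over_carrier[OF UV(2)] invertible_over_carrier[OF UV(3)] invertible_over_carrier[OF W(1)]
  define e where "e = d j \<cdot>\<^sub>v unit_vec r j"
  have e: "e \<in> carrier_vec r" by (simp add: e_def)
  define \<alpha> where "\<alpha> = W *\<^sub>v e"
  have \<alpha>: "\<alpha> \<in> carrier_vec r" unfolding \<alpha>_def by (rule mult_mat_vec_carrier[OF c(4) e])
  have "equivalent (Suc r) (bordered f x A) (diag_of (Suc r) d)"
    if x: "x \<in> carrier_vec r" "\<forall>i<r. \<exists>y\<in>S. x $ i = \<alpha> $ i + f * y" for x
  proof -
    obtain y where y: "\<And>i. i < r \<Longrightarrow> y i \<in> S" "\<And>i. i < r \<Longrightarrow> x $ i = \<alpha> $ i + f * y i"
      using x(2) by metis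
    define z where "z = - (U *\<^sub>v vec r y)"
    have z: "z \<in> carrier_vec r"
      unfolding z_def using mult_mat_vec_carrier[OF c(2), of "vec r y"] by simp
    have zS: "z $ i \<in> S" if "i < r" for i
    proof -
      have "z $ i = - (\<Sum>j<r. U $$ (i, j) * y j)"
        using mult_mat_vec_index_sum[OF c(2) _ that, of "vec r y"] that c by (simp add: z_def)
      then show ?thesis using invertible_over_over[OF UV(2)] c y that
        by (auto simp: over_def intro!: uminus_mem sum_mem mult_mem)
    qed
    have xeq: "x = \<alpha> + f \<cdot>\<^sub>v vec r y" using x(1) \<alpha> y by (intro eq_vecI) auto
    have "U *\<^sub>v x = U *\<^sub>v \<alpha> + f \<cdot>\<^sub>v (U *\<^sub>v vec r y)"
      unfolding xeq using c \<alpha> by (simp add: mult_add_distrib_mat_vec[of _ r r] mult_mat_vec[of _ r r])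
    also have "U *\<^sub>v \<alpha> = e"
      unfolding \<alpha>_def using c e W by (simp add: assoc_mult_mat_vec[of U r r W r, symmetric])
    finally have Ux: "f \<cdot>\<^sub>v z + U *\<^sub>v x = e"
      using e c by (intro eq_vecI) (auto simp: z_def algebra_simps)
    have "bordered 1 z U * bordered f x A * bordered 1 (0\<^sub>v r) V = bordered f e (diag_of r d')"
    proof -
      have "bordered 1 z U * bordered f x A = bordered f e (U * A)"
        using bordered_mult[OF c(2,1) z x(1), of 1 f] Ux by simp
      moreover have "(1 \<cdot>\<^sub>v e + (U * A) *\<^sub>v 0\<^sub>v r) = e"
        using e mult_mat_zero_vec[OF mult_carrier_mat[OF c(2,1)]] by simp
      ultimately show ?thesis
        using bordered_mult[OF mult_carrier_mat[OF c(2,1)] c(3) e, of "0\<^sub>v r" f 1] UV(4) by simp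
    qed
    then have "equivalent (Suc r) (bordered f x A) (bordered f e (diag_of r d'))"
      using z zS UV c by (intro equivalentI[of _ _ "bordered 1 z U" "bordered 1 (0\<^sub>v r) V"] invertible_over_bordered) auto
    moreover have "equivalent (Suc r) (bordered f e (diag_of r d')) (diag_of (Suc r) d)"
      unfolding f e_def by (rule equivalent_bordered_diag[OF jr h t w d' htd])
    ultimately show ?thesis by (rule equivalent_trans)
  qed
  then show ?thesis by (intro exI[of _ "\<lambda>i. \<alpha> $ i"]) blast
qed

end

section \<open>A square matrix with prescribed invariants\<close>

text \<open>
  Split off linear factors one at a time; this is the only place where the field has to be algebraically closed.
\<close>

lemma divisor_of_every_degree:
  fixes p :: "'a::field poly"
  assumes closed: "\<forall>p :: 'a poly. degree p > 0 \<longrightarrow> (\<exists>x. poly p x = 0)"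
    and p: "p \<noteq> 0" and e: "e \<le> degree p"
  shows "\<exists>g x. p = g * x \<and> degree g = e"
  using e
proof (induction e)
  case 0
  show ?case by (intro exI[of _ 1] exI[of _ p]) simp
next
  case (Suc e)
  then obtain g x where gx: "p = g * x" "degree g = e" by auto
  then have nz: "g \<noteq> 0" "x \<noteq> 0" using p by auto
  then have "degree x > 0" using Suc.prems gx by (simp add: degree_mult_eq)
  then obtain c where "poly x c = 0" using closed by blast
  then obtain y where y: "x = [:- c, 1:] * y" by (auto simp: poly_eq_0_iff_dvd elim: dvdE)
  have "p = (g * [:- c, 1:]) * y" using gx y by (simp only: mult.assoc)
  moreover have "degree (g * [:- c, 1:]) = Suc e" using nz gx(2) by (subst degree_mult_eq) auto
  ultimately show ?case by blast
qed

text \<open>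
  Dividing by \<open>f\<close>, this says that every rational function is the sum of a polynomial and a function
  of degree at most \<open>k0 - k\<close>, which holds as \<open>k \<le> k0\<close>.
\<close>

lemma approximation_at_both_places:
  fixes f \<alpha> \<beta> :: "'a::field poly fract"
  assumes f: "f \<noteq> 0" and k: "k \<le> k0"
  shows "\<exists>x. (\<exists>y \<in> range to_fract. x = \<alpha> + f * y) \<and>
    (\<exists>z \<in> Collect proper. s_var powi k * x * s_var powi l = \<beta> + s_var powi k0 * f * s_var powi l * z)"
proof -
  have nz: "s_var powi c \<noteq> (0 :: 'a poly fract)" for c by simp
  obtain p h where ph: "(\<beta> / (s_var powi k * s_var powi l) - \<alpha>) / f = to_fract p + h" "deg_le h (- 1)"
    by (rule polynomial_part)
  define x where "x = \<alpha> + f * to_fract p"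
  have "\<beta> / (s_var powi k * s_var powi l) - \<alpha> = f * (to_fract p + h)"
    using ph(1) f by (simp add: field_simps)
  then have "x = \<beta> / (s_var powi k * s_var powi l) - f * h"
    by (simp add: x_def algebra_simps)
  then have "s_var powi k * x * s_var powi l = \<beta> - s_var powi k * f * s_var powi l * h"
    using nz by (simp add: field_simps)
  also have "s_var powi k * f * s_var powi l * h = s_var powi k0 * f * s_var powi l * (s_var powi (k - k0) * h)"
  proof -
    have "(s_var :: 'a poly fract) powi k = s_var powi k0 * s_var powi (k - k0)"
      by (simp flip: power_int_add)
    then show ?thesis by (simp only: mult_ac)
  qed
  finally have "s_var powi k * x * s_var powi l =
    \<beta> + s_var powi k0 * f * s_var powi l * (s_var powi (k - k0) * - h)"
    by simp
  moreover have "deg_le (s_var powi (k - k0) * - h) (k - k0 + - 1)"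
    using ph(2) by (intro deg_le_mult) auto
  then have "proper (s_var powi (k - k0) * - h)"
    using k unfolding proper_iff_deg_le by (rule_tac deg_le_mono) auto
  ultimately show ?thesis unfolding x_def by blast
qed

lemma discrete_intermediate:
  fixes a :: "nat \<Rightarrow> int"
  assumes "a 0 \<le> x" "x \<le> a r" "r > 0"
  shows "\<exists>j<r. a j \<le> x \<and> x \<le> a (Suc j)"
  using assms(3,2)
proof (induction r rule: nat_induct_non_zero)
  case 1
  then show ?case using assms(1) by auto
next
  case (Suc r)
  then show ?case by (cases "x \<le> a r") (auto simp: less_Suc_eq)
qed

definition merge_at :: "nat \<Rightarrow> 'b \<Rightarrow> (nat \<Rightarrow> 'b) \<Rightarrow> nat \<Rightarrow> 'b" where
  "merge_at j y a i = (if i < j then a i else if i = j then y else a (Suc i))"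

lemma sum_merge_at:
  fixes a :: "nat \<Rightarrow> int"
  shows "(\<Sum>i<t. merge_at j (a j + a (Suc j) - x) a i) = (if t \<le> j then (\<Sum>i<t. a i) else (\<Sum>i<Suc t. a i) - x)"
  by (induction t) (auto simp: merge_at_def not_le less_Suc_eq_le)

text \<open>
  The bordering construction. The sequence \<open>k\<close> has to be nonincreasing, for the approximation of the first
  column; \<open>l\<close> may be in any order.
\<close>

lemma exists_square_with_invariants:
  fixes \<phi> :: "nat \<Rightarrow> 'a::field poly fract" and q k l :: "nat \<Rightarrow> int"
  assumes closed: "\<forall>p :: 'a poly. degree p > 0 \<longrightarrow> (\<exists>x. poly p x = 0)"
    and r: "r > 0"
    and "\<And>i. i < r \<Longrightarrow> \<phi> i \<noteq> 0" "\<And>i. Suc i < r \<Longrightarrow> \<phi> (Suc i) / \<phi> i \<in> range to_fract"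
    and "\<And>i. Suc i < r \<Longrightarrow> q i \<le> q (Suc i)"
    and "\<And>i j. i \<le> j \<Longrightarrow> j < r \<Longrightarrow> k j \<le> k i"
    and "\<And>T. T \<subseteq> {..<r} \<Longrightarrow> (\<Sum>i<card T. rdeg (\<phi> i) + q i) \<le> (\<Sum>i\<in>T. - (k i + l i))"
    and "(\<Sum>i<r. rdeg (\<phi> i) + q i) = (\<Sum>i<r. - (k i + l i))"
  shows "\<exists>E. polyring.equivalent r E (diag_of r \<phi>) \<and>
    properring.equivalent r (s_diag r k * E * s_diag r l) (s_diag r (\<lambda>i. - q i))"
  using r assms(3-)
proof (induction r arbitrary: \<phi> q k l rule: nat_induct_non_zero)
  case 1
  have nz: "\<phi> 0 \<noteq> 0" using "1.prems"(1) by simp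
  have deg: "rdeg (\<phi> 0) + q 0 = - (k 0 + l 0)" using "1.prems"(6) by simp
  define u where "u = s_var powi (- q 0 - k 0 - l 0) / \<phi> 0"
  have u: "u \<noteq> 0" "rdeg u = 0" using nz deg by (auto simp: u_def rdeg_divide)
  then have uS: "proper u" "proper (inverse u)"
    by (auto simp: proper_iff_deg_le deg_le_def rdeg_inverse)
  have "properring.invertible_over 1 (diag_of 1 (\<lambda>_. u))"
  proof (rule properring.invertible_over_if_det[of _ _ "inverse u"])
    show "det (diag_of 1 (\<lambda>_. u)) * inverse u = 1" using u by (simp add: det_diag_of)
  qed (use uS in \<open>auto simp: properring.over_def diag_of_def\<close>)
  moreover have "s_var powi (- q 0) = u * (s_var powi k 0 * \<phi> 0 * s_var powi l 0)"
  proof -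
    have "s_var powi (- q 0) = (s_var :: 'a poly fract) powi ((- q 0 - k 0 - l 0) + k 0 + l 0)" by simp
    also have "\<dots> = s_var powi (- q 0 - k 0 - l 0) * s_var powi k 0 * s_var powi l 0"
      by (simp only: power_int_add s_var_nonzero simp_thms)
    finally show ?thesis using nz by (simp add: u_def field_simps)
  qed
  then have "diag_of 1 (\<lambda>_. u) * (s_diag 1 k * diag_of 1 \<phi> * s_diag 1 l) * 1\<^sub>m 1 = s_diag 1 (\<lambda>i. - q i)"
    by (simp add: s_diag_def diag_of_mult right_mult_one_mat[OF diag_of_carrier])
      (auto simp: diag_of_def)
  ultimately have "properring.equivalent 1 (s_diag 1 k * diag_of 1 \<phi> * s_diag 1 l) (s_diag 1 (\<lambda>i. - q i))"
    by (intro properring.equivalentI[of _ _ "diag_of 1 (\<lambda>_. u)" "1\<^sub>m 1"])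
      (auto simp: s_diag_def diag_of_mult)
  moreover have "polyring.equivalent 1 (diag_of 1 \<phi>) (diag_of 1 \<phi>)"
    by (intro polyring.equivalentI[of _ _ "1\<^sub>m 1" "1\<^sub>m 1"]) auto
  ultimately show ?case by blast
next
  case (Suc r)
  note nz = Suc.prems(1) and chain = Suc.prems(2) and qmono = Suc.prems(3) and kmono = Suc.prems(4)
    and maj = Suc.prems(5) and total = Suc.prems(6)
  define a where "a i = rdeg (\<phi> i) + q i" for i
  define D where "D i = - (k i + l i)" for i
  have "a 0 \<le> D 0" using maj[of "{0}"] by (simp add: a_def D_def)
  moreover have "D 0 \<le> a r"
  proof -
    have "(\<Sum>i<r. a i) \<le> (\<Sum>i\<in>Suc ` {..<r}. D i)"
      using maj[of "Suc ` {..<r}"] by (auto simp: a_def D_def card_image)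
    moreover have "(\<Sum>i<Suc r. D i) = D 0 + (\<Sum>i<r. D (Suc i))" by (rule sum.lessThan_Suc_shift)
    moreover have "(\<Sum>i<Suc r. a i) = (\<Sum>i<Suc r. D i)" using total by (simp only: a_def D_def)
    ultimately show ?thesis by (simp add: sum.reindex)
  qed
  ultimately obtain j where j: "j < r" "a j \<le> D 0" "D 0 \<le> a (Suc j)"
    using discrete_intermediate[of a "D 0" r] Suc.hyps by blast
  have nzj: "\<phi> j \<noteq> 0" "\<phi> (Suc j) \<noteq> 0" using nz j by auto
  obtain P where P: "\<phi> (Suc j) / \<phi> j = to_fract P" using chain[of j] j by auto
  have Pnz: "P \<noteq> 0" using P nzj by auto
  have "rdeg (\<phi> (Suc j) / \<phi> j) = int (degree P)" using P Pnz by (simp add: rdeg_to_fract)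
  then have degP: "int (degree P) = rdeg (\<phi> (Suc j)) - rdeg (\<phi> j)" using nzj by (simp add: rdeg_divide)
  \<comment> \<open>The excess of the required degree over \<open>a j\<close> is given to \<open>f\<close> as far as possible, the rest to the order \<open>p\<close>.\<close>
  define e where "e = min (nat (D 0 - a j)) (degree P)"
  obtain g x where gx: "P = g * x" "degree g = e"
    using divisor_of_every_degree[OF closed Pnz, of e] by (auto simp: e_def)
  have gxnz: "g \<noteq> 0" "x \<noteq> 0" using gx Pnz by auto
  define f where "f = to_fract g * \<phi> j"
  have fnz: "f \<noteq> 0" using gxnz nzj by (simp add: f_def)
  have degf: "rdeg f = int e + rdeg (\<phi> j)" using gxnz nzj gx by (simp add: f_def rdeg_mult rdeg_to_fract)
  define p where "p = D 0 - rdeg f"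
  have p: "q j \<le> p" "p \<le> q (Suc j)"
    using j qmono[of j] degP degf by (auto simp: p_def e_def a_def min_def split: if_splits)
  have \<phi>j: "\<phi> (Suc j) = to_fract x * f"
  proof -
    have "\<phi> (Suc j) = to_fract P * \<phi> j" using P nzj by (simp add: field_simps)
    then show ?thesis by (simp add: f_def gx mult_ac)
  qed
  define \<phi>' where "\<phi>' = merge_at j (to_fract x * \<phi> j) \<phi>"
  define q' where "q' = merge_at j (q j + q (Suc j) - p) q"
  have a': "rdeg (\<phi>' i) + q' i = merge_at j (a j + a (Suc j) - D 0) a i" for i
    using degf gxnz nzj fnz
    by (auto simp: \<phi>'_def q'_def merge_at_def a_def p_def \<phi>j rdeg_mult rdeg_to_fract)
  have "\<exists>E. polyring.equivalent r E (diag_of r \<phi>') \<and>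
    properring.equivalent r (s_diag r (k \<circ> Suc) * E * s_diag r (l \<circ> Suc)) (s_diag r (\<lambda>i. - q' i))"
  proof (rule Suc.IH)
    show "\<phi>' i \<noteq> 0" if "i < r" for i using that nz nzj gxnz by (auto simp: \<phi>'_def merge_at_def)
    show "\<phi>' (Suc i) / \<phi>' i \<in> range to_fract" if i: "Suc i < r" for i
    proof -
      consider "Suc i < j" | "Suc i = j" | "i = j" | "j < i" by linarith
      then show ?thesis
      proof cases
        case 1
        then show ?thesis using chain[of i] i by (simp add: \<phi>'_def merge_at_def)
      next
        case 2
        then have "\<phi>' (Suc i) / \<phi>' i = to_fract x * (\<phi> (Suc i) / \<phi> i)" by (auto simp: \<phi>'_def merge_at_def)
        then show ?thesis using polyring.mult_mem[OF rangeI chain[of i], of x] i by simp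
      next
        case 3
        then have "\<phi>' (Suc i) / \<phi>' i = to_fract g * (\<phi> (Suc (Suc j)) / \<phi> (Suc j))"
          using gxnz nzj by (auto simp: \<phi>'_def merge_at_def \<phi>j f_def field_simps)
        then show ?thesis using polyring.mult_mem[OF rangeI chain[of "Suc j"], of g] 3 i by simp
      next
        case 4
        then show ?thesis using chain[of "Suc i"] i by (simp add: \<phi>'_def merge_at_def)
      qed
    qed
    show "q' i \<le> q' (Suc i)" if i: "Suc i < r" for i
    proof -
      consider "Suc i < j" | "Suc i = j" | "i = j" | "j < i" by linarith
      then show ?thesis
        using qmono[of i] qmono[of "Suc i"] p i by cases (auto simp: q'_def merge_at_def)
    qed
    show "(k \<circ> Suc) b \<le> (k \<circ> Suc) i" if "i \<le> b" "b < r" for i b using kmono that by simp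
    show "(\<Sum>i<card T. rdeg (\<phi>' i) + q' i) \<le> (\<Sum>i\<in>T. - ((k \<circ> Suc) i + (l \<circ> Suc) i))" if T: "T \<subseteq> {..<r}" for T
    proof -
      have fin: "finite T" using T finite_subset by blast
      have Suc_sum: "(\<Sum>i\<in>T. - ((k \<circ> Suc) i + (l \<circ> Suc) i)) = (\<Sum>i\<in>Suc ` T. D i)"
        by (simp add: sum.reindex D_def)
      show ?thesis
      proof (cases "card T \<le> j")
        case True
        have "(\<Sum>i<card (Suc ` T). a i) \<le> (\<Sum>i\<in>Suc ` T. D i)"
          unfolding a_def D_def using T by (intro maj) auto
        then show ?thesis unfolding Suc_sum a' sum_merge_at using True by (simp add: card_image)
      next
        case False
        have "(\<Sum>i<card (insert 0 (Suc ` T)). a i) \<le> (\<Sum>i\<in>insert 0 (Suc ` T). D i)"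
          unfolding a_def D_def using T by (intro maj) auto
        moreover have "card (insert 0 (Suc ` T)) = Suc (card T)" using fin by (simp add: card_image)
        moreover have "(\<Sum>i\<in>insert 0 (Suc ` T). D i) = D 0 + (\<Sum>i\<in>Suc ` T. D i)" using fin by (subst sum.insert) auto
        ultimately show ?thesis unfolding Suc_sum a' sum_merge_at using False by simp
      qed
    qed
    show "(\<Sum>i<r. rdeg (\<phi>' i) + q' i) = (\<Sum>i<r. - ((k \<circ> Suc) i + (l \<circ> Suc) i))"
    proof -
      have "(\<Sum>i<Suc r. D i) = D 0 + (\<Sum>i<r. D (Suc i))" by (rule sum.lessThan_Suc_shift)
      moreover have "(\<Sum>i<Suc r. a i) = (\<Sum>i<Suc r. D i)" using total by (simp only: a_def D_def)
      ultimately have "(\<Sum>i<Suc r. a i) - D 0 = (\<Sum>i<r. D (Suc i))" by simp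
      then show ?thesis unfolding a' sum_merge_at using j by (simp add: D_def del: sum.lessThan_Suc)
    qed
  qed
  then obtain E' where E': "polyring.equivalent r E' (diag_of r \<phi>')"
    "properring.equivalent r (s_diag r (k \<circ> Suc) * E' * s_diag r (l \<circ> Suc)) (s_diag r (\<lambda>i. - q' i))"
    by blast
  have E'c: "E' \<in> carrier_mat r r" using E'(1) by (simp add: polyring.equivalent_def)
  \<comment> \<open>Every first column congruent to \<open>\<alpha>\<close> modulo \<open>f\<close> gives the right finite invariants.\<close>
  have "\<exists>\<alpha>. \<forall>x \<in> carrier_vec r. (\<forall>i<r. \<exists>y\<in>range to_fract. x $ i = \<alpha> i + f * y) \<longrightarrow>
    polyring.equivalent (Suc r) (bordered f x E') (diag_of (Suc r) \<phi>)"
    by (rule polyring.equivalent_bordered[OF E'(1) j(1), of "to_fract g" "to_fract x" 1])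
      (auto simp: \<phi>'_def merge_at_def f_def \<phi>j mult_ac polyring.one_mem)
  then obtain \<alpha> where \<alpha>: "\<And>x. x \<in> carrier_vec r \<Longrightarrow> \<forall>i<r. \<exists>y\<in>range to_fract. x $ i = \<alpha> i + f * y \<Longrightarrow>
    polyring.equivalent (Suc r) (bordered f x E') (diag_of (Suc r) \<phi>)" by blast
  \<comment> \<open>After scaling, the corner is \<open>f'\<close>, of degree \<open>- p\<close>; the unit \<open>w\<close> is the quotient of \<open>f'\<close> and \<open>s\<close> to the power \<open>- p\<close>.\<close>
  define f' where "f' = s_var powi k 0 * f * s_var powi l 0"
  define w where "w = f' * s_var powi p"
  have degf': "f' \<noteq> 0" "rdeg f' = - p"
    using fnz by (auto simp: f'_def rdeg_mult p_def D_def)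
  have w: "w \<noteq> 0" "rdeg w = 0" using degf' by (auto simp: w_def rdeg_mult)
  have powi_shift: "s_var powi b * s_var powi c = (s_var :: 'a poly fract) powi (b + c)" for b c
    by (simp flip: power_int_add)
  have "\<exists>\<beta>. \<forall>x \<in> carrier_vec r. (\<forall>i<r. \<exists>y\<in>Collect proper. x $ i = \<beta> i + f' * y) \<longrightarrow>
    properring.equivalent (Suc r) (bordered f' x (s_diag r (k \<circ> Suc) * E' * s_diag r (l \<circ> Suc)))
      (diag_of (Suc r) (\<lambda>i. s_var powi (- q i)))"
  proof (rule properring.equivalent_bordered[OF E'(2)[unfolded s_diag_def[of r "\<lambda>i. - q' i"]] j(1), of "f' * s_var powi q j" "s_var powi (p - q (Suc j))" w])
    show "f' * s_var powi q j \<in> Collect proper" "s_var powi (p - q (Suc j)) \<in> Collect proper"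
      "w \<in> Collect proper" "inverse w \<in> Collect proper" "w \<noteq> 0"
      using p degf' w by (auto simp: proper_iff_deg_le deg_le_def rdeg_mult rdeg_inverse)
    show "(s_var :: 'a poly fract) powi - q' i = s_var powi - q i" if "i < j" for i using that by (simp add: q'_def merge_at_def)
    show "(s_var :: 'a poly fract) powi - q' i = s_var powi - q (Suc i)" if "j < i" for i using that by (simp add: q'_def merge_at_def)
    show "(s_var :: 'a poly fract) powi - q' j = s_var powi (p - q (Suc j)) * s_var powi - q j"
      unfolding powi_shift by (simp add: q'_def merge_at_def algebra_simps)
    show "f' * s_var powi q j * s_var powi (p - q (Suc j)) * s_var powi - q j = w * s_var powi - q (Suc j)"
      unfolding w_def mult.assoc powi_shift by simp
    show "f' = f' * s_var powi q j * s_var powi - q j"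
      unfolding mult.assoc powi_shift by simp
  qed
  then obtain \<beta> where \<beta>: "\<And>x. x \<in> carrier_vec r \<Longrightarrow> \<forall>i<r. \<exists>y\<in>Collect proper. x $ i = \<beta> i + f' * y \<Longrightarrow>
    properring.equivalent (Suc r) (bordered f' x (s_diag r (k \<circ> Suc) * E' * s_diag r (l \<circ> Suc)))
      (diag_of (Suc r) (\<lambda>i. s_var powi (- q i)))" by blast
  have "\<exists>x. (\<exists>y \<in> range to_fract. x = \<alpha> i + f * y) \<and>
    (\<exists>z \<in> Collect proper. s_var powi k (Suc i) * x * s_var powi l 0 = \<beta> i + f' * z)" if "i < r" for i
    unfolding f'_def by (rule approximation_at_both_places[OF fnz]) (use kmono that in auto)
  then obtain x where x: "\<And>i. i < r \<Longrightarrow> \<exists>y \<in> range to_fract. x i = \<alpha> i + f * y"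
    "\<And>i. i < r \<Longrightarrow> \<exists>z \<in> Collect proper. s_var powi k (Suc i) * x i * s_var powi l 0 = \<beta> i + f' * z"
    by metis
  define E where "E = bordered f (vec r x) E'"
  have "polyring.equivalent (Suc r) E (diag_of (Suc r) \<phi>)"
    unfolding E_def using x(1) by (intro \<alpha>) auto
  moreover have "s_diag (Suc r) k * E * s_diag (Suc r) l =
    bordered f' (vec r (\<lambda>i. s_var powi k (Suc i) * x i * s_var powi l 0)) (s_diag r (k \<circ> Suc) * E' * s_diag r (l \<circ> Suc))"
  proof (rule eq_matI)
    have Ec: "E \<in> carrier_mat (Suc r) (Suc r)" using E'c by (simp add: E_def)
    have c: "s_diag r (k \<circ> Suc) * E' * s_diag r (l \<circ> Suc) \<in> carrier_mat r r"
      by (intro mult_carrier_mat[of _ r r] s_diag_carrier E'c)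
    fix i b assume "i < dim_row (bordered f' (vec r (\<lambda>i. s_var powi k (Suc i) * x i * s_var powi l 0)) (s_diag r (k \<circ> Suc) * E' * s_diag r (l \<circ> Suc)))"
      "b < dim_col (bordered f' (vec r (\<lambda>i. s_var powi k (Suc i) * x i * s_var powi l 0)) (s_diag r (k \<circ> Suc) * E' * s_diag r (l \<circ> Suc)))"
    then have ib: "i < Suc r" "b < Suc r" by (auto simp: bordered_def s_diag_def)
    show "(s_diag (Suc r) k * E * s_diag (Suc r) l) $$ (i, b) = bordered f' (vec r (\<lambda>i. s_var powi k (Suc i) * x i * s_var powi l 0))
      (s_diag r (k \<circ> Suc) * E' * s_diag r (l \<circ> Suc)) $$ (i, b)"
      unfolding s_diag_sandwich_index[OF Ec ib] bordered_index[OF c ib] using ib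
      by (cases i; cases b) (auto simp: E_def bordered_index[OF E'c] f'_def s_diag_sandwich_index[OF E'c] simp del: index_mult_mat(1))
  qed (auto simp: bordered_def s_diag_def E_def)
  moreover have "properring.equivalent (Suc r)
    (bordered f' (vec r (\<lambda>i. s_var powi k (Suc i) * x i * s_var powi l 0)) (s_diag r (k \<circ> Suc) * E' * s_diag r (l \<circ> Suc)))
    (s_diag (Suc r) (\<lambda>i. - q i))"
    unfolding s_diag_def[of "Suc r"] using x(2) by (intro \<beta>) auto
  ultimately show ?case by auto
qed

section \<open>Bases with prescribed degrees\<close>

definition inclusion_mat :: "nat \<Rightarrow> nat \<Rightarrow> 'b::zero_neq_one mat" where
  "inclusion_mat m r = mat m r (\<lambda>(i, j). if i = j then 1 else 0)"

lemma inclusion_mat_carrier [simp]: "inclusion_mat m r \<in> carrier_mat m r"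
  by (simp add: inclusion_mat_def)

lemma inclusion_mat_dim [simp]: "dim_row (inclusion_mat m r) = m" "dim_col (inclusion_mat m r) = r"
  by (simp_all add: inclusion_mat_def)

lemma mult_inclusion_index:
  fixes A :: "'b::comm_ring_1 mat"
  assumes A: "A \<in> carrier_mat c m" and r: "r \<le> m" and ij: "i < c" "j < r"
  shows "(A * inclusion_mat m r) $$ (i, j) = A $$ (i, j)"
proof -
  have "(A * inclusion_mat m r) $$ (i, j) = (\<Sum>k<m. A $$ (i, k) * (if k = j then 1 else 0))"
    by (subst mult_mat_index_sum[OF A inclusion_mat_carrier ij]) (use ij in \<open>simp add: inclusion_mat_def\<close>)
  also have "\<dots> = (\<Sum>k<m. if k = j then A $$ (i, j) else 0)" by (intro sum.cong) auto
  finally show ?thesis using r ij by simp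
qed

lemma inclusion_mult_index:
  fixes A :: "'b::comm_ring_1 mat"
  assumes A: "A \<in> carrier_mat r c" and ij: "i < m" "j < c"
  shows "(inclusion_mat m r * A) $$ (i, j) = (if i < r then A $$ (i, j) else 0)"
proof -
  have "(inclusion_mat m r * A) $$ (i, j) = (\<Sum>k<r. (if i = k then 1 else 0) * A $$ (k, j))"
    by (subst mult_mat_index_sum[OF inclusion_mat_carrier A ij]) (use ij in \<open>simp add: inclusion_mat_def\<close>)
  also have "\<dots> = (\<Sum>k<r. if k = i then A $$ (i, j) else 0)" by (intro sum.cong) auto
  finally show ?thesis by simp
qed

lemma transpose_inclusion_mult_inclusion:
  assumes "r \<le> m"
  shows "(inclusion_mat m r)\<^sup>T * inclusion_mat m r = (1\<^sub>m r :: 'b::comm_ring_1 mat)"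
proof (rule eq_matI)
  fix i j assume "i < dim_row (1\<^sub>m r :: 'b mat)" "j < dim_col (1\<^sub>m r :: 'b mat)"
  then have ij: "i < r" "j < r" by auto
  have "((inclusion_mat m r)\<^sup>T * inclusion_mat m r) $$ (i, j) = ((inclusion_mat m r)\<^sup>T :: 'b mat) $$ (i, j)"
    by (rule mult_inclusion_index) (use ij assms in auto)
  then show "((inclusion_mat m r)\<^sup>T * inclusion_mat m r) $$ (i, j) = (1\<^sub>m r :: 'b mat) $$ (i, j)"
    using ij assms by (auto simp: inclusion_mat_def)
qed (auto simp: inclusion_mat_def)

text \<open>
  The block diagonal matrix with blocks \<open>U\<close> and an identity matrix.
\<close>

definition embed_mat :: "nat \<Rightarrow> nat \<Rightarrow> 'b::zero_neq_one mat \<Rightarrow> 'b mat" where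
  "embed_mat m r U = mat m m (\<lambda>(i, j). if i < r \<and> j < r then U $$ (i, j) else if i = j then 1 else 0)"

lemma embed_mat_carrier [simp]: "embed_mat m r U \<in> carrier_mat m m"
  by (simp add: embed_mat_def)

lemma embed_mat_mult:
  fixes U W :: "'b::comm_ring_1 mat"
  assumes U: "U \<in> carrier_mat r r" and W: "W \<in> carrier_mat r r" and r: "r \<le> m"
  shows "embed_mat m r U * embed_mat m r W = embed_mat m r (U * W)"
proof (rule eq_matI)
  fix i j assume "i < dim_row (embed_mat m r (U * W))" "j < dim_col (embed_mat m r (U * W))"
  then have ij: "i < m" "j < m" by (auto simp: embed_mat_def)
  have eq: "(embed_mat m r U * embed_mat m r W) $$ (i, j) = (\<Sum>k<m. embed_mat m r U $$ (i, k) * embed_mat m r W $$ (k, j))"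
    by (rule mult_mat_index_sum[OF embed_mat_carrier embed_mat_carrier ij])
  show "(embed_mat m r U * embed_mat m r W) $$ (i, j) = embed_mat m r (U * W) $$ (i, j)"
  proof (cases "i < r")
    case True
    have "(\<Sum>k<m. embed_mat m r U $$ (i, k) * embed_mat m r W $$ (k, j)) =
      (\<Sum>k<r. U $$ (i, k) * embed_mat m r W $$ (k, j))"
      using True ij r by (intro sum.mono_neutral_cong_right) (auto simp: embed_mat_def)
    also have "\<dots> = embed_mat m r (U * W) $$ (i, j)"
    proof (cases "j < r")
      case j: True
      have "(\<Sum>k<r. U $$ (i, k) * embed_mat m r W $$ (k, j)) = (\<Sum>k<r. U $$ (i, k) * W $$ (k, j))"
        using True j r ij by (intro sum.cong) (auto simp: embed_mat_def)
      then show ?thesis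
        using True j ij by (simp add: embed_mat_def mult_mat_index_sum[OF U W] del: index_mult_mat(1))
    next
      case False
      then show ?thesis using True ij r by (auto simp: embed_mat_def intro!: sum.neutral)
    qed
    finally show ?thesis using eq by simp
  next
    case False
    have "(\<Sum>k<m. embed_mat m r U $$ (i, k) * embed_mat m r W $$ (k, j)) =
      (\<Sum>k<m. if k = i then embed_mat m r W $$ (i, j) else 0)"
      using False ij by (intro sum.cong) (auto simp: embed_mat_def)
    then show ?thesis using eq False ij by (simp add: embed_mat_def)
  qed
qed (auto simp: embed_mat_def)

lemma embed_mat_one: "embed_mat m r (1\<^sub>m r) = 1\<^sub>m m"
  by (intro eq_matI) (auto simp: embed_mat_def)

lemma embed_mat_mult_inclusion:
  fixes U :: "'b::comm_ring_1 mat"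
  assumes U: "U \<in> carrier_mat r r" and r: "r \<le> m"
  shows "embed_mat m r U * inclusion_mat m r = inclusion_mat m r * U"
proof (rule eq_matI)
  fix i j assume "i < dim_row (inclusion_mat m r * U)" "j < dim_col (inclusion_mat m r * U)"
  then have ij: "i < m" "j < r" using U by (auto simp: inclusion_mat_def)
  show "(embed_mat m r U * inclusion_mat m r) $$ (i, j) = (inclusion_mat m r * U) $$ (i, j)"
    unfolding mult_inclusion_index[OF embed_mat_carrier r ij] inclusion_mult_index[OF U ij]
    using ij r by (auto simp: embed_mat_def)
qed (use U in \<open>auto simp: embed_mat_def inclusion_mat_def\<close>)

context subring_of_field
begin

lemma over_embed_mat: "U \<in> carrier_mat r r \<Longrightarrow> over U \<Longrightarrow> over (embed_mat m r U)"
  by (auto simp: over_def embed_mat_def)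

lemma invertible_over_embed_mat:
  assumes "invertible_over r U" "r \<le> m"
  shows "invertible_over m (embed_mat m r U)"
proof -
  obtain W where W: "invertible_over r W" "U * W = 1\<^sub>m r" "W * U = 1\<^sub>m r"
    using assms(1) by (rule invertible_overE)
  note c = invertible_over_carrier[OF assms(1)] invertible_over_carrier[OF W(1)]
  show ?thesis unfolding invertible_over_def
    using assms W c embed_mat_mult[OF c assms(2)] embed_mat_mult[OF c(2,1) assms(2)]
    by (intro conjI bexI[of _ "embed_mat m r W"]) (auto simp: embed_mat_one over_embed_mat invertible_over_over)
qed

text \<open>
  Up to equivalence, \<open>(G I) A (H J)\<^sup>T\<close> with \<open>I\<close> and \<open>J\<close> inclusion
  matrices is \<open>A\<close> padded with zeros. This carries the diagonal forms of \<open>E\<close> and of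
  \<open>s\<^sup>k E s\<^sup>l\<close> over to \<open>R\<close>.
\<close>

lemma diagonalization_of_factorization:
  assumes eqv: "equivalent r A (diag_of r d)" and r: "r \<le> m" "r \<le> n"
    and G: "invertible_over m G" and H: "invertible_over n H"
  shows "\<exists>U V. invertible_over m U \<and> invertible_over n V \<and>
    U * ((G * inclusion_mat m r) * A * (H * inclusion_mat n r)\<^sup>T) * V = diagonal_form m n (map d [0..<r])"
proof -
  obtain U V where UV: "A \<in> carrier_mat r r" "invertible_over r U" "invertible_over r V" "U * A * V = diag_of r d"
    using eqv by (auto simp: equivalent_def)
  obtain G' where G': "invertible_over m G'" "G * G' = 1\<^sub>m m" "G' * G = 1\<^sub>m m"
    using G by (rule invertible_overE)
  obtain H' where H': "invertible_over n H'" "H * H' = 1\<^sub>m n" "H' * H = 1\<^sub>m n"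
    using H by (rule invertible_overE)
  let ?I = "inclusion_mat m r :: 'b mat" and ?J = "inclusion_mat n r :: 'b mat"
  have IJ: "?I \<in> carrier_mat m r" "?J \<in> carrier_mat n r" by simp_all
  note Uc = invertible_over_carrier[OF UV(2)] and Vc = invertible_over_carrier[OF UV(3)]
    and Gc = invertible_over_carrier[OF G] and Hc = invertible_over_carrier[OF H]
    and G'c = invertible_over_carrier[OF G'(1)] and H'c = invertible_over_carrier[OF H'(1)]
  define X where "X = embed_mat m r U * G'"
  define Y where "Y = embed_mat n r V\<^sup>T * H'"
  have X: "invertible_over m X" unfolding X_def
    by (intro invertible_over_mult invertible_over_embed_mat UV G' r)
  have Y: "invertible_over n Y" unfolding Y_def
    by (intro invertible_over_mult invertible_over_embed_mat invertible_over_transpose UV H' r)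
  have Xc: "X \<in> carrier_mat m m" and Yc: "Y \<in> carrier_mat n n"
    using X Y by (simp_all add: invertible_over_carrier)
  have emb: "embed_mat m r U \<in> carrier_mat m m" "embed_mat n r V\<^sup>T \<in> carrier_mat n n" by simp_all
  have XG: "X * (G * ?I) = ?I * U"
  proof -
    have "X * (G * ?I) = embed_mat m r U * ((G' * G) * ?I)"
      unfolding X_def using emb G'c Gc IJ
      by (simp add: assoc_mult_mat[of _ m m _ m _ m] assoc_mult_mat[of _ m m _ m _ r])
    then show ?thesis unfolding G' using IJ embed_mat_mult_inclusion[OF Uc r(1)] by simp
  qed
  have YH: "Y * (H * ?J) = ?J * V\<^sup>T"
  proof -
    have "Y * (H * ?J) = embed_mat n r V\<^sup>T * ((H' * H) * ?J)"
      unfolding Y_def using emb H'c Hc IJ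
      by (simp add: assoc_mult_mat[of _ n n _ n _ n] assoc_mult_mat[of _ n n _ n _ r])
    then show ?thesis unfolding H' using IJ embed_mat_mult_inclusion[of "V\<^sup>T" r n] Vc r(2) by simp
  qed
  have GI: "G * ?I \<in> carrier_mat m r" and HJ: "H * ?J \<in> carrier_mat n r" using Gc Hc IJ by auto
  have "X * ((G * ?I) * A * (H * ?J)\<^sup>T) * Y\<^sup>T = (X * (G * ?I)) * A * ((H * ?J)\<^sup>T * Y\<^sup>T)"
    using Xc Yc GI UV(1) transpose_carrier_mat[THEN iffD2, OF HJ] transpose_carrier_mat[THEN iffD2, OF Yc]
    by (simp add: assoc_mult_mat[of _ m m _ r _ n] assoc_mult_mat[of _ m m _ n _ n]
        assoc_mult_mat[of _ m r _ r _ n] assoc_mult_mat[of _ m m _ r _ r] assoc_mult_mat[of _ m r _ n _ n]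
        assoc_mult_mat[of _ r r _ n _ n])
  also have "(H * ?J)\<^sup>T * Y\<^sup>T = (Y * (H * ?J))\<^sup>T"
    using Yc HJ by (simp add: transpose_mult[of Y n n _ r])
  also have "\<dots> = V * ?J\<^sup>T" unfolding YH using Vc IJ by (simp add: transpose_mult[of _ n r _ r])
  also have "X * (G * ?I) * A * (V * ?J\<^sup>T) = ?I * ((U * A * V) * ?J\<^sup>T)"
    unfolding XG using IJ Uc Vc UV(1) transpose_carrier_mat[THEN iffD2, OF IJ(2)]
    by (simp add: assoc_mult_mat[of _ m r _ r _ r] assoc_mult_mat[of _ m r _ r _ n]
        assoc_mult_mat[of _ r r _ r _ n] assoc_mult_mat[of _ r r _ r _ r])
  also have "\<dots> = diagonal_form m n (map d [0..<r])"
    unfolding UV(4)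
  proof (rule eq_matI)
    fix i j assume "i < dim_row (diagonal_form m n (map d [0..<r]))" "j < dim_col (diagonal_form m n (map d [0..<r]))"
    then have ij: "i < m" "j < n" by (auto simp: diagonal_form_def)
    have JT: "?J\<^sup>T \<in> carrier_mat r n" using IJ by simp
    show "(?I * (diag_of r d * ?J\<^sup>T)) $$ (i, j) = diagonal_form m n (map d [0..<r]) $$ (i, j)"
      unfolding inclusion_mult_index[OF mult_carrier_mat[OF diag_of_carrier JT] ij]
      using ij r by (auto simp: diag_of_mult_index[OF JT] diagonal_form_def simp del: index_mult_mat(1))
        (auto simp: inclusion_mat_def)
  qed (use IJ in \<open>auto simp: diagonal_form_def\<close>)
  finally show ?thesis using X invertible_over_transpose[OF Y] by blast
qed

lemma inclusion_left_inverse: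
  assumes "invertible_over m G" "r \<le> m"
  shows "\<exists>L \<in> carrier_mat r m. over L \<and> L * (G * inclusion_mat m r) = 1\<^sub>m r"
proof -
  obtain G' where G': "invertible_over m G'" "G * G' = 1\<^sub>m m" "G' * G = 1\<^sub>m m"
    using assms(1) by (rule invertible_overE)
  note c = invertible_over_carrier[OF assms(1)] invertible_over_carrier[OF G'(1)]
  let ?I = "inclusion_mat m r :: 'b mat"
  have I: "?I\<^sup>T \<in> carrier_mat r m" "?I \<in> carrier_mat m r" by simp_all
  have "(?I\<^sup>T * G') * (G * ?I) = ?I\<^sup>T * ((G' * G) * ?I)"
    using c I by (simp add: assoc_mult_mat[of _ r m _ m _ r] assoc_mult_mat[of _ m m _ m _ r])
  then have "(?I\<^sup>T * G') * (G * ?I) = 1\<^sub>m r"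
    unfolding G' using transpose_inclusion_mult_inclusion[OF assms(2)] left_mult_one_mat[OF I(2)] by simp
  moreover have "over ?I" by (auto simp: over_def inclusion_mat_def)
  then have "over (?I\<^sup>T * G')" using c invertible_over_over[OF G'(1)] by (intro over_mult) auto
  ultimately show ?thesis using mult_carrier_mat[OF I(1) c(2)] by blast
qed

end

lemma vec_degree_eqI:
  assumes "v \<in> carrier_vec m" "\<And>i. i < m \<Longrightarrow> degree (v $ i) \<le> d" "j < m" "degree (v $ j) = d"
  shows "vec_degree v = d"
proof (rule antisym)
  show "vec_degree v \<le> d" unfolding vec_degree_def
    using assms by (intro Max.boundedI) auto
  show "d \<le> vec_degree v" using degree_le_vec_degree[of j v] assms by auto
qed

lemma inclusion_columnsI:
  assumes ps: "set ps \<subseteq> carrier_vec m" "length ps = r" "r \<le> m" and G: "G \<in> carrier_mat m m"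
    and eq: "\<And>i j. i < m \<Longrightarrow> j < r \<Longrightarrow> G $$ (i, j) = to_fract (ps ! j $ i) * s_var powi c j"
  shows "fract_mat_of_cols m ps * s_diag r c = G * inclusion_mat m r"
proof (rule eq_matI)
  fix i j assume "i < dim_row (G * inclusion_mat m r)" "j < dim_col (G * inclusion_mat m r)"
  then have ij: "i < m" "j < r" using G by auto
  have "fract_mat_of_cols m ps \<in> carrier_mat m r" using ps(2) by (metis fract_mat_of_cols_carrier)
  then show "(fract_mat_of_cols m ps * s_diag r c) $$ (i, j) = (G * inclusion_mat m r) $$ (i, j)"
    unfolding s_diag_def using ij ps eq
    by (subst mult_diag_of_index) (auto simp: mult_inclusion_index[OF G] fract_mat_of_cols_index simp del: index_mult_mat(1))
qed (use G in \<open>auto simp: s_diag_def\<close>)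

text \<open>
  For \<open>r < m\<close> take the vectors with entry \<open>s\<^sup>k\<^sup>j\<close> at position
  \<open>j\<close> and entry \<open>1\<close> at position \<open>j + 1\<close>. Preceded by the first unit
  vector and followed by the missing ones, they form a unitriangular polynomial matrix. After scaling column
  \<open>j\<close> by \<open>s\<^sup>-\<^sup>k\<^sup>j\<close> they are the first columns of a unitriangular
  proper matrix. For \<open>r = m\<close> the unit vectors serve.
\<close>

lemma exists_basis_with_degrees:
  fixes k :: "nat \<Rightarrow> nat"
  assumes m: "m > 0" and r: "r \<le> m" and full: "r = m \<Longrightarrow> \<forall>j<r. k j = 0"
  obtains ps :: "'a::field poly vec list" and G H where "length ps = r" "set ps \<subseteq> carrier_vec m"
    "\<And>j. j < r \<Longrightarrow> vec_degree (ps ! j) = k j"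
    "polyring.invertible_over m G" "fract_mat_of_cols m ps = G * inclusion_mat m r"
    "properring.invertible_over m H"
    "fract_mat_of_cols m ps * s_diag r (\<lambda>j. - int (k j)) = H * inclusion_mat m r"
proof (cases "r = m")
  case True
  define ps :: "'a poly vec list" where "ps = map (unit_vec m) [0..<r]"
  have ps: "length ps = r" "set ps \<subseteq> carrier_vec m" by (auto simp: ps_def)
  have eq: "fract_mat_of_cols m ps * s_diag r (\<lambda>_. 0) = 1\<^sub>m m * inclusion_mat m r"
    using True by (intro inclusion_columnsI ps) (auto simp: ps_def)
  have deg: "vec_degree (ps ! j) = k j" if "j < r" for j
    using that full True by (intro vec_degree_eqI[of _ m _ j]) (auto simp: ps_def unit_vec_def)
  have k0: "s_diag r (\<lambda>j. - int (k j)) = s_diag r (\<lambda>_. 0)"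
    unfolding s_diag_def diag_of_def using full[OF True] by (intro eq_matI) auto
  have "fract_mat_of_cols m ps * s_diag r (\<lambda>_. 0) = fract_mat_of_cols m ps"
    using fract_mat_of_cols_carrier[of m ps] ps(1) by (simp add: s_diag_0)
  then show ?thesis
    using that[OF ps deg polyring.invertible_over_one _ properring.invertible_over_one] eq unfolding k0 by simp
next
  case False
  then have rm: "r < m" using r by simp
  define ps :: "'a poly vec list" where
    "ps = map (\<lambda>j. vec m (\<lambda>i. if i = j then monom 1 (k j) else if i = Suc j then 1 else 0)) [0..<r]"
  have ps: "length ps = r" "set ps \<subseteq> carrier_vec m" by (auto simp: ps_def)
  have psi: "ps ! j $ i = (if i = j then monom 1 (k j) else if i = Suc j then 1 else 0)" if "i < m" "j < r" for i j
    using that by (simp add: ps_def)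
  have deg: "vec_degree (ps ! j) = k j" if "j < r" for j
  proof (rule vec_degree_eqI[of _ m _ j])
    show "ps ! j \<in> carrier_vec m" using ps that nth_mem by blast
  qed (use that rm in \<open>auto simp: psi degree_monom_eq\<close>)
  define T :: "'a poly fract mat" where "T = mat m m (\<lambda>(i, j). if i = j then 1
    else if j = Suc i \<and> j \<le> r then s_var powi int (k i) else 0)"
  have T: "T \<in> carrier_mat m m" by (simp add: T_def)
  have "upper_triangular T" by (auto simp: upper_triangular_def T_def)
  then have "det T = prod_list (diag_mat T)" by (rule det_upper_triangular[OF _ T])
  also have "diag_mat T = replicate m 1"
    by (intro nth_equalityI) (auto simp: diag_mat_def T_def)
  finally have detT: "det T = 1" by simp
  have "polyring.over T"
    unfolding polyring.over_def using T by (auto simp: T_def polyring.one_mem polyring.zero_mem simp flip: to_fract_monom)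
  then have Tinv: "polyring.invertible_over m T"
    using polyring.invertible_over_if_det[OF T _ _ polyring.one_mem] detT by simp
  define \<tau> where "\<tau> j = (if j < r then Suc j else if j = r then 0 else j)" for j
  have \<tau>: "bij_betw \<tau> {..<m} {..<m}"
    by (rule bij_betw_byWitness[where f' = "\<lambda>j. if j = 0 then r else if j \<le> r then j - 1 else j"])
      (use rm in \<open>auto simp: \<tau>_def\<close>)
  have \<tau>': "\<tau> j < m" if "j < m" for j using that rm by (auto simp: \<tau>_def)
  define M :: "'a poly fract mat" where "M = polyring.monomial_mat m (\<lambda>_. 1) \<tau>"
  have M: "M \<in> carrier_mat m m" by (simp add: M_def)
  have Minv: "polyring.invertible_over m M\<^sup>T"
    unfolding M_def by (intro polyring.invertible_over_transpose polyring.invertible_over_monomial_mat[OF \<tau>]) auto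
  define G where "G = T * M\<^sup>T"
  have Ginv: "polyring.invertible_over m G"
    unfolding G_def by (rule polyring.invertible_over_mult[OF Tinv Minv])
  have Gidx: "G $$ (i, j) = T $$ (i, \<tau> j)" if "i < m" "j < m" for i j
  proof -
    have "G = (M * T\<^sup>T)\<^sup>T" unfolding G_def using T M by (simp add: transpose_mult[of _ m m _ m])
    then have "G $$ (i, j) = (M * T\<^sup>T) $$ (j, i)" using that T M by simp
    also have "\<dots> = 1 * T\<^sup>T $$ (\<tau> j, i)"
      unfolding M_def by (rule polyring.monomial_mat_mult_index[OF \<tau>']) (use T that in auto)
    finally show ?thesis using T that \<tau>' by simp
  qed
  have "fract_mat_of_cols m ps * s_diag r (\<lambda>_. 0) = G * inclusion_mat m r"
    using rm polyring.invertible_over_carrier[OF Ginv]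
    by (intro inclusion_columnsI ps) (auto simp: Gidx psi T_def \<tau>_def to_fract_monom)
  moreover have "fract_mat_of_cols m ps * s_diag r (\<lambda>_. 0) = fract_mat_of_cols m ps"
    using fract_mat_of_cols_carrier[of m ps] ps(1) by (simp add: s_diag_0)
  ultimately have PG: "fract_mat_of_cols m ps = G * inclusion_mat m r" by simp
  define H :: "'a poly fract mat" where "H = mat m m (\<lambda>(i, j). if i = j then 1
    else if i = Suc j \<and> j < r then s_var powi - int (k j) else 0)"
  have H: "H \<in> carrier_mat m m" by (simp add: H_def)
  have "det H = prod_list (diag_mat H)" by (rule det_lower_triangular[OF _ H]) (auto simp: H_def)
  also have "diag_mat H = replicate m 1"
    by (intro nth_equalityI) (auto simp: diag_mat_def H_def)
  finally have detH: "det H = 1" by simp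
  have "properring.over H"
    unfolding properring.over_def using H by (auto simp: H_def proper_iff_deg_le deg_le_def)
  then have Hinv: "properring.invertible_over m H"
    using properring.invertible_over_if_det[OF H _ _ properring.one_mem] detH by simp
  have "fract_mat_of_cols m ps * s_diag r (\<lambda>j. - int (k j)) = H * inclusion_mat m r"
  proof (intro inclusion_columnsI ps H)
    fix i j assume ij: "i < m" "j < r"
    have "s_var powi int (k j) * s_var powi - int (k j) = (1 :: 'a poly fract)"
      by (subst power_int_add[symmetric]) auto
    then show "H $$ (i, j) = to_fract (ps ! j $ i) * s_var powi - int (k j)"
      using ij rm by (auto simp: H_def psi to_fract_monom simp del: power_int_of_nat)
  qed (use r in auto)
  then show ?thesis using that[OF ps deg Ginv PG Hinv] by blast
qed

text \<open>
  Multiplication by a right invertible matrix does not change the column space, so the column degrees of the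
  first factor are the minimal indices.
\<close>

lemma col_span_minimal_indices_of_factorization:
  fixes X :: "'a::field poly fract mat"
  assumes m: "m > 0" "r \<le> m" and ps: "length ps = r" "set ps \<subseteq> carrier_vec m"
    and G: "polyring.invertible_over m G" "fract_mat_of_cols m ps = G * inclusion_mat m r"
    and H: "properring.invertible_over m H"
      "fract_mat_of_cols m ps * s_diag r (\<lambda>j. - int (vec_degree (ps ! j))) = H * inclusion_mat m r"
    and X: "X \<in> carrier_mat r n" and Y: "Y \<in> carrier_mat n r" "X * Y = 1\<^sub>m r"
    and ks: "sorted (rev ks)" "mset ks = mset (map vec_degree ps)"
  shows "col_span_minimal_indices (fract_mat_of_cols m ps * X) ks"
    "vec_space.rank m (fract_mat_of_cols m ps * X) = r"
proof -
  define P where "P = fract_mat_of_cols m ps"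
  have P: "P \<in> carrier_mat m r" using ps(1) by (metis P_def fract_mat_of_cols_carrier)
  have PX: "P * X \<in> carrier_mat m n" using P X by simp
  obtain L where L: "L \<in> carrier_mat r m" "polyring.over L" "L * P = 1\<^sub>m r"
    using polyring.inclusion_left_inverse[OF G(1) m(2)] unfolding G(2)[symmetric] P_def by blast
  obtain L' where L': "L' \<in> carrier_mat r m" "properring.over L'"
    "L' * (P * s_diag r (\<lambda>j. - int (vec_degree (ps ! j)))) = 1\<^sub>m r"
    using properring.inclusion_left_inverse[OF H(1) m(2)] unfolding H(2)[symmetric] P_def by blast
  note mb = left_inverses_imp_minimal_basis[OF ps(2), folded P_def, unfolded ps(1), OF L L' PX
      col_space_mult_right_invertible[OF P X Y, symmetric]]
  have "rev ks = sort (map vec_degree ps)"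
    by (rule sort_eqI[symmetric]) (use ks in auto)
  then have "minimal_indices m (vec_space.col_space m (P * X)) ks"
    using mb(1,2) by (intro minimal_indicesI)
  then show "col_span_minimal_indices (fract_mat_of_cols m ps * X) ks"
    unfolding col_span_minimal_indices_def P_def[symmetric] using P by simp
  show "vec_space.rank m (fract_mat_of_cols m ps * X) = r" using mb(3) by (simp add: P_def)
qed

section \<open>Majorization and the characterization of the invariants\<close>

text \<open>
  Cancel the common indices: the remaining ones on the left lie below \<open>r - card T\<close>, those on the right do not.
\<close>

lemma sum_le_sum_top:
  fixes b :: "nat \<Rightarrow> int"
  assumes mono: "\<And>i j. i \<le> j \<Longrightarrow> j < r \<Longrightarrow> b i \<le> b j" and T: "T \<subseteq> {..<r}"
  shows "sum b T \<le> (\<Sum>i\<in>{r - card T..<r}. b i)"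
proof -
  define u where "u = r - card T"
  define X where "X = {u..<r}"
  have fin: "finite T" using T finite_subset by blast
  have ct: "card T \<le> r" using card_mono[OF _ T] by simp
  show ?thesis
  proof (cases "card T = 0")
    case False
    then have ur: "u < r" using ct by (simp add: u_def)
    have cX: "card X = card T" using ct by (simp add: X_def u_def)
    have "card (T - X) = card (X - T)"
      using cX fin card_Diff_subset_Int[of T X] card_Diff_subset_Int[of X T]
      by (simp add: X_def Int_commute)
    moreover have "sum b (T - X) \<le> of_nat (card (T - X)) * b u"
      using T mono ur by (intro sum_bounded_above) (auto simp: X_def)
    moreover have "of_nat (card (X - T)) * b u \<le> sum b (X - T)"
      using mono by (intro sum_bounded_below) (auto simp: X_def)
    ultimately have "sum b (T - X) \<le> sum b (X - T)" by simp
    moreover have "sum b T = sum b (T \<inter> X) + sum b (T - X)"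
      using fin by (metis sum.Int_Diff)
    moreover have "sum b X = sum b (T \<inter> X) + sum b (X - T)"
      by (metis Int_commute X_def finite_atLeastLessThan sum.Int_Diff)
    ultimately show ?thesis by (simp add: X_def u_def)
  qed (use fin in auto)
qed

text \<open>
  Subtracting the partial sums from the total turns the conditions on the left into bounds for \<open>a 0 +
  \<dots> + a (t - 1)\<close> by the negated sum of the \<open>t\<close> largest \<open>y\<close>'s, and among
  the sets of \<open>t\<close> indices those of the largest \<open>y\<close>'s give the strongest condition.
\<close>

lemma majorized_iff_subset_sums:
  fixes y :: "nat \<Rightarrow> nat" and a :: "nat \<Rightarrow> int"
  shows "rev (map (\<lambda>x. - int x) (rev (sort (map y [0..<r])))) \<prec>\<^sub>m rev (map a [0..<r]) \<longleftrightarrow>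
    (\<forall>T \<subseteq> {..<r}. (\<Sum>i<card T. a i) \<le> (\<Sum>i\<in>T. - int (y i))) \<and> (\<Sum>i<r. a i) = (\<Sum>i<r. - int (y i))"
proof -
  define ms where "ms = sort (map y [0..<r])"
  define b where "b i = int (ms ! i)" for i
  have len: "length ms = r" by (simp add: ms_def)
  have mono: "b i \<le> b j" if "i \<le> j" "j < r" for i j
    using that len unfolding b_def ms_def by (simp add: sorted_nth_mono)
  have "mset ms = mset (map y [0..<r])" by (simp add: ms_def)
  then obtain \<pi> where perm: "\<pi> permutes {..<length (map y [0..<r])}" "permute_list \<pi> (map y [0..<r]) = ms"
    by (rule mset_eq_permutation)
  have \<pi>: "bij_betw \<pi> {..<r} {..<r}" "\<And>i. i < r \<Longrightarrow> ms ! i = map y [0..<r] ! \<pi> i"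
    using permutes_imp_bij[OF perm(1)] perm by (auto simp: permute_list_nth simp del: nth_map)
  have \<pi>r: "\<pi> i < r" if "i < r" for i using \<pi>(1) that by (auto simp: bij_betw_def)
  have b\<pi>: "b i = int (y (\<pi> i))" if "i < r" for i using \<pi>(2)[OF that] \<pi>r[OF that] by (simp add: b_def)
  have image_sum: "(\<Sum>i\<in>\<pi> ` X. - int (y i)) = - sum b X" "card (\<pi> ` X) = card X" if X: "X \<subseteq> {..<r}" for X
  proof -
    have inj: "inj_on \<pi> X" using \<pi>(1) X by (auto simp: bij_betw_def intro: inj_on_subset)
    then show "card (\<pi> ` X) = card X" by (rule card_image)
    show "(\<Sum>i\<in>\<pi> ` X. - int (y i)) = - sum b X"
      using X b\<pi> by (subst sum.reindex[OF inj]) (auto simp: sum_negf intro!: sum.cong)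
  qed
  have total: "(\<Sum>i<r. - int (y i)) = - (\<Sum>i<r. b i)"
    using image_sum(1)[of "{..<r}"] \<pi>(1) by (simp add: bij_betw_def)
  have lhs: "sum_list (take t (map (\<lambda>x. - int x) ms)) = - (\<Sum>i<t. b i)" if "t \<le> r" for t
    using that len by (simp add: sum_list_sum_nth take_map b_def sum_negf atLeast0LessThan min_def)
  have rhs: "sum_list (take t (rev (map a [0..<r]))) = (\<Sum>i<r. a i) - (\<Sum>i<r - t. a i)" if t: "t \<le> r" for t
  proof -
    have "sum_list (take t (rev (map a [0..<r]))) = sum_list (drop (r - t) (map a [0..<r]))"
      by (simp add: take_rev sum_list_rev)
    also have "\<dots> = (\<Sum>i\<in>{r - t..<r}. a i)"
      by (simp add: drop_map interv_sum_list_conv_sum_set_nat)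
    also have "\<dots> = (\<Sum>i<r. a i) - (\<Sum>i<r - t. a i)"
      using sum_diff_nat_ivl[of 0 "r - t" r a] t by (simp add: atLeast0LessThan)
    finally show ?thesis .
  qed
  have top: "(\<Sum>i\<in>{t..<r}. b i) = (\<Sum>i<r. b i) - (\<Sum>i<t. b i)" if "t \<le> r" for t
    using sum_diff_nat_ivl[of 0 t r b] that by (simp add: atLeast0LessThan)
  have m_iff: "rev (map (\<lambda>x. - int x) (rev ms)) \<prec>\<^sub>m rev (map a [0..<r]) \<longleftrightarrow>
    (\<forall>t<r. - (\<Sum>i<t. b i) \<le> (\<Sum>i<r. a i) - (\<Sum>i<r - t. a i)) \<and> - (\<Sum>i<r. b i) = (\<Sum>i<r. a i)"
    using lhs[of r] rhs[of r] lhs rhs len by (auto simp: majorized_def rev_map)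
  show ?thesis
    unfolding ms_def[symmetric] m_iff total
  proof (intro iffI conjI allI impI; elim conjE)
    fix T assume *: "\<forall>t<r. - (\<Sum>i<t. b i) \<le> (\<Sum>i<r. a i) - (\<Sum>i<r - t. a i)"
      "- (\<Sum>i<r. b i) = (\<Sum>i<r. a i)" and T: "T \<subseteq> {..<r}"
    have ct: "card T \<le> r" using card_mono[OF _ T] by simp
    obtain X where X: "X \<subseteq> {..<r}" "T = \<pi> ` X" using T \<pi>(1) by (metis bij_betw_imp_surj_on subset_imageE)
    have cX: "card X = card T" using image_sum(2)[OF X(1)] X(2) by simp
    have "sum b X \<le> sum b {r - card X..<r}" using mono X(1) by (rule sum_le_sum_top)
    then have "sum b X \<le> (\<Sum>i<r. b i) - (\<Sum>i<r - card T. b i)"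
      using top[of "r - card T"] cX by simp
    moreover have "- (\<Sum>i<r - card T. b i) \<le> (\<Sum>i<r. a i) - (\<Sum>i<card T. a i)"
      using *(1)[rule_format, of "r - card T"] *(2) ct by (cases "card T = 0") auto
    ultimately show "(\<Sum>i<card T. a i) \<le> (\<Sum>i\<in>T. - int (y i))"
      using *(2) image_sum(1)[OF X(1)] X(2) by simp
  next
    fix t assume *: "\<forall>T\<subseteq>{..<r}. (\<Sum>i<card T. a i) \<le> (\<Sum>i\<in>T. - int (y i))"
      "(\<Sum>i<r. a i) = - (\<Sum>i<r. b i)" and t: "t < r"
    have X: "{t..<r} \<subseteq> {..<r}" by auto
    have "\<pi> ` {t..<r} \<subseteq> {..<r}" using \<pi>r by auto
    then have "(\<Sum>i<card (\<pi> ` {t..<r}). a i) \<le> (\<Sum>i\<in>\<pi> ` {t..<r}. - int (y i))" using *(1) by blast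
    then have "(\<Sum>i<r - t. a i) \<le> - (\<Sum>i\<in>{t..<r}. b i)" unfolding image_sum[OF X] by simp
    then show "- (\<Sum>i<t. b i) \<le> (\<Sum>i<r. a i) - (\<Sum>i<r - t. a i)" using *(2) top[of t] t by simp
  qed auto
qed

text \<open>
  The order of the second basis is reversed, so that column \<open>i\<close> of \<open>Q\<close> has degree
  \<open>l ! (r - 1 - i)\<close>; the square matrix is then built for the pairs that occur in the majorization
  condition.
\<close>

lemma exists_with_invariants:
  fixes eps psi :: "'a::field poly list"
  assumes closed: "\<forall>p :: 'a poly. degree p > 0 \<longrightarrow> (\<exists>x. poly p x = 0)"
    and mn: "m > 0" "n > 0" "r > 0" "r \<le> min m n"
    and len: "length eps = r" "length psi = r" "length q = r" "length k = r" "length l = r"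
    and monic: "\<forall>i < r. lead_coeff (eps ! i) = 1 \<and> lead_coeff (psi ! i) = 1"
    and chain: "sorted_wrt (dvd) eps" "sorted_wrt (\<lambda>p p'. p' dvd p) psi"
    and cop: "\<forall>i < r. coprime (eps ! i) (psi ! i)"
    and sorted: "sorted q" "sorted_wrt (\<ge>) k" "sorted_wrt (\<ge>) l"
    and full: "r = n \<Longrightarrow> \<forall>x \<in> set l. x = 0" "r = m \<Longrightarrow> \<forall>x \<in> set k. x = 0"
  defines "a \<equiv> \<lambda>i. int (degree (eps ! i)) - int (degree (psi ! i)) + q ! i"
    and "y \<equiv> \<lambda>i. k ! i + l ! (r - 1 - i)"
  assumes maj: "\<And>T. T \<subseteq> {..<r} \<Longrightarrow> (\<Sum>i<card T. a i) \<le> (\<Sum>i\<in>T. - int (y i))"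
    and total: "(\<Sum>i<r. a i) = (\<Sum>i<r. - int (y i))"
  shows "\<exists>R :: 'a poly fract mat. R \<in> carrier_mat m n \<and> has_invariants R r eps psi q k l"
proof -
  define ds where "ds = map2 Fract eps psi"
  have monic': "\<forall>p \<in> set eps \<union> set psi. lead_coeff p = 1"
    using monic len by (auto simp: in_set_conv_nth)
  have ds: "ds ! i \<noteq> 0" "rdeg (ds ! i) = int (degree (eps ! i)) - int (degree (psi ! i))" if "i < r" for i
    using invariant_quotients_mem[OF _ monic' chain] that len unfolding ds_def by auto
  have ds_chain: "ds ! Suc i / ds ! i \<in> range to_fract" if "Suc i < r" for i
    using invariant_quotients_mem(3)[OF _ monic' chain] that len unfolding ds_def by auto
  have lends: "length ds = r" using len by (simp add: ds_def)
  define K where "K i = int (k ! i)" for i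
  define \<Lambda> where "\<Lambda> i = int (l ! (r - 1 - i))" for i
  have "\<exists>E. polyring.equivalent r E (diag_of r (\<lambda>i. ds ! i)) \<and>
    properring.equivalent r (s_diag r K * E * s_diag r \<Lambda>) (s_diag r (\<lambda>i. - (q ! i)))"
  proof (rule exists_square_with_invariants[OF closed mn(3)])
    show "q ! i \<le> q ! Suc i" if "Suc i < r" for i using that sorted(1) len by (simp add: sorted_nth_mono)
    show "K j \<le> K i" if "i \<le> j" "j < r" for i j
      using sorted(2) len that unfolding K_def by (auto simp: sorted_wrt_iff_nth_less le_less)
    have a: "a i = rdeg (ds ! i) + q ! i" if "i < r" for i using ds(2)[OF that] by (simp add: a_def)
    have yK: "- int (y i) = - (K i + \<Lambda> i)" for i by (simp add: y_def K_def \<Lambda>_def)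
    show "(\<Sum>i<card T. rdeg (ds ! i) + q ! i) \<le> (\<Sum>i\<in>T. - (K i + \<Lambda> i))" if T: "T \<subseteq> {..<r}" for T
    proof -
      have "card T \<le> r" using card_mono[OF _ T] by simp
      then have "(\<Sum>i<card T. rdeg (ds ! i) + q ! i) = (\<Sum>i<card T. a i)" by (intro sum.cong) (auto simp: a)
      then show ?thesis using maj[OF T] by (simp only: yK)
    qed
    have "(\<Sum>i<r. rdeg (ds ! i) + q ! i) = (\<Sum>i<r. a i)" by (intro sum.cong) (auto simp: a)
    then show "(\<Sum>i<r. rdeg (ds ! i) + q ! i) = (\<Sum>i<r. - (K i + \<Lambda> i))" using total by (simp only: yK)
  qed (use ds ds_chain in auto)
  then obtain E where E: "polyring.equivalent r E (diag_of r (\<lambda>i. ds ! i))"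
    "properring.equivalent r (s_diag r K * E * s_diag r \<Lambda>) (s_diag r (\<lambda>i. - (q ! i)))" by blast
  have Ec: "E \<in> carrier_mat r r" using E(1) by (simp add: polyring.equivalent_def)
  obtain E' where E': "E' \<in> carrier_mat r r" "E * E' = 1\<^sub>m r" "E' * E = 1\<^sub>m r"
  proof -
    obtain U V where UV: "polyring.invertible_over r U" "polyring.invertible_over r V" "U * E * V = diag_of r (\<lambda>i. ds ! i)"
      using E(1) by (auto simp: polyring.equivalent_def)
    have c: "U \<in> carrier_mat r r" "V \<in> carrier_mat r r" using UV by (simp_all add: polyring.invertible_over_carrier)
    have "det U * det E * det V = (\<Prod>i<r. ds ! i)"
      using arg_cong[OF UV(3), of det] c Ec by (simp add: det_diag_of det_mult[of _ r] mult_carrier_mat[of _ r r] mult.assoc)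
    moreover have "(\<Prod>i<r. ds ! i) \<noteq> 0" using ds by auto
    ultimately have nz: "det E \<noteq> 0" by auto
    define W where "W = inverse (det E) \<cdot>\<^sub>m adj_mat E"
    have W: "W \<in> carrier_mat r r" using adj_mat(1)[OF Ec] by (simp add: W_def)
    have "E * W = 1\<^sub>m r"
      unfolding W_def using adj_mat(1,2)[OF Ec] Ec nz
      by (simp add: mult_smult_distrib[of _ r r _ r]) (intro eq_matI, auto)
    then show ?thesis using that[OF W] mat_mult_left_right_inverse[OF Ec W] by blast
  qed
  have rm: "r \<le> m" "r \<le> n" using mn by auto
  have full': "r = m \<Longrightarrow> \<forall>j<r. k ! j = 0" "r = n \<Longrightarrow> \<forall>j<r. l ! (r - 1 - j) = 0"
    using full len by auto
  obtain ps :: "'a poly vec list" and G H where ps: "length ps = r" "set ps \<subseteq> carrier_vec m" "\<And>j. j < r \<Longrightarrow> vec_degree (ps ! j) = k ! j"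
    and G: "polyring.invertible_over m G" "fract_mat_of_cols m ps = G * inclusion_mat m r"
    and H: "properring.invertible_over m H" "fract_mat_of_cols m ps * s_diag r (\<lambda>j. - int (k ! j)) = H * inclusion_mat m r"
    using exists_basis_with_degrees[OF mn(1) rm(1) full'(1)] by blast
  obtain qs :: "'a poly vec list" and G' H' where qs: "length qs = r" "set qs \<subseteq> carrier_vec n" "\<And>j. j < r \<Longrightarrow> vec_degree (qs ! j) = l ! (r - 1 - j)"
    and G': "polyring.invertible_over n G'" "fract_mat_of_cols n qs = G' * inclusion_mat n r"
    and H': "properring.invertible_over n H'" "fract_mat_of_cols n qs * s_diag r (\<lambda>j. - int (l ! (r - 1 - j))) = H' * inclusion_mat n r"
    using exists_basis_with_degrees[OF mn(2) rm(2) full'(2)] by blast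
  have degs: "map vec_degree ps = k" "map vec_degree qs = rev l"
    using ps qs len by (auto intro!: nth_equalityI simp: rev_nth)
  define P where "P = fract_mat_of_cols m ps"
  define Q where "Q = fract_mat_of_cols n qs"
  have P: "P \<in> carrier_mat m r" and Q: "Q \<in> carrier_mat n r"
    using ps(1) qs(1) by (metis P_def Q_def fract_mat_of_cols_carrier)+
  have QT: "Q\<^sup>T \<in> carrier_mat r n" and PT: "P\<^sup>T \<in> carrier_mat r m" using P Q by auto
  obtain L where L: "L \<in> carrier_mat r m" "L * P = 1\<^sub>m r"
    using polyring.inclusion_left_inverse[OF G(1) rm(1)] unfolding G(2)[symmetric] P_def by blast
  obtain M where M: "M \<in> carrier_mat r n" "M * Q = 1\<^sub>m r"
    using polyring.inclusion_left_inverse[OF G'(1) rm(2)] unfolding G'(2)[symmetric] Q_def by blast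
  define R where "R = P * E * Q\<^sup>T"
  have R: "R \<in> carrier_mat m n" using P Q Ec by (auto simp: R_def)
  have R1: "R = P * (E * Q\<^sup>T)" unfolding R_def using P Ec QT by (simp add: assoc_mult_mat[of _ m r _ r _ n])
  have R2: "R\<^sup>T = Q * (E\<^sup>T * P\<^sup>T)"
    unfolding R1 using P Ec QT by (simp add: transpose_mult[of _ m r _ n] transpose_mult[of _ r r _ n] assoc_mult_mat[of _ n r _ r _ m])
  have ET: "E\<^sup>T \<in> carrier_mat r r" "E'\<^sup>T \<in> carrier_mat r r" "E\<^sup>T * E'\<^sup>T = 1\<^sub>m r"
    using Ec E' by (auto simp: transpose_mult[of _ r r _ r, symmetric])
  have Hps: "fract_mat_of_cols m ps * s_diag r (\<lambda>j. - int (vec_degree (ps ! j))) = H * inclusion_mat m r"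
  proof -
    have "s_diag r (\<lambda>j. - int (vec_degree (ps ! j))) = (s_diag r (\<lambda>j. - int (k ! j)) :: 'a poly fract mat)"
      unfolding s_diag_def diag_of_def using ps(3) by (intro eq_matI) auto
    then show ?thesis using H(2) by simp
  qed
  have Hqs: "fract_mat_of_cols n qs * s_diag r (\<lambda>j. - int (vec_degree (qs ! j))) = H' * inclusion_mat n r"
  proof -
    have "s_diag r (\<lambda>j. - int (vec_degree (qs ! j))) = (s_diag r (\<lambda>j. - int (l ! (r - 1 - j))) :: 'a poly fract mat)"
      unfolding s_diag_def diag_of_def using qs(3) by (intro eq_matI) auto
    then show ?thesis using H'(2) by simp
  qed
  have sorted_rev: "sorted (rev k)" "sorted (rev l)"
    using sorted(2,3) by (simp_all add: sorted_wrt_rev)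
  have col: "col_span_minimal_indices R k" "vec_space.rank m R = r"
    unfolding R1 P_def
    by (rule col_span_minimal_indices_of_factorization[OF mn(1) rm(1) ps(1,2) G H(1) Hps
          mult_carrier_mat[OF Ec QT] mult_carrier_mat[OF transpose_carrier_mat[THEN iffD2, OF M(1)] E'(1)]
          right_inverse_mult_transpose[OF Ec E'(1,2) Q M] sorted_rev(1)], simp add: degs)+
  have row: "row_span_minimal_indices R l"
    unfolding row_span_minimal_indices_def R2 Q_def
    by (rule col_span_minimal_indices_of_factorization(1)[OF mn(2) rm(2) qs(1,2) G' H'(1) Hqs
          mult_carrier_mat[OF ET(1) PT] mult_carrier_mat[OF transpose_carrier_mat[THEN iffD2, OF L(1)] ET(2)]
          right_inverse_mult_transpose[OF ET P L] sorted_rev(2)]) (simp add: degs)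
  have maps: "map (\<lambda>i. ds ! i) [0..<r] = ds" "map (\<lambda>i. s_var powi (- (q ! i))) [0..<r] = map (\<lambda>x. (s_var :: 'a poly fract) powi (- x)) q"
    using lends len by (auto intro!: nth_equalityI)
  have "invariant_rational_functions R eps psi"
  proof -
    obtain U V where UV: "polyring.invertible_over m U" "polyring.invertible_over n V" "U * R * V = diagonal_form m n ds"
      using polyring.diagonalization_of_factorization[OF E(1) rm G(1) G'(1)]
      unfolding R_def P_def Q_def G(2) G'(2) maps by blast
    obtain U0 where U0: "U0 \<in> carrier_mat m m" "invertible_mat U0" "U = map_mat to_fract U0"
      using UV(1) by (rule invertible_over_imp_unimodular)
    obtain V0 where V0: "V0 \<in> carrier_mat n n" "invertible_mat V0" "V = map_mat to_fract V0"
      using UV(2) by (rule invertible_over_imp_unimodular)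
    have "map_mat to_fract U0 * R * map_mat to_fract V0 = diagonal_form (dim_row R) (dim_col R) (map2 Fract eps psi)"
      using UV(3) U0 V0 R by (simp add: ds_def)
    then show ?thesis unfolding invariant_rational_functions_def
      using U0 V0 R len mn(4) monic' chain cop by auto
  qed
  moreover have "invariant_orders_at_infinity R q"
  proof -
    have RF: "R = (P * s_diag r (\<lambda>j. - K j)) * (s_diag r K * E * s_diag r \<Lambda>) * (Q * s_diag r (\<lambda>j. - \<Lambda> j))\<^sup>T"
    proof -
      have "(Q * s_diag r (\<lambda>j. - \<Lambda> j))\<^sup>T = s_diag r (\<lambda>j. - \<Lambda> j) * Q\<^sup>T"
        using Q by (simp add: transpose_mult[of _ n r _ r])
      then show ?thesis unfolding R_def
        by (simp only: sandwich_cancel[OF P s_diag_carrier s_diag_carrier Ec s_diag_carrier s_diag_carrier QT] s_diag_inverse)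
    qed
    have PH: "P * s_diag r (\<lambda>j. - K j) = H * inclusion_mat m r" "Q * s_diag r (\<lambda>j. - \<Lambda> j) = H' * inclusion_mat n r"
      using H(2) H'(2) by (simp_all add: P_def Q_def K_def \<Lambda>_def)
    obtain B1 B2 where B: "properring.invertible_over m B1" "properring.invertible_over n B2"
      "B1 * R * B2 = diagonal_form m n (map (\<lambda>x. s_var powi (- x)) q)"
      using properring.diagonalization_of_factorization[OF E(2)[unfolded s_diag_def[of r "\<lambda>i. - (q ! i)"]] rm H(1) H'(1)]
      unfolding PH[symmetric] RF[symmetric] maps by blast
    then show ?thesis unfolding invariant_orders_at_infinity_def biproper_iff
      using R len mn(4) sorted(1) by auto
  qed
  ultimately have "has_invariants R r eps psi q k l"
    unfolding has_invariants_def using col row R by simp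
  then show ?thesis using R by blast
qed

theorem theorem6p4:
  fixes m n r :: nat
    and eps psi :: "'a::field poly list"
    and q :: "int list"
    and k l g :: "nat list"
  assumes "m > 0" "n > 0" "r > 0" "r \<le> min m n"
    and "length eps = r" "length psi = r"
    and "\<forall>i < r. lead_coeff (eps ! i) = 1 \<and> lead_coeff (psi ! i) = 1"
    and "sorted_wrt (dvd) eps" "sorted_wrt (\<lambda>p p'. p' dvd p) psi"
    and "\<forall>i < r. coprime (eps ! i) (psi ! i)"
    and "length q = r" "sorted q"
    and "length k = r" "sorted_wrt (\<ge>) k"
    and "length l = r" "sorted_wrt (\<ge>) l"
    and "g = rev (sort (map2 (+) (rev k) l))"
  shows
    "let a = (r = n \<longrightarrow> (\<forall>x \<in> set l. x = 0));
         b = (r = m \<longrightarrow> (\<forall>x \<in> set k. x = 0));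
         c = (rev (map (\<lambda>x. - int x) g) \<prec>\<^sub>m
              rev (map (\<lambda>i. int (degree (eps ! i)) - int (degree (psi ! i)) + q ! i) [0..<r]))
     in (\<forall>R :: 'a poly fract mat. R \<in> carrier_mat m n \<and> has_invariants R r eps psi q k l
           \<longrightarrow> a \<and> b \<and> c) \<and>
        ((\<forall>p :: 'a poly. degree p > 0 \<longrightarrow> (\<exists>x. poly p x = 0)) \<longrightarrow> a \<and> b \<and> c \<longrightarrow>
           (\<exists>R :: 'a poly fract mat. R \<in> carrier_mat m n \<and> has_invariants R r eps psi q k l))"
proof -
  define a where "a i = int (degree (eps ! i)) - int (degree (psi ! i)) + q ! i" for i
  define y where "y i = k ! i + l ! (r - 1 - i)" for i
  have "map2 (+) (rev k) l = rev (map y [0..<r])"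
    using assms(13,15) by (intro nth_equalityI) (auto simp: y_def rev_nth)
  then have g: "g = rev (sort (map y [0..<r]))"
    using assms(17) by (metis sort_eqI mset_rev mset_sort sorted_sort)
  note c_iff = majorized_iff_subset_sums[of y r a, folded g]
  have nec: "(r = n \<longrightarrow> (\<forall>x \<in> set l. x = 0)) \<and> (r = m \<longrightarrow> (\<forall>x \<in> set k. x = 0)) \<and>
    rev (map (\<lambda>x. - int x) g) \<prec>\<^sub>m rev (map a [0..<r])"
    if R: "R \<in> carrier_mat m n" "has_invariants R r eps psi q k l" for R :: "'a poly fract mat"
  proof -
    note N = has_invariants_necessary[OF R(1) assms(1,2) R(2) assms(5,6,11,13,15,4,14,16), folded a_def]
    have sums: "(\<Sum>i<card T. a i) \<le> (\<Sum>i\<in>T. - int (y i))" if "T \<subseteq> {..<r}" for T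
      using N(1)[OF that] by (simp add: y_def sum_negf sum_subtractf sum.distrib)
    have "(\<Sum>i<r. int (l ! (r - 1 - i))) = (\<Sum>i<r. int (l ! i))"
      using sum.nat_diff_reindex[of "\<lambda>i. int (l ! i)" r] by simp
    then have "(\<Sum>i<r. a i) = (\<Sum>i<r. - int (y i))"
      using N(2) by (simp add: y_def sum_negf sum_subtractf sum.distrib)
    then show ?thesis unfolding c_iff using N(3,4) sums by blast
  qed
  have suf: "\<exists>R :: 'a poly fract mat. R \<in> carrier_mat m n \<and> has_invariants R r eps psi q k l"
    if "\<forall>p :: 'a poly. degree p > 0 \<longrightarrow> (\<exists>x. poly p x = 0)"
      "r = n \<longrightarrow> (\<forall>x \<in> set l. x = 0)" "r = m \<longrightarrow> (\<forall>x \<in> set k. x = 0)"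
      "rev (map (\<lambda>x. - int x) g) \<prec>\<^sub>m rev (map a [0..<r])"
  proof (rule exists_with_invariants[OF that(1) assms(1-6,11,13,15,7-10,12,14,16)])
    show "(\<Sum>i<card T. int (degree (eps ! i)) - int (degree (psi ! i)) + q ! i) \<le>
      (\<Sum>i\<in>T. - int (k ! i + l ! (r - 1 - i)))" if "T \<subseteq> {..<r}" for T
      using \<open>rev _ \<prec>\<^sub>m _\<close> that unfolding c_iff a_def y_def by blast
    show "(\<Sum>i<r. int (degree (eps ! i)) - int (degree (psi ! i)) + q ! i) =
      (\<Sum>i<r. - int (k ! i + l ! (r - 1 - i)))"
      using that(4) unfolding c_iff a_def y_def by blast
  qed (use that in blast)+
  show ?thesis unfolding Let_def using nec suf unfolding a_def by blast
qed

end
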